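(* Let $(V,H,V')$ be a normal triple of Hilbert spaces. Assume that (C1) each $\mathbf M_k$, $k\ge1$, is a bounded linear operator from $H$ to $H$, and $\mathbf A$ is a bounded linear operator from $V$ to $V'$ with $$\langle\mathbf Av,v\rangle+\kappa\|v\|_V^2\le-c\|v\|_H^2\quad\text{for every }v\in V,$$ with $\kappa>0$ and $c>0$ independent of $v$; (C2) for some operator $\bar{\mathcal R}$ (system of positive uniformly bounded weights), $f\in\bar{\mathcal R}L_2(\mathbb F;L_2((0,T);H))$ for every $T>0$, and there exists $f^*\in\bar{\mathcal R}L_2(\mathbb F;H)$ such that $\lim_{t\to+\infty}\|f(t)-f^*\|_{\bar{\mathcal R}L_2(\mathbb F;H)}=0$. Then, for every $u_0\in\bar{\mathcal R}L_2(\mathbb F;H)$, there exists an operator $\mathcal R$ (system of positive uniformly bounded weights) so that (1) there exists a unique solution $u$ of $$\dot u(t)=\mathbf Au(t)+f(t)+\sum_{k\ge1}\mathbf M_ku(t)\diamond\xi_k,\quad t>0,\qquad u(0)=u_0,$$ with $u\in\mathcal RL_2(\mathbb F;L_2((0,T);V))$ for every $T>0$; (2) there exists a unique solution $u^*\in\mathcal RL_2(\mathbb F;V)$ of $$-\mathbf Au^*=f^*+\sum_{k\ge1}\mathbf M_ku^*\diamond\xi_k;$$ (3) $\displaystyle\lim_{t\to+\infty}\|u(t)-u^*\|_{\mathcal RL_2(\mathbb F;H)}=0$.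
   Context: Wiener chaos. $\mathbb F=(\Omega,\mathcal F,\mathbb P)$ is a complete probability space, $\mathcal U$ a real separable Hilbert space with orthonormal basis $\{\mathfrak u_k\}_{k\ge1}$, $\dot W=\{\dot W(h),h\in\mathcal U\}$ a zero-mean Gaussian family with $\mathbb E(\dot W(h_1)\dot W(h_2))=(h_1,h_2)_{\mathcal U}$, and $\mathcal F$ is generated by $\dot W$. Put $\xi_k=\dot W(\mathfrak u_k)$. $\mathcal J$ is the set of multi-indices $\alpha=(\alpha_1,\alpha_2,\dots)$ of non-negative integers with $|\alpha|=\sum_k\alpha_k<\infty$; $\varepsilon_k$ has $1$ in position $k$ and $0$ elsewhere. $\xi_\alpha=\prod_k H_{\alpha_k}(\xi_k)/\sqrt{\alpha_k!}$, $H_n(x)=(-1)^ne^{x^2/2}\frac{d^n}{dx^n}e^{-x^2/2}$. Weighted spaces. For positive weights $\{r_\alpha\}_{\alpha\in\mathcal J}$ (identified with the operator $\mathcal R\xi_\alpha=r_\alpha\xi_\alpha$) and a Hilbert space $X$, $\mathcal R L_2(\mathbb F;X)$ is the space of formal series $v=\sum_{\alpha}v_\alpha\xi_\alpha$, $v_\alpha\in X$, with $\|v\|^2_{\mathcal RL_2(\mathbb F;X)}=\sum_\alpha r_\alpha^2\|v_\alpha\|_X^2<\infty$. Normal triple: dense continuous embeddings $V\hookrightarrow H\hookrightarrow V'$, $V'$ is the dual of $V$ relative to the inner product of $H$ (duality $\langle\cdot,\cdot\rangle$), and $|(h,v)_H|\le C\|v\|_V\|h\|_{V'}$ for $v\in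 V,h\in H$. Solutions. $u=\sum_\alpha u_\alpha\xi_\alpha$ solves the evolution equation if every $u_\alpha$ is continuous from $[0,\infty)$ to $H$ and, in $V'$, for all $t\ge0$, $\alpha\in\mathcal J$, $$u_\alpha(t)=u_{0,\alpha}+\int_0^t\Big(\mathbf Au_\alpha(s)+f_\alpha(s)+\sum_{k\ge1}\sqrt{\alpha_k}\,\mathbf M_ku_{\alpha-\varepsilon_k}(s)\Big)ds;$$ $u^*=\sum_\alpha u^*_\alpha\xi_\alpha$ solves the stationary equation if $-\mathbf Au^*_\alpha=f^*_\alpha+\sum_{k\ge1}\sqrt{\alpha_k}\,\mathbf M_ku^*_{\alpha-\varepsilon_k}$ in $V'$ for all $\alpha$ (terms with $\alpha_k=0$ are zero). Here $u(t)=\sum_\alpha u_\alpha(t)\xi_\alpha$. *)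

theory Defs
  imports "HOL-Probability.Probability" "HOL-Library.Poly_Mapping"
begin

section \<open>Gaussian noise and Wiener chaos\<close>

definition centered_gaussian :: "'w measure \<Rightarrow> ('w \<Rightarrow> real) \<Rightarrow> bool" where
  "centered_gaussian P X \<longleftrightarrow> X \<in> borel_measurable P \<and>
     ((\<exists>\<sigma>>0. distributed P lborel X (normal_density 0 \<sigma>)) \<or> (AE \<omega> in P. X \<omega> = 0))"

text \<open>Positions of multi-indices and basis vectors are numbered from 0 instead of 1.
  A Gaussian family is one all of whose finite linear combinations are Gaussian.  Since the
  probability space is complete, ``generated by the noise'' is understood up to null sets.\<close>

locale gaussian_noise = prob_space P + complete_measure P
  for P :: "'w measure" +
  fixes W :: "'u::{real_inner, banach, second_countable_topology} \<Rightarrow> 'w \<Rightarrow> real"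
    and e :: "nat \<Rightarrow> 'u"
  assumes orthonormal: "\<And>i j. e i \<bullet> e j = (if i = j then 1 else 0)"
    and total: "closure (span (range e)) = UNIV"
    and gaussian: "\<And>F c. finite F \<Longrightarrow> centered_gaussian P (\<lambda>\<omega>. \<Sum>h\<in>F. c h * W h \<omega>)"
    and covariance: "\<And>h1 h2. expectation (\<lambda>\<omega>. W h1 \<omega> * W h2 \<omega>) = h1 \<bullet> h2"
    and generated: "sets P = sets (completion (restr_to_subalg P
      (sigma (space P) {W h -` B \<inter> space P | h B. B \<in> sets borel})))"

type_synonym multiindex = "nat \<Rightarrow>\<^sub>0 nat"

abbreviation unit_index :: "nat \<Rightarrow> multiindex" where
  "unit_index k \<equiv> Poly_Mapping.single k 1"

definition hermite :: "nat \<Rightarrow> real \<Rightarrow> real" where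
  "hermite n x = (-1) ^ n * exp (x\<^sup>2 / 2) * (deriv ^^ n) (\<lambda>y. exp (- y\<^sup>2 / 2)) x"

definition chaos_xi :: "('u \<Rightarrow> 'w \<Rightarrow> real) \<Rightarrow> (nat \<Rightarrow> 'u) \<Rightarrow> multiindex \<Rightarrow> 'w \<Rightarrow> real" where
  "chaos_xi W e \<alpha> \<omega> =
     (\<Prod>k\<in>Poly_Mapping.keys \<alpha>. hermite (Poly_Mapping.lookup \<alpha> k) (W (e k) \<omega>) / sqrt (fact (Poly_Mapping.lookup \<alpha> k)))"

section \<open>Weighted chaos spaces\<close>

text \<open>A formal series \<open>\<Sum>\<^sub>\<alpha> v\<^sub>\<alpha> \<xi>\<^sub>\<alpha>\<close>, with \<open>\<xi>\<^sub>\<alpha> = chaos_xi W e \<alpha>\<close>, is the family of its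
  coefficients; no convergence in the probability space is involved.\<close>

type_synonym 'x chaos_series = "multiindex \<Rightarrow> 'x"

definition bounded_weights :: "(multiindex \<Rightarrow> real) \<Rightarrow> bool" where
  "bounded_weights r \<longleftrightarrow> (\<forall>\<alpha>. 0 < r \<alpha>) \<and> (\<exists>B. \<forall>\<alpha>. r \<alpha> \<le> B)"

text \<open>The coefficient space is given by a carrier \<open>X\<close> and a norm \<open>N\<close> on it, so that it can
  also be a space of functions of time.\<close>

definition RL2_space ::
    "(multiindex \<Rightarrow> real) \<Rightarrow> 'x set \<Rightarrow> ('x \<Rightarrow> real) \<Rightarrow> 'x chaos_series set" where
  "RL2_space r X N =
     {v. (\<forall>\<alpha>. v \<alpha> \<in> X) \<and> (\<lambda>\<alpha>. (r \<alpha>)\<^sup>2 * (N (v \<alpha>))\<^sup>2) summable_on UNIV}"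

definition RL2_norm ::
    "(multiindex \<Rightarrow> real) \<Rightarrow> ('x \<Rightarrow> real) \<Rightarrow> 'x chaos_series \<Rightarrow> real" where
  "RL2_norm r N v = sqrt (\<Sum>\<^sub>\<infinity>\<alpha>. (r \<alpha>)\<^sup>2 * (N (v \<alpha>))\<^sup>2)"

text \<open>Eventual membership is part of convergence, because a divergent \<open>infsum\<close> equals 0.\<close>

definition RL2_tendsto_at_top ::
    "(multiindex \<Rightarrow> real) \<Rightarrow> (multiindex \<Rightarrow> real \<Rightarrow> 'x::real_normed_vector)
       \<Rightarrow> 'x chaos_series \<Rightarrow> bool" where
  "RL2_tendsto_at_top r u v \<longleftrightarrow>
     (\<forall>\<^sub>F t in at_top. (\<lambda>\<alpha>. u \<alpha> t - v \<alpha>) \<in> RL2_space r UNIV norm) \<and>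
     ((\<lambda>t. RL2_norm r norm (\<lambda>\<alpha>. u \<alpha> t - v \<alpha>)) \<longlongrightarrow> 0) at_top"

section \<open>Square-integrable functions of time\<close>

text \<open>Strong (Bochner) measurability; the Hilbert spaces need not be separable.\<close>

definition strongly_measurable :: "'s measure \<Rightarrow> ('s \<Rightarrow> 'x::real_normed_vector) \<Rightarrow> bool" where
  "strongly_measurable M g \<longleftrightarrow>
     (\<exists>s. (\<forall>n. simple_function M (s n)) \<and> (AE x in M. (\<lambda>n::nat. s n x) \<longlonglongrightarrow> g x))"

definition L2_space :: "real \<Rightarrow> (real \<Rightarrow> 'x::real_normed_vector) set" where
  "L2_space T = {g. strongly_measurable (lebesgue_on {0<..<T}) g \<and>
     integrable (lebesgue_on {0<..<T}) (\<lambda>s. (norm (g s))\<^sup>2)}"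

definition L2_norm :: "real \<Rightarrow> (real \<Rightarrow> 'x::real_normed_vector) \<Rightarrow> real" where
  "L2_norm T g = sqrt (LINT s|lebesgue_on {0<..<T}. (norm (g s))\<^sup>2)"

section \<open>Normal triples\<close>

text \<open>The inclusions of \<open>V\<close> in \<open>H\<close> and of \<open>H\<close> in \<open>V'\<close> are the injections \<open>iV\<close> and \<open>iH\<close>;
  \<open>pair\<close> is the duality between \<open>V'\<close> and \<open>V\<close>.  The norm of \<open>V'\<close> need only be equivalent to
  the dual norm.\<close>

locale normal_triple =
  fixes iV :: "'v::{real_inner, banach} \<Rightarrow> 'h::{real_inner, banach}"
    and iH :: "'h \<Rightarrow> 'd::{real_inner, banach}"
    and pair :: "'d \<Rightarrow> 'v \<Rightarrow> real"
  assumes V_embedding: "bounded_linear iV" "inj iV" "closure (range iV) = UNIV"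
    and H_embedding: "bounded_linear iH" "inj iH" "closure (range iH) = UNIV"
    and pair_bilinear: "bounded_bilinear pair"
    and pair_inner: "\<And>h v. pair (iH h) v = h \<bullet> iV v"
    and dual: "\<And>\<phi>. bounded_linear \<phi> \<Longrightarrow> \<exists>!w. \<forall>v. pair w v = \<phi> v"
    and inner_bound: "\<exists>C. \<forall>h v. \<bar>h \<bullet> iV v\<bar> \<le> C * norm v * norm (iH h)"

text \<open>Square-integrable \<open>V\<close>-valued functions, regarded as functions with values in \<open>H\<close> that
  belong to \<open>V\<close> for almost every time; \<open>inv iV\<close> recovers the element of \<open>V\<close>.\<close>

definition L2V_space :: "('v::real_normed_vector \<Rightarrow> 'h) \<Rightarrow> real \<Rightarrow> (real \<Rightarrow> 'h) set" where
  "L2V_space iV T = {g. (AE s in lebesgue_on {0<..<T}. g s \<in> range iV) \<and>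
     (\<lambda>s. inv iV (g s)) \<in> L2_space T}"

definition L2V_norm :: "('v::real_normed_vector \<Rightarrow> 'h) \<Rightarrow> real \<Rightarrow> (real \<Rightarrow> 'h) \<Rightarrow> real" where
  "L2V_norm iV T g = L2_norm T (\<lambda>s. inv iV (g s))"

section \<open>Solutions\<close>

text \<open>The coefficient at \<open>\<alpha>\<close> of \<open>\<Sum>\<^sub>k M\<^sub>k u \<diamond> \<xi>\<^sub>k\<close>; terms with \<open>\<alpha>\<^sub>k = 0\<close> vanish.\<close>

definition wick_coeff ::
    "(nat \<Rightarrow> 'h \<Rightarrow> 'h::real_normed_vector) \<Rightarrow> 'h chaos_series \<Rightarrow> 'h chaos_series" where
  "wick_coeff M u \<alpha> =
     (\<Sum>k\<in>Poly_Mapping.keys \<alpha>. sqrt (real (Poly_Mapping.lookup \<alpha> k)) *\<^sub>R M k (u (\<alpha> - unit_index k)))"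

text \<open>On integrands that are strongly measurable with integrable norm, as is the case for
  solutions with square-integrable coefficients in \<open>V\<close>, the Henstock--Kurzweil integral
  is the Bochner integral in \<open>V'\<close>.\<close>

definition evolution_solution ::
    "('v::{real_inner, banach} \<Rightarrow> 'h::{real_inner, banach}) \<Rightarrow> ('h \<Rightarrow> 'd::{real_inner, banach})
       \<Rightarrow> ('v \<Rightarrow> 'd) \<Rightarrow> (nat \<Rightarrow> 'h \<Rightarrow> 'h)
       \<Rightarrow> (real \<Rightarrow> 'h) chaos_series \<Rightarrow> 'h chaos_series \<Rightarrow> (real \<Rightarrow> 'h) chaos_series \<Rightarrow> bool" where
  "evolution_solution iV iH A M f u0 u \<longleftrightarrow>
     (\<forall>\<alpha>. continuous_on {0..} (u \<alpha>) \<and>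
       (\<forall>t\<ge>0. \<exists>I. ((\<lambda>s. A (inv iV (u \<alpha> s)) + iH (f \<alpha> s)
                           + iH (wick_coeff M (\<lambda>\<beta>. u \<beta> s) \<alpha>)) has_integral I) {0..t} \<and>
                  iH (u \<alpha> t) = iH (u0 \<alpha>) + I))"

definition stationary_solution ::
    "('v::{real_inner, banach} \<Rightarrow> 'h::{real_inner, banach}) \<Rightarrow> ('h \<Rightarrow> 'd::{real_inner, banach})
       \<Rightarrow> ('v \<Rightarrow> 'd) \<Rightarrow> (nat \<Rightarrow> 'h \<Rightarrow> 'h)
       \<Rightarrow> 'h chaos_series \<Rightarrow> 'v chaos_series \<Rightarrow> bool" where
  "stationary_solution iV iH A M f u \<longleftrightarrow>
     (\<forall>\<alpha>. - A (u \<alpha>) = iH (f \<alpha>) + iH (wick_coeff M (\<lambda>\<beta>. iV (u \<beta>)) \<alpha>))"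

end

theory Submission
  imports Defs
begin

text \<open>
  Riesz representation identifies \<open>V'\<close> with \<open>V\<close>; writing \<open>j\<close> for the embedding of \<open>V\<close> in
  \<open>V'\<close>, the homogeneous equation is \<open>(j u)' = A u\<close>.  It is regularised to
  \<open>(j + \<epsilon>\<^sup>2) u' = A u\<close>, a linear equation with a bounded operator on \<open>V\<close>, whose solutions
  converge in \<open>V\<close>, locally uniformly in time, when \<open>A u(0) \<in> H\<close>.  Since \<open>A\<close> is invertible,
  a source \<open>t\<^sup>k h\<close> has a particular solution polynomial in time.  The
  energy estimate and the density of polynomials in \<open>L\<^sub>2((0,T);H)\<close> then give solutions for all
  data, and, applied to \<open>u - u\<^sup>*\<close>, the convergence \<open>u\<^sub>\<alpha>(t) \<rightarrow> u\<^sup>*\<^sub>\<alpha>\<close> for each \<open>\<alpha>\<close>.  The system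
  of equations for the coefficients is lower triangular and is solved by recursion on
  \<open>|\<alpha>|\<close>.  As there are countably many multi-indices, the weights can be chosen after the
  coefficients are known, which reduces the statements in the weighted spaces to the
  coefficientwise ones by dominated convergence.
\<close>

section \<open>Coercive operators and operator exponentials\<close>

text \<open>The embedding j of V in V' is in general not boundedly invertible, so j u' = A u is no
  differential equation with a bounded right-hand side; j + \<epsilon>^2 is coercive, hence
  invertible, and A stays dissipative for the inner product it defines. What must be independent of
  \<epsilon> is the bound on u': u' solves the same equation, and A u(0) in H bounds its initial
  energy. Density of such initial values and of polynomial sources replaces semigroup theory and the
  Duhamel formula. A limit solution has values in V only at almost every time, and no energy
  identity is proved for it. Energy bounds hold for solutions continuous in V and survive the limit
  as inequalities; uniqueness, which offers no approximations, goes through the primitive in time.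
  As the spaces need not be separable, integrals in V' are gauge integrals, and limits are taken in
  their Riemann sums. No bound on the operators M_k uniform in k is assumed, so the coefficients may
  grow arbitrarily fast with \<alpha>; this is why the weights are chosen last.\<close>

lemma riesz_representation:
  fixes \<phi> :: "'a::{real_inner, banach} \<Rightarrow> real"
  assumes "bounded_linear \<phi>"
  obtains x where "\<And>v. \<phi> v = x \<bullet> v"
proof -
  interpret bounded_linear \<phi> by fact
  obtain C where C: "\<And>v. norm (\<phi> v) \<le> norm v * C" using bounded by blast
  define J where "J v = v \<bullet> v - 2 * \<phi> v" for v
  have low: "- C\<^sup>2 \<le> J v" for v
  proof -
    have "\<phi> v \<le> norm v * C" using C[of v] by auto
    moreover have "0 \<le> (norm v - C)\<^sup>2" by simp
    ultimately show ?thesis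
      unfolding J_def power2_norm_eq_inner[symmetric] by (simp add: power2_eq_square algebra_simps)
  qed
  define m where "m = Inf (range J)"
  have bdd: "bdd_below (range J)" using low by (auto intro!: bdd_belowI)
  have m_le: "m \<le> J v" for v unfolding m_def using bdd by (auto intro: cInf_lower)
  \<comment> \<open>The parallelogram law in terms of \<open>J\<close>: two points with values near
    the infimum \<open>m\<close> are close to each other, because the value at their midpoint is at
    least \<open>m\<close>.\<close>
  have par: "(norm (v - w))\<^sup>2 = 2 * (J v + J w) - 4 * J ((1/2) *\<^sub>R (v + w))" for v w
    unfolding J_def power2_norm_eq_inner
    by (simp add: scaleR add inner_add_left inner_add_right inner_diff_left inner_diff_right
        inner_commute algebra_simps)
  have "\<exists>v. J v < m + 1 / (real n + 1)" for n
    using cInf_less_iff[of "range J" "m + 1 / (real n + 1)"] bdd unfolding m_def by auto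
  then obtain s where s: "\<And>n::nat. J (s n) < m + 1 / (real n + 1)" by metis
  have "Cauchy s"
  proof (rule metric_CauchyI)
    fix e :: real assume "0 < e"
    then obtain N :: nat where N: "4 / e\<^sup>2 < real N" using reals_Archimedean2 by blast
    have "dist (s p) (s q) < e" if "p \<ge> N" "q \<ge> N" for p q
    proof -
      have N0: "0 < real N" using N \<open>0 < e\<close> by (smt (verit) zero_le_divide_iff zero_le_power2)
      have b: "1 / (real i + 1) < 1 / real N" if "i \<ge> N" for i
        using that N0 by (intro divide_strict_left_mono) auto
      have "(norm (s p - s q))\<^sup>2 < 4 / real N"
        using par[of "s p" "s q"] s[of p] s[of q] m_le[of "(1/2) *\<^sub>R (s p + s q)"] b[OF that(1)] b[OF that(2)]
        by simp
      also have "\<dots> < e\<^sup>2" using N N0 \<open>0 < e\<close> by (simp add: field_simps)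
      finally show ?thesis using \<open>0 < e\<close> by (simp add: dist_norm power2_less_imp_less)
    qed
    then show "\<exists>N. \<forall>p\<ge>N. \<forall>q\<ge>N. dist (s p) (s q) < e" by blast
  qed
  then obtain x where x: "s \<longlonglongrightarrow> x" using Cauchy_convergent convergent_def by blast
  have Jx: "J x \<le> m"
  proof (rule tendsto_le)
    show "(\<lambda>n. J (s n)) \<longlonglongrightarrow> J x" unfolding J_def by (intro tendsto_intros x tendsto)
    have "(\<lambda>n. 1 / (real n + 1)) \<longlonglongrightarrow> 0"
      using LIMSEQ_inverse_real_of_nat by (simp add: inverse_eq_divide add.commute)
    then show "(\<lambda>n. m + 1 / (real n + 1)) \<longlonglongrightarrow> m"
      using tendsto_add[OF tendsto_const] by fastforce
    show "\<forall>\<^sub>F n in sequentially. J (s n) \<le> m + 1 / (real n + 1)"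
      using s by (intro always_eventually allI) (rule less_imp_le)
  qed simp
  have "\<phi> v = x \<bullet> v" for v
  proof (rule ccontr)
    define b where "b = x \<bullet> v - \<phi> v"
    assume "\<phi> v \<noteq> x \<bullet> v"
    then have b: "b \<noteq> 0" by (simp add: b_def)
    \<comment> \<open>First variation in direction v with step - b / n. The summand 1 keeps
      \<open>n\<close> positive when v = 0, and the quadratic term is at most half of the linear
      gain.\<close>
    define n where "n = v \<bullet> v + 1"
    have n: "0 < n" unfolding n_def by (simp add: add_nonneg_pos)
    have "J x \<le> J (x + (- b / n) *\<^sub>R v)" using m_le Jx order_trans by blast
    moreover have "J (x + r *\<^sub>R v) = J x + (r\<^sup>2 * (v \<bullet> v) + 2 * r * b)" for r
      unfolding J_def b_def
      by (simp add: add scaleR inner_add_left inner_add_right inner_commute power2_eq_square algebra_simps)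
    ultimately have "0 \<le> (- b / n)\<^sup>2 * (v \<bullet> v) + 2 * (- b / n) * b" 
      by (metis (no_types) le_add_same_cancel1)
    also have "\<dots> \<le> (- b / n)\<^sup>2 * n + 2 * (- b / n) * b"
      by (intro add_right_mono mult_left_mono) (auto simp: n_def)
    also have "\<dots> = - (b\<^sup>2 / n)" using n by (simp add: field_simps power2_eq_square)
    also have "\<dots> < 0" using b n by simp
    finally show False by simp
  qed
  then show ?thesis using that by blast
qed

text \<open>Lax-Milgram in operator form. Solving T x = y means finding a fixed point of v - \<rho>
  (T v - y), and coercivity makes this map a contraction for small \<rho>; the lower bound k |v|
  \<le> |T v| gives injectivity and bounds the inverse by 1 / k.\<close>

lemma coercive_bijective:
  fixes T :: "'a::{real_inner, banach} \<Rightarrow> 'a"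
  assumes T: "bounded_linear T" and k: "0 < k" and coer: "\<And>v. k * (norm v)\<^sup>2 \<le> T v \<bullet> v"
  shows "bij T" and "bounded_linear (inv T)"
proof -
  interpret bounded_linear T by fact
  have low: "k * norm v \<le> norm (T v)" for v
  proof (cases "v = 0")
    case False
    have "k * norm v * norm v \<le> norm (T v) * norm v"
      using coer[of v] norm_cauchy_schwarz[of "T v" v] by (simp add: power2_eq_square)
    then show ?thesis using False by simp
  qed auto
  obtain C0 where C0: "\<And>v. norm (T v) \<le> norm v * C0" using bounded by blast
  \<comment> \<open>The maximum with \<open>k\<close> ensures 0 < C and k \<le> C, so that
    \<open>q\<close> is the square root of a number in [0,1).\<close>
  define C where "C = max k C0"
  have C: "norm (T v) \<le> C * norm v" "0 < C" "k \<le> C" for v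
    using C0[of v] k mult_left_mono[of C0 C "norm v"] by (auto simp: C_def mult.commute)
  have inj: "inj T"
  proof (rule injI)
    fix x y assume "T x = T y"
    then show "x = y" using low[of "x - y"] k by (simp add: diff mult_le_0_iff)
  qed
  \<comment> \<open>The squared contraction factor is at most 1 - 2 \<rho> k + \<rho>^2 C^2; the
    choice k / C^2 minimises this, with value 1 - k^2 / C^2.\<close>
  define \<rho> where "\<rho> = k / C\<^sup>2"
  define q where "q = sqrt (1 - k\<^sup>2 / C\<^sup>2)"
  have kC: "k\<^sup>2 \<le> C\<^sup>2" using C k by (simp add: power_mono)
  have q: "0 \<le> q" "q < 1" using kC C k by (auto simp: q_def field_simps)
  have "\<exists>x. T x = y" for y
  proof -
    define S where "S v = v - \<rho> *\<^sub>R (T v - y)" for v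
    have "dist (S v) (S w) \<le> q * dist v w" for v w
    proof -
      define d where "d = v - w"
      have "S v - S w = d - \<rho> *\<^sub>R T d"
        unfolding S_def d_def by (simp add: diff algebra_simps)
      then have "(norm (S v - S w))\<^sup>2 = (norm (d - \<rho> *\<^sub>R T d))\<^sup>2" by simp
      also have "\<dots> = (norm d)\<^sup>2 - 2 * \<rho> * (T d \<bullet> d) + \<rho>\<^sup>2 * (norm (T d))\<^sup>2"
        unfolding power2_norm_eq_inner
        by (simp add: inner_diff_left inner_diff_right inner_commute power2_eq_square algebra_simps)
      also have "\<dots> \<le> (norm d)\<^sup>2 - 2 * \<rho> * (k * (norm d)\<^sup>2) + \<rho>\<^sup>2 * (C * norm d)\<^sup>2"
        using coer[of d] C k
        by (intro add_mono diff_mono mult_left_mono power_mono) (auto simp: \<rho>_def)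
      also have "\<dots> = (1 - k\<^sup>2 / C\<^sup>2) * (norm d)\<^sup>2"
        using C by (simp add: \<rho>_def field_simps power2_eq_square)
      also have "\<dots> = (q * norm d)\<^sup>2"
        using kC C by (simp add: q_def power_mult_distrib)
      finally have "norm (S v - S w) \<le> q * norm d"
        using q by (meson mult_nonneg_nonneg norm_ge_zero power2_le_imp_le)
      then show ?thesis by (simp add: dist_norm d_def)
    qed
    then have "\<exists>!x. S x = x"
      using q by (intro banach_fix_type[of q]) auto
    then obtain x where "S x = x" by blast
    then have "\<rho> *\<^sub>R (T x - y) = 0" by (simp add: S_def)
    then have "T x = y" using k C by (simp add: \<rho>_def)
    then show ?thesis ..
  qed
  then have "surj T" by (metis surjI)
  with inj show "bij T" by (simp add: bij_def)
  have TI: "T (inv T y) = y" for y using \<open>surj T\<close> by (simp add: surj_f_inv_f)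
  have IT: "inv T (T x) = x" for x using inj by simp
  show "bounded_linear (inv T)"
  proof (rule bounded_linear_intro)
    show "inv T (x + y) = inv T x + inv T y" for x y by (metis IT TI add)
    show "inv T (r *\<^sub>R x) = r *\<^sub>R inv T x" for r x by (metis IT TI scaleR)
    show "norm (inv T y) \<le> norm y * (1 / k)" for y
      using low[of "inv T y"] k by (simp add: TI field_simps)
  qed
qed

text \<open>The vector exp(t K) x as a power series at x, so that \<open>K\<close> can stay a plain
  function and no algebra of bounded operators enters.\<close>

definition op_exp :: "('a \<Rightarrow> 'a) \<Rightarrow> 'a::{real_normed_vector} \<Rightarrow> real \<Rightarrow> 'a" where
  "op_exp K x t = suminf (\<lambda>n. (t ^ n / fact n) *\<^sub>R (K ^^ n) x)"

context
  fixes K :: "'a::banach \<Rightarrow> 'a"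
  assumes K: "bounded_linear K"
begin

interpretation bounded_linear K by (rule K)

lemma op_exp_bound: "\<exists>C\<ge>0. \<forall>n x. norm ((K ^^ n) x) \<le> C ^ n * norm x"
proof -
  obtain C where C: "C > 0" "\<And>v. norm (K v) \<le> norm v * C" using pos_bounded by blast
  have "norm ((K ^^ n) x) \<le> C ^ n * norm x" for n x
  proof (induction n)
    case (Suc n)
    have "norm ((K ^^ Suc n) x) \<le> C * norm ((K ^^ n) x)" using C(2)[of "(K ^^ n) x"] by (simp add: mult.commute)
    also have "\<dots> \<le> C * (C ^ n * norm x)" using Suc C by (intro mult_left_mono) auto
    finally show ?case by simp
  qed simp
  then show ?thesis using C by (intro exI[of _ C]) auto
qed

lemma op_exp_summable: "summable (\<lambda>n. (t ^ n / fact n) *\<^sub>R (K ^^ n) x)"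
proof -
  obtain C where C: "C \<ge> 0" "\<And>n x. norm ((K ^^ n) x) \<le> C ^ n * norm x" using op_exp_bound by blast
  have "summable (\<lambda>n. (inverse (fact n) * (\<bar>t\<bar> * C) ^ n) * norm x)"
    by (intro summable_mult2 summable_exp)
  then show ?thesis
  proof (rule summable_comparison_test')
    fix n
    show "norm ((t ^ n / fact n) *\<^sub>R (K ^^ n) x) \<le> (inverse (fact n) * (\<bar>t\<bar> * C) ^ n) * norm x"
      using mult_left_mono[OF C(2)[of n x], of "\<bar>t\<bar> ^ n / fact n"]
      by (simp add: power_abs power_mult_distrib field_simps)
  qed
qed

lemma op_exp_0: "op_exp K x 0 = x"
  unfolding op_exp_def by (subst suminf_finite[of "{0}"]) (auto simp: power_0_left)

lemma op_exp_commute: "K (op_exp K x t) = op_exp K (K x) t"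
  unfolding op_exp_def suminf[OF op_exp_summable]
  by (simp add: scaleR funpow_swap1)

text \<open>Termwise differentiation: the derivative of the n-th term is \<open>K\<close> applied to
  the preceding one, so the differentiated series is \<open>K\<close> applied to the original. It
  converges uniformly on bounded intervals by comparison with a scalar exponential series.\<close>

lemma op_exp_has_vector_derivative:
  "(op_exp K x has_vector_derivative K (op_exp K x t)) (at t)"
proof -
  obtain C where C: "C \<ge> 0" "\<And>n x. norm ((K ^^ n) x) \<le> C ^ n * norm x" using op_exp_bound by blast
  \<comment> \<open>The summand 1 puts t in the interior of [-T, T], where the derivative within the
    interval is the full derivative.\<close>
  define T where "T = \<bar>t\<bar> + 1"
  define f where "f n t = (t ^ n / fact n) *\<^sub>R (K ^^ n) x" for n t
  \<comment> \<open>The index shift of the differentiated series; the constant term contributes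
    0.\<close>
  define f' where "f' n t = (case n of 0 \<Rightarrow> 0 | Suc m \<Rightarrow> f m t)" for n t
  define f'K where "f'K n t h = h *\<^sub>R (case n of 0 \<Rightarrow> 0 | Suc m \<Rightarrow> (t ^ m / fact m) *\<^sub>R (K ^^ n) x)" for n t h
  define m where "m n = (case n of 0 \<Rightarrow> 0 | Suc i \<Rightarrow> (inverse (fact i) * (T * C) ^ i) * (C * norm x))" for n
  have dK: "f'K n t h = h *\<^sub>R K (f' n t)" for n t h
    by (cases n) (auto simp: f'K_def f'_def f_def scaleR zero)
  have sm: "summable m"
  proof -
    have "summable (\<lambda>i. m (Suc i))" unfolding m_def by simp (intro summable_mult2 summable_exp)
    then show ?thesis using summable_Suc_iff by blast
  qed
  have der: "(f n has_derivative f'K n s) (at s within {-T..T})" for n s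
  proof (cases n)
    case 0 then show ?thesis by (simp add: f_def[abs_def] f'K_def[abs_def])
  next
    case (Suc i)
    have "((\<lambda>t. t ^ n / fact n) has_real_derivative (s ^ i / fact i)) (at s within {-T..T})"
      unfolding Suc by (rule derivative_eq_intros refl | simp add: fact_Suc del: of_nat_Suc)+
    then have "((\<lambda>t. (t ^ n / fact n) *\<^sub>R (K ^^ n) x) has_derivative (\<lambda>h. (h * (s ^ i / fact i)) *\<^sub>R (K ^^ n) x)) (at s within {-T..T})"
      unfolding has_field_derivative_def mult.commute[of _ "s ^ i / fact i"]
      by (rule has_derivative_scaleR_left)
    then show ?thesis unfolding f_def f'K_def Suc by simp
  qed
  have bnd: "norm (f'K n s 1) \<le> m n" if "s \<in> {-T..T}" for n s
  proof (cases n)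
    case (Suc i)
    have "\<bar>s\<bar> ^ i \<le> T ^ i" using that by (intro power_mono) auto
    then have "(\<bar>s\<bar> ^ i / fact i) * norm ((K ^^ n) x) \<le> (T ^ i / fact i) * (C ^ n * norm x)"
      using C(2)[of n x] C(1) by (intro mult_mono divide_right_mono) (auto simp: T_def)
    then show ?thesis by (simp add: f'K_def m_def Suc power_abs power_mult_distrib field_simps)
  qed (simp add: f'K_def m_def)
  have ul: "uniform_limit {-T..T} (\<lambda>N s. \<Sum>i<N. f'K i s 1) (\<lambda>s. suminf (\<lambda>i. f'K i s 1)) sequentially"
    by (rule Weierstrass_m_test[OF bnd sm])
  have "\<exists>g. \<forall>s\<in>{-T..T}. (\<lambda>n. f n s) sums (g s) \<and> (g has_derivative (\<lambda>h. h *\<^sub>R suminf (\<lambda>i. f'K i s 1))) (at s within {-T..T})"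
  proof (rule has_derivative_series[where f' = f'K])
    show "convex {-T..T}" by simp
    show "(f n has_derivative f'K n s) (at s within {-T..T})" for n s by (rule der)
    show "\<forall>\<^sub>F n in sequentially. \<forall>s\<in>{-T..T}. \<forall>h. norm ((\<Sum>i<n. f'K i s h) - h *\<^sub>R suminf (\<lambda>i. f'K i s 1)) \<le> e * norm h"
      if "0 < e" for e
    proof -
      have "\<forall>\<^sub>F n in sequentially. \<forall>s\<in>{-T..T}. dist (\<Sum>i<n. f'K i s 1) (suminf (\<lambda>i. f'K i s 1)) < e"
        using ul that unfolding uniform_limit_iff by blast
      then show ?thesis
      proof eventually_elim
        case (elim n)
        show ?case
        proof (intro ballI allI)
          fix s h assume s: "s \<in> {-T..T}"
          have "(\<Sum>i<n. f'K i s h) = h *\<^sub>R (\<Sum>i<n. f'K i s 1)" by (simp add: dK scaleR_sum_right)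
          then have "norm ((\<Sum>i<n. f'K i s h) - h *\<^sub>R suminf (\<lambda>i. f'K i s 1)) = norm h * norm ((\<Sum>i<n. f'K i s 1) - suminf (\<lambda>i. f'K i s 1))"
            by (metis norm_scaleR real_norm_def scaleR_right_diff_distrib)
          also have "\<dots> \<le> norm h * e"
            using elim s by (intro mult_left_mono) (auto simp: dist_norm intro: less_imp_le)
          finally show "norm ((\<Sum>i<n. f'K i s h) - h *\<^sub>R suminf (\<lambda>i. f'K i s 1)) \<le> e * norm h"
            by (simp add: mult.commute)
        qed
      qed
    qed
    show "0 \<in> {-T..T}" by (simp add: T_def)
    show "(\<lambda>n. f n 0) sums (op_exp K x 0)"
      unfolding f_def op_exp_def by (rule summable_sums[OF op_exp_summable])
  qed
  then obtain g where g: "\<And>s. s \<in> {-T..T} \<Longrightarrow> (\<lambda>n. f n s) sums (g s)"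
    "\<And>s. s \<in> {-T..T} \<Longrightarrow> (g has_derivative (\<lambda>h. h *\<^sub>R suminf (\<lambda>i. f'K i s 1))) (at s within {-T..T})" by blast
  have ge: "g s = op_exp K x s" if "s \<in> {-T..T}" for s
    using g(1)[OF that] unfolding op_exp_def f_def by (simp add: sums_iff)
  have t: "t \<in> interior {-T..T}" "t \<in> {-T..T}" unfolding T_def by (auto simp: interior_atLeastAtMost_real)
  have "(\<lambda>i. f' (Suc i) t) sums op_exp K x t"
    unfolding f'_def f_def op_exp_def by (simp, rule summable_sums[OF op_exp_summable])
  then have "(\<lambda>i. K (f' (Suc i) t)) sums K (op_exp K x t)" by (rule sums)
  then have "(\<lambda>i. K (f' i t)) sums K (op_exp K x t)"
    by (subst (asm) sums_Suc_iff) (simp add: f'_def zero)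
  then have e: "suminf (\<lambda>i. f'K i t 1) = K (op_exp K x t)" by (simp add: dK sums_iff)
  have "(g has_derivative (\<lambda>h. h *\<^sub>R K (op_exp K x t))) (at t within {-T..T})"
    using g(2)[OF t(2)] e by simp
  then have "(op_exp K x has_derivative (\<lambda>h. h *\<^sub>R K (op_exp K x t))) (at t within {-T..T})"
    using has_derivative_transform[OF t(2), of "op_exp K x" g] ge by simp
  then show ?thesis
    unfolding has_vector_derivative_def at_within_interior[OF t(1)] .
qed

end

text \<open>Every Riemann sum of F - G is bounded in norm by the corresponding Riemann sum of h,
  which is close to i. This passes integrated equations to the limit in a general normed space
  without speaking of measurability of the limit G.\<close>

lemma has_integral_approximation:
  fixes G :: "'a::euclidean_space \<Rightarrow> 'b::real_normed_vector"
  assumes N: "negligible N"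
    and ap: "\<And>e. 0 < e \<Longrightarrow> \<exists>F I h i. (F has_integral I) (cbox a b) \<and> norm (I - J) \<le> e \<and>
        (h has_integral i) (cbox a b) \<and> i \<le> (e::real) \<and> (\<forall>x\<in>cbox a b - N. norm (F x - G x) \<le> h x)"
  shows "(G has_integral J) (cbox a b)"
  unfolding has_integral
proof (intro allI impI)
  fix e :: real assume "0 < e"
  then obtain F I h i where F: "(F has_integral I) (cbox a b)" and I: "norm (I - J) \<le> e / 5"
    and h: "(h has_integral i) (cbox a b)" and i: "i \<le> e / 5"
    and le: "\<And>x. x \<in> cbox a b \<Longrightarrow> x \<notin> N \<Longrightarrow> norm (F x - G x) \<le> h x"
    using ap[of "e/5"] by auto
  \<comment> \<open>On \<open>N\<close> nothing relates F - G to h, so the error itself is taken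
    there; a change on a negligible set leaves the integral \<open>i\<close>.\<close>
  define k where "k x = (if x \<in> N then norm (F x - G x) else h x)" for x
  have k: "(k has_integral i) (cbox a b)"
    by (rule has_integral_spike[OF N _ h]) (auto simp: k_def)
  have lek: "norm (F x - G x) \<le> k x" if "x \<in> cbox a b" for x using le that by (auto simp: k_def)
  obtain \<gamma>1 where g1: "gauge \<gamma>1" "\<And>D. D tagged_division_of cbox a b \<Longrightarrow> \<gamma>1 fine D \<Longrightarrow>
      norm ((\<Sum>(x,k)\<in>D. measure lborel k *\<^sub>R F x) - I) < e / 5"
    using F \<open>0 < e\<close> unfolding has_integral by (metis zero_less_divide_iff zero_less_numeral)
  obtain \<gamma>2 where g2: "gauge \<gamma>2" "\<And>D. D tagged_division_of cbox a b \<Longrightarrow> \<gamma>2 fine D \<Longrightarrow>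
      norm ((\<Sum>(x,l)\<in>D. measure lborel l *\<^sub>R k x) - i) < e / 5"
    using k \<open>0 < e\<close> unfolding has_integral by (metis zero_less_divide_iff zero_less_numeral)
  show "\<exists>\<gamma>. gauge \<gamma> \<and> (\<forall>D. D tagged_division_of cbox a b \<and> \<gamma> fine D \<longrightarrow>
      norm ((\<Sum>(x,k)\<in>D. measure lborel k *\<^sub>R G x) - J) < e)"
  proof (intro exI[of _ "\<lambda>x. \<gamma>1 x \<inter> \<gamma>2 x"] conjI allI impI)
    show "gauge (\<lambda>x. \<gamma>1 x \<inter> \<gamma>2 x)" using g1 g2 by (simp add: gauge_Int)
    fix D assume D: "D tagged_division_of cbox a b \<and> (\<lambda>x. \<gamma>1 x \<inter> \<gamma>2 x) fine D"
    then have fine: "\<gamma>1 fine D" "\<gamma>2 fine D" by (auto simp: fine_Int)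
    let ?SF = "\<Sum>(x,k)\<in>D. measure lborel k *\<^sub>R F x"
    let ?SG = "\<Sum>(x,k)\<in>D. measure lborel k *\<^sub>R G x"
    let ?Sk = "\<Sum>(x,l)\<in>D. measure lborel l *\<^sub>R k x"
    have "norm (?SF - ?SG) = norm (\<Sum>(x,l)\<in>D. measure lborel l *\<^sub>R (F x - G x))"
      by (simp add: sum_subtractf[symmetric] case_prod_unfold scaleR_diff_right)
    also have "\<dots> \<le> (\<Sum>(x,l)\<in>D. norm (measure lborel l *\<^sub>R (F x - G x)))"
      by (rule order_trans[OF norm_sum]) (simp add: case_prod_unfold)
    also have "\<dots> \<le> ?Sk"
    proof (rule sum_mono, clarify)
      fix x l assume "(x, l) \<in> D"
      then have "x \<in> cbox a b" using D by (meson tag_in_interval)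
      then show "norm (measure lborel l *\<^sub>R (F x - G x)) \<le> measure lborel l *\<^sub>R k x"
        using lek by (auto intro!: mult_left_mono)
    qed
    finally have 1: "norm (?SF - ?SG) \<le> ?Sk" .
    have 2: "norm (?SF - I) < e / 5" "norm (?Sk - i) < e / 5" using g1 g2 D fine by blast+
    \<comment> \<open>Four shares of e / 5: two for the first term, as ?Sk is below i + e / 5, and
      one for each of the others.\<close>
    have "norm (?SG - J) \<le> norm (?SF - ?SG) + norm (?SF - I) + norm (I - J)"
      using norm_triangle_ineq4[of "?SF - J" "?SF - ?SG"] norm_triangle_ineq[of "?SF - I" "I - J"] by simp
    also have "\<dots> < e" using 1 2 I i unfolding real_norm_def by linarith
    finally show "norm (?SG - J) < e" .
  qed
qed

section \<open>Calculus on the half-line\<close>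

lemma nonpos_derivative_imp_le:
  fixes \<phi> :: "real \<Rightarrow> real"
  assumes d: "\<And>s. 0 \<le> s \<Longrightarrow> (\<phi> has_real_derivative \<phi>' s) (at s within {0..})"
    and n: "\<And>s. 0 \<le> s \<Longrightarrow> \<phi>' s \<le> 0" and t: "0 \<le> t"
  shows "\<phi> t \<le> \<phi> 0"
proof (rule DERIV_nonpos_imp_decreasing_open[OF t])
  show "continuous_on {0..t} \<phi>"
    by (rule DERIV_continuous_on[of _ _ \<phi>'], rule DERIV_subset[OF d]) auto
  show "\<exists>y. (\<phi> has_real_derivative y) (at x) \<and> y \<le> 0" if "0 < x" "x < t" for x
  proof -
    have "at x within {0..} = at x" using that by (intro at_within_interior) auto
    then show ?thesis using d[of x] n[of x] that by auto
  qed
qed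

lemma at_within_atLeast_eq: "(t::real) < T \<Longrightarrow> at t within {0..} = at t within {0..T}"
  by (rule at_within_nhd[of t "{..<T}"]) auto

lemma has_vector_derivative_of_integral:
  fixes y :: "real \<Rightarrow> 'a::banach"
  assumes cont: "continuous_on {0..} f" and I: "\<And>t. 0 \<le> t \<Longrightarrow> (f has_integral (y t - y 0)) {0..t}" and t: "0 \<le> t"
  shows "(y has_vector_derivative f t) (at t within {0..})"
proof -
  have "((\<lambda>s. integral {0..s} f) has_vector_derivative f t) (at t within {0..t+1})"
    using t cont by (intro integral_has_vector_derivative) (auto intro: continuous_on_subset)
  then have "((\<lambda>s. y 0 + integral {0..s} f) has_vector_derivative (0 + f t)) (at t within {0..t+1})"
    by (intro derivative_intros)
  then have "((\<lambda>s. y 0 + integral {0..s} f) has_vector_derivative f t) (at t within {0..})"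
    by (simp add: at_within_atLeast_eq[of t "t+1"])
  then show ?thesis
    by (rule has_vector_derivative_transform[rotated 2])
      (use t integral_unique[OF I] in auto)
qed

lemma norm_square_has_derivative:
  fixes y :: "real \<Rightarrow> 'a::real_inner"
  assumes "(y has_vector_derivative y') (at t within S)"
  shows "((\<lambda>s. (norm (y s))\<^sup>2) has_real_derivative 2 * (y' \<bullet> y t)) (at t within S)"
proof -
  have "((\<lambda>s. y s \<bullet> y s) has_derivative (\<lambda>h. y t \<bullet> (h *\<^sub>R y') + (h *\<^sub>R y') \<bullet> y t)) (at t within S)"
    using assms unfolding has_vector_derivative_def by (intro has_derivative_inner)
  then show ?thesis
    unfolding has_field_derivative_def power2_norm_eq_inner
    by (rule has_derivative_eq_rhs) (auto simp: inner_commute algebra_simps)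
qed

section \<open>Strong measurability and density of polynomials\<close>

text \<open>Translates between the almost everywhere statements of Lebesgue integration and the
  negligible exceptional sets of the gauge integral; both occur below.\<close>

lemma AE_lebesgue_on_iff:
  "S \<in> sets lebesgue \<Longrightarrow> (AE x in lebesgue_on S. P x) \<longleftrightarrow> (\<exists>N. negligible N \<and> (\<forall>x\<in>S - N. P x))"
  for S :: "'a::euclidean_space set"
proof -
  assume S: "S \<in> sets lebesgue"
  have "(AE x in lebesgue_on S. P x) \<longleftrightarrow> (AE x in lebesgue. x \<in> S \<longrightarrow> P x)"
    using S by (simp add: AE_restrict_space_iff)
  also have "\<dots> \<longleftrightarrow> (\<exists>N. negligible N \<and> (\<forall>x\<in>S - N. P x))"
    unfolding eventually_ae_filter negligible_iff_null_sets by auto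
  finally show ?thesis .
qed

lemma borel_measurable_AE_limit:
  fixes s :: "nat \<Rightarrow> 'a::euclidean_space \<Rightarrow> real"
  assumes S: "S \<in> sets lebesgue" and s: "\<And>n. s n \<in> borel_measurable (lebesgue_on S)"
    and lim: "AE x in lebesgue_on S. (\<lambda>n. s n x) \<longlonglongrightarrow> g x"
  shows "g \<in> borel_measurable (lebesgue_on S)"
proof -
  obtain N where N: "negligible N" "\<And>x. x \<in> S - N \<Longrightarrow> (\<lambda>n. s n x) \<longlonglongrightarrow> g x"
    using lim unfolding AE_lebesgue_on_iff[OF S] by blast
  have NS: "N \<in> sets lebesgue" using N(1) negligible_iff_null_sets by blast
  \<comment> \<open>Limit and approximants are set to 0 off S - N, so that convergence holds
    everywhere; completeness of Lebesgue measure then allows any values on \<open>N\<close>.\<close>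
  have "(\<lambda>x. if x \<in> S - N then g x else 0) \<in> borel_measurable lebesgue"
  proof (rule borel_measurable_LIMSEQ_real[where u = "\<lambda>n x. if x \<in> S - N then s n x else 0"])
    fix n
    have "s n \<in> borel_measurable (lebesgue_on (S - N))"
      using s by (meson Diff_subset measurable_restrict_mono)
    then show "(\<lambda>x. if x \<in> S - N then s n x else 0) \<in> borel_measurable lebesgue"
      using S NS by (intro borel_measurable_if_I) auto
  qed (use N in auto)
  then have "(\<lambda>x. if x \<in> S then g x else 0) \<in> borel_measurable lebesgue"
  proof (rule borel_measurable_AE)
    show "AE x in lebesgue. (if x \<in> S - N then g x else 0) = (if x \<in> S then g x else 0)"
      by (rule AE_I'[of N]) (use N(1) in \<open>auto simp: negligible_iff_null_sets\<close>)
  qed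
  then show ?thesis by (rule borel_measurable_if_D)
qed

lemma strongly_measurable_add:
  "strongly_measurable M f \<Longrightarrow> strongly_measurable M g \<Longrightarrow> strongly_measurable M (\<lambda>x. f x + g x)"
  unfolding strongly_measurable_def
proof (elim exE conjE)
  fix s t :: "nat \<Rightarrow> 'a \<Rightarrow> 'b"
  assume s: "\<forall>n. simple_function M (s n)" "AE x in M. (\<lambda>n. s n x) \<longlonglongrightarrow> f x"
    and t: "\<forall>n. simple_function M (t n)" "AE x in M. (\<lambda>n. t n x) \<longlonglongrightarrow> g x"
  show "\<exists>s. (\<forall>n. simple_function M (s n)) \<and> (AE x in M. (\<lambda>n. s n x) \<longlonglongrightarrow> f x + g x)"
    by (rule exI[of _ "\<lambda>n x. s n x + t n x"])
      (use s t in \<open>auto intro!: simple_function_compose2[where h="(+)"] tendsto_add elim: eventually_elim2\<close>)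
qed

lemma strongly_measurable_simple: "simple_function M f \<Longrightarrow> strongly_measurable M f"
  unfolding strongly_measurable_def by (intro exI[of _ "\<lambda>_. f"]) auto

lemma strongly_measurable_norm:
  fixes g :: "'a::euclidean_space \<Rightarrow> 'b::real_normed_vector"
  assumes "S \<in> sets lebesgue" "strongly_measurable (lebesgue_on S) g"
  shows "(\<lambda>x. norm (g x)) \<in> borel_measurable (lebesgue_on S)"
proof -
  obtain s where s: "\<And>n. simple_function (lebesgue_on S) (s n)" "AE x in lebesgue_on S. (\<lambda>n. s n x) \<longlonglongrightarrow> g x"
    using assms(2) unfolding strongly_measurable_def by blast
  show ?thesis
  proof (rule borel_measurable_AE_limit[OF assms(1)])
    show "(\<lambda>x. norm (s n x)) \<in> borel_measurable (lebesgue_on S)" for n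
      by (rule borel_measurable_simple_function[OF simple_function_compose1[OF s(1)]])
    show "AE x in lebesgue_on S. (\<lambda>n. norm (s n x)) \<longlonglongrightarrow> norm (g x)"
      using s(2) by eventually_elim (rule tendsto_norm)
  qed
qed

lemma continuous_on_simple_approximation:
  fixes u :: "real \<Rightarrow> 'b::real_normed_vector"
  assumes u: "continuous_on {0..} u" and e: "0 < e"
  shows "\<exists>s. simple_function (lebesgue_on {0<..<T}) s \<and> (\<forall>x\<in>{0<..<T}. norm (s x - u x) < e)"
proof -
  have "uniformly_continuous_on {0..T} u"
    by (rule compact_uniformly_continuous[OF continuous_on_subset[OF u]]) auto
  then obtain d where d: "0 < d" "\<And>x y. x \<in> {0..T} \<Longrightarrow> y \<in> {0..T} \<Longrightarrow> dist x y < d \<Longrightarrow> dist (u x) (u y) < e"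
    using e unfolding uniformly_continuous_on_def by metis
  obtain k :: nat where k: "1 / d < real k" using reals_Archimedean2 by blast
  have k0: "0 < real k" using k d by (smt (verit) zero_less_divide_1_iff)
  \<comment> \<open>The value of u at x rounded down to a grid of mesh 1 / k below d. For x in (0,T)
    the grid points used are finitely many and lie in [0,T], where u is uniformly
    continuous.\<close>
  define s where "s x = u (of_int \<lfloor>real k * x\<rfloor> / real k)" for x :: real
  have "simple_function (lebesgue_on {0<..<T}) (\<lambda>x. \<lfloor>real k * x\<rfloor>)"
    unfolding simple_function_eq_measurable
  proof
    have "(\<lambda>x. \<lfloor>real k * x\<rfloor>) ` space (lebesgue_on {0<..<T}) \<subseteq> {0..\<lfloor>real k * T\<rfloor>}"
      using k0 by (auto intro!: floor_mono mult_left_mono)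
    then show "finite ((\<lambda>x. \<lfloor>real k * x\<rfloor>) ` space (lebesgue_on {0<..<T}))" by (rule finite_subset) simp
    have "(\<lambda>x. \<lfloor>real k * x\<rfloor>) \<in> measurable borel (count_space UNIV)" by measurable
    then show "(\<lambda>x. \<lfloor>real k * x\<rfloor>) \<in> measurable (lebesgue_on {0<..<T}) (count_space UNIV)"
      by (intro measurable_restrict_space1 measurable_completion) simp
  qed
  then have 1: "simple_function (lebesgue_on {0<..<T}) s"
    unfolding s_def by (rule simple_function_compose1)
  have 2: "norm (s x - u x) < e" if x: "x \<in> {0<..<T}" for x
  proof -
    have f: "of_int \<lfloor>real k * x\<rfloor> \<le> real k * x" "real k * x < of_int \<lfloor>real k * x\<rfloor> + 1" by linarith+
    have f0: "0 \<le> of_int \<lfloor>real k * x\<rfloor> / real k" using x k0 by simp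
    have f1: "of_int \<lfloor>real k * x\<rfloor> / real k \<le> x" using f k0 by (simp add: field_simps)
    have "x < of_int \<lfloor>real k * x\<rfloor> / real k + 1 / real k" using f k0 by (simp add: field_simps)
    moreover have "1 / real k < d" using k k0 d by (simp add: field_simps)
    ultimately show ?thesis using d(2)[of "of_int \<lfloor>real k * x\<rfloor> / real k" x] x f0 f1
      unfolding s_def dist_norm by auto
  qed
  show ?thesis using 1 2 by blast
qed

text \<open>Each u n is within 1 / (n + 1) of a simple function on the whole interval, so these
  simple functions already converge to v and no diagonal sequence has to be extracted.\<close>

lemma strongly_measurable_AE_limit:
  fixes u :: "nat \<Rightarrow> real \<Rightarrow> 'b::real_normed_vector"
  assumes u: "\<And>n. continuous_on {0..} (u n)"
    and lim: "AE x in lebesgue_on {0<..<T}. (\<lambda>n. u n x) \<longlonglongrightarrow> v x"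
  shows "strongly_measurable (lebesgue_on {0<..<T}) v"
proof -
  have "\<exists>s. simple_function (lebesgue_on {0<..<T}) s \<and> (\<forall>x\<in>{0<..<T}. norm (s x - u n x) < inverse (real (Suc n)))" for n
    by (rule continuous_on_simple_approximation[OF u]) simp
  then obtain s where s: "\<And>n. simple_function (lebesgue_on {0<..<T}) (s n)"
    "\<And>n x. x \<in> {0<..<T} \<Longrightarrow> norm (s n x - u n x) < inverse (real (Suc n))" by metis
  have "AE x in lebesgue_on {0<..<T}. (\<lambda>n. s n x) \<longlonglongrightarrow> v x"
    using lim AE_space
  proof eventually_elim
    fix x assume x: "(\<lambda>n. u n x) \<longlonglongrightarrow> v x" "x \<in> space (lebesgue_on {0<..<T})"
    have "(\<lambda>n. s n x - u n x) \<longlonglongrightarrow> 0"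
      by (rule Lim_null_comparison[OF _ LIMSEQ_inverse_real_of_nat])
        (use x(2) s(2) in \<open>auto intro!: always_eventually less_imp_le simp del: of_nat_Suc\<close>)
    from tendsto_add[OF this x(1)] show "(\<lambda>n. s n x) \<longlonglongrightarrow> v x" by simp
  qed
  then show ?thesis unfolding strongly_measurable_def using s(1) by blast
qed

lemma strongly_measurable_continuous:
  "continuous_on {0..} u \<Longrightarrow> strongly_measurable (lebesgue_on {0<..<T}) (u :: real \<Rightarrow> 'b::real_normed_vector)"
  by (rule strongly_measurable_AE_limit[of "\<lambda>_. u"]) auto

lemma integrable_lebesgue_on_subset:
  fixes f :: "'a::euclidean_space \<Rightarrow> 'b::{banach, second_countable_topology}"
  assumes "integrable (lebesgue_on T) f" "S \<subseteq> T" "S \<in> sets lebesgue" "T \<in> sets lebesgue"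
  shows "integrable (lebesgue_on S) f"
  using assms set_integrable_subset[of lebesgue T f S]
  by (simp add: integrable_restrict_space set_integrable_def)

lemma integrable_continuous_lebesgue_on:
  fixes \<phi> :: "real \<Rightarrow> real"
  assumes "continuous_on {0..} \<phi>"
  shows "integrable (lebesgue_on {0<..<T}) \<phi>"
proof (rule integrable_lebesgue_on_subset)
  show "integrable (lebesgue_on {0..T}) \<phi>"
    using assms by (intro continuous_imp_integrable_real) (auto intro: continuous_on_subset)
qed auto

lemma norm_add_square_le: "(norm (x + y))\<^sup>2 \<le> 2 * (norm x)\<^sup>2 + 2 * (norm y)\<^sup>2"
  for x y :: "'a::real_normed_vector"
proof -
  have "(norm (x + y))\<^sup>2 \<le> (norm x + norm y)\<^sup>2" by (intro power_mono norm_triangle_ineq) auto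
  also have "\<dots> \<le> 2 * (norm x)\<^sup>2 + 2 * (norm y)\<^sup>2"
    using sum_squares_bound[of "norm x" "norm y"] by (simp add: power2_sum)
  finally show ?thesis .
qed

lemma L2_space_add:
  assumes "f \<in> L2_space T" "g \<in> L2_space T"
  shows "(\<lambda>s. f s + g s) \<in> L2_space T"
proof -
  let ?M = "lebesgue_on {0<..<T}"
  have sm: "strongly_measurable ?M (\<lambda>s. f s + g s)"
    using assms unfolding L2_space_def by (auto intro: strongly_measurable_add)
  have i: "integrable ?M (\<lambda>s. 2 * (norm (f s))\<^sup>2 + 2 * (norm (g s))\<^sup>2)"
    using assms unfolding L2_space_def by auto
  have "integrable ?M (\<lambda>s. (norm (f s + g s))\<^sup>2)"
  proof (rule Bochner_Integration.integrable_bound[OF i])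
    show "(\<lambda>s. (norm (f s + g s))\<^sup>2) \<in> borel_measurable ?M"
      using strongly_measurable_norm[OF _ sm] by simp
    show "AE s in ?M. norm ((norm (f s + g s))\<^sup>2) \<le> norm (2 * (norm (f s))\<^sup>2 + 2 * (norm (g s))\<^sup>2)"
      using norm_add_square_le by (intro AE_I2) fastforce
  qed
  with sm show ?thesis unfolding L2_space_def by simp
qed

lemma L2_space_continuous: "continuous_on {0..} g \<Longrightarrow> g \<in> L2_space T"
  unfolding L2_space_def
  by (auto intro!: strongly_measurable_continuous integrable_continuous_lebesgue_on continuous_intros)

section \<open>Vector-valued polynomials and their density in the square mean\<close>

inductive vpoly :: "(real \<Rightarrow> 'h::real_normed_vector) \<Rightarrow> bool" where
  monomial: "vpoly (\<lambda>t. t ^ k *\<^sub>R h)"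
| add: "vpoly p \<Longrightarrow> vpoly q \<Longrightarrow> vpoly (\<lambda>t. p t + q t)"

lemma vpoly_zero: "vpoly (\<lambda>t. 0)"
  using vpoly.monomial[of 0 0] by simp

lemma vpoly_sum: "(\<And>i. i \<in> A \<Longrightarrow> vpoly (p i)) \<Longrightarrow> vpoly (\<lambda>t. \<Sum>i\<in>A. p i t)"
  by (induction A rule: infinite_finite_induct) (auto intro: vpoly_zero vpoly.add)

text \<open>Domination by an integrable function replaces the integral of \<open>\<parallel>g - p\<parallel>\<^sup>2\<close>, so that
  the triangle inequality needs no measurability.\<close>

definition L2_near :: "real \<Rightarrow> real \<Rightarrow> (real \<Rightarrow> 'h::real_normed_vector) \<Rightarrow> (real \<Rightarrow> 'h) \<Rightarrow> bool" where
  "L2_near T e g p \<longleftrightarrow> (\<exists>\<phi>. integrable (lebesgue_on {0<..<T}) \<phi> \<and> (LINT s|lebesgue_on {0<..<T}. \<phi> s) \<le> e \<and>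
     (AE s in lebesgue_on {0<..<T}. (norm (g s - p s))\<^sup>2 \<le> \<phi> s))"

text \<open>The parameter bounds the square of a distance, so the triangle inequality takes the form
  2 a + 2 b, and approximations in two stages start from e / 4.\<close>

lemma L2_near_trans:
  assumes "L2_near T a f g" "L2_near T b g h"
  shows "L2_near T (2 * a + 2 * b) f h"
proof -
  obtain \<phi> where \<phi>: "integrable (lebesgue_on {0<..<T}) \<phi>" "(LINT s|lebesgue_on {0<..<T}. \<phi> s) \<le> a"
     "AE s in lebesgue_on {0<..<T}. (norm (f s - g s))\<^sup>2 \<le> \<phi> s" using assms(1) unfolding L2_near_def by blast
  obtain \<psi> where \<psi>: "integrable (lebesgue_on {0<..<T}) \<psi>" "(LINT s|lebesgue_on {0<..<T}. \<psi> s) \<le> b"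
     "AE s in lebesgue_on {0<..<T}. (norm (g s - h s))\<^sup>2 \<le> \<psi> s" using assms(2) unfolding L2_near_def by blast
  show ?thesis unfolding L2_near_def
  proof (intro exI[of _ "\<lambda>s. 2 * \<phi> s + 2 * \<psi> s"] conjI)
    show "AE s in lebesgue_on {0<..<T}. (norm (f s - h s))\<^sup>2 \<le> 2 * \<phi> s + 2 * \<psi> s"
      using \<phi>(3) \<psi>(3)
    proof eventually_elim
      case (elim s)
      then show ?case using norm_add_square_le[of "f s - g s" "g s - h s"] by simp
    qed
  qed (use \<phi> \<psi> in auto)
qed

lemma L2_near_add:
  assumes "L2_near T a f p" "L2_near T b g q"
  shows "L2_near T (2 * a + 2 * b) (\<lambda>t. f t + g t) (\<lambda>t. p t + q t)"
proof -
  have "L2_near T a (\<lambda>t. f t + g t) (\<lambda>t. p t + g t)" "L2_near T b (\<lambda>t. p t + g t) (\<lambda>t. p t + q t)"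
    using assms by (simp_all add: L2_near_def)
  then show ?thesis by (rule L2_near_trans)
qed

lemma L2_near_uniform:
  assumes "\<And>t. t \<in> {0<..<T} \<Longrightarrow> norm (g t - p t) \<le> d" and T: "0 \<le> T"
  shows "L2_near T (T * d\<^sup>2) g p"
  unfolding L2_near_def
proof (intro exI[of _ "\<lambda>_. d\<^sup>2"] conjI)
  show "integrable (lebesgue_on {0<..<T}) (\<lambda>_. d\<^sup>2)"
    by (rule integrable_continuous_lebesgue_on) simp
  show "(LINT s|lebesgue_on {0<..<T}. d\<^sup>2) \<le> T * d\<^sup>2"
    using T by (simp add: measure_restrict_space)
  show "AE s in lebesgue_on {0<..<T}. (norm (g s - p s))\<^sup>2 \<le> d\<^sup>2"
    using assms by (intro AE_I2) (auto intro!: power_mono)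
qed

definition L2_approx :: "real \<Rightarrow> (real \<Rightarrow> 'h::real_normed_vector) \<Rightarrow> bool" where
  "L2_approx T g \<longleftrightarrow> (\<forall>e>0. \<exists>p. vpoly p \<and> L2_near T e g p)"

lemma L2_approx_closed:
  assumes "\<And>e. 0 < e \<Longrightarrow> \<exists>h. L2_approx T h \<and> L2_near T e g h"
  shows "L2_approx T g"
  unfolding L2_approx_def
proof (intro allI impI)
  fix e :: real assume e: "0 < e"
  then obtain h where h: "L2_approx T h" "L2_near T (e/4) g h" using assms[of "e/4"] by auto
  then obtain p where p: "vpoly p" "L2_near T (e/4) h p" using e unfolding L2_approx_def
    by (meson zero_less_divide_iff zero_less_numeral)
  then show "\<exists>p. vpoly p \<and> L2_near T e g p" using L2_near_trans[OF h(2) p(2)] by auto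
qed

lemma L2_approx_add:
  assumes "L2_approx T f" "L2_approx T g"
  shows "L2_approx T (\<lambda>t. f t + g t)"
  unfolding L2_approx_def
proof (intro allI impI)
  fix e :: real assume e: "0 < e"
  then have e4: "0 < e / 4" by simp
  obtain p q where p: "vpoly p" "L2_near T (e/4) f p" and q: "vpoly q" "L2_near T (e/4) g q"
    using assms e4 unfolding L2_approx_def by meson
  show "\<exists>p. vpoly p \<and> L2_near T e (\<lambda>t. f t + g t) p"
    using L2_near_add[OF p(2) q(2)] vpoly.add[OF p(1) q(1)] by auto
qed

lemma L2_approx_zero: "L2_approx T (\<lambda>t. 0)"
proof -
  have "L2_near T e (\<lambda>t. 0) (\<lambda>t. 0)" if "0 < e" for e
    unfolding L2_near_def by (rule exI[of _ "\<lambda>_. 0"]) (use that in auto)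
  then show ?thesis unfolding L2_approx_def using vpoly_zero by blast
qed

lemma L2_approx_sum:
  assumes "\<And>i. i \<in> A \<Longrightarrow> L2_approx T (f i)"
  shows "L2_approx T (\<lambda>t. \<Sum>i\<in>A. f i t)"
  using assms by (induction A rule: infinite_finite_induct) (auto intro: L2_approx_zero L2_approx_add)

lemma L2_approx_continuous:
  assumes T: "0 < T" and k: "continuous_on {0..T} (k :: real \<Rightarrow> real)"
  shows "L2_approx T (\<lambda>t. k t *\<^sub>R h)"
  unfolding L2_approx_def
proof (intro allI impI)
  fix e :: real assume e: "0 < e"
  \<comment> \<open>Chosen so that T (d |h|)^2 \<le> e; the summand 1 in the denominator allows h =
    0. Only the scalar factor is approximated, by the Weierstrass theorem.\<close>
  define d where "d = sqrt (e / T) / (norm h + 1)"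
  have h1: "0 < norm h + 1" by (simp add: add_nonneg_pos)
  have d: "0 < d" unfolding d_def using e T h1 by simp
  obtain q where q: "real_polynomial_function q" "\<And>t. t \<in> {0..T} \<Longrightarrow> \<bar>k t - q t\<bar> < d"
    using Stone_Weierstrass_real_polynomial_function[OF _ k d] by auto
  obtain a n where an: "q = (\<lambda>t. \<Sum>i\<le>n. a i * t ^ i)" using q(1) real_polynomial_function_iff_sum by auto
  have "vpoly (\<lambda>t. \<Sum>i\<le>n. t ^ i *\<^sub>R (a i *\<^sub>R h))" by (intro vpoly_sum vpoly.monomial)
  then have vp: "vpoly (\<lambda>t. q t *\<^sub>R h)" by (simp add: an scaleR_sum_left mult.commute)
  have "L2_near T (T * (d * norm h)\<^sup>2) (\<lambda>t. k t *\<^sub>R h) (\<lambda>t. q t *\<^sub>R h)"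
  proof (rule L2_near_uniform)
    fix t assume "t \<in> {0<..<T}"
    then have "\<bar>k t - q t\<bar> * norm h \<le> d * norm h" using q(2)[of t] by (intro mult_right_mono) auto
    then show "norm (k t *\<^sub>R h - q t *\<^sub>R h) \<le> d * norm h" by (simp add: scaleR_diff_left[symmetric])
  qed (use T in simp)
  moreover have "T * (d * norm h)\<^sup>2 \<le> e"
  proof -
    have "d * norm h \<le> d * (norm h + 1)" using d by (intro mult_left_mono) auto
    also have "\<dots> = sqrt (e / T)" unfolding d_def using h1 by simp
    finally have "(d * norm h)\<^sup>2 \<le> (sqrt (e / T))\<^sup>2" using d by (intro power_mono) auto
    then show ?thesis using T e by (simp add: field_simps)
  qed
  ultimately have "L2_near T e (\<lambda>t. k t *\<^sub>R h) (\<lambda>t. q t *\<^sub>R h)"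
    unfolding L2_near_def by (meson order_trans)
  then show "\<exists>p. vpoly p \<and> L2_near T e (\<lambda>t. k t *\<^sub>R h) p" using vp by blast
qed

text \<open>A measurable indicator is an almost everywhere limit of continuous functions. After
  clipping these to [0,1], the squared errors are dominated by |h|^2, and dominated convergence
  gives closeness in the square mean.\<close>

lemma L2_approx_indicator:
  assumes T: "0 < T" and E: "E \<in> sets lebesgue"
  shows "L2_approx T (\<lambda>t. indicat_real E t *\<^sub>R h)"
proof (rule L2_approx_closed)
  fix e :: real assume e: "0 < e"
  have "indicat_real E measurable_on UNIV"
    using E by (intro lebesgue_measurable_imp_measurable_on_real) auto
  then obtain N g where N: "negligible N" and g: "\<And>n. continuous_on UNIV (g n)"
    and lim: "\<And>x. x \<notin> N \<Longrightarrow> (\<lambda>n. g n x) \<longlonglongrightarrow> indicat_real E x"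
    unfolding measurable_on_def by auto
  define k where "k n x = max 0 (min 1 (g n x))" for n x
  have kc: "continuous_on S (k n)" for n S
    unfolding k_def by (intro continuous_intros continuous_on_subset[OF g]) auto
  have klim: "(\<lambda>n. k n x) \<longlonglongrightarrow> indicat_real E x" if "x \<notin> N" for x
  proof -
    have "(\<lambda>n. k n x) \<longlonglongrightarrow> max 0 (min 1 (indicat_real E x))"
      unfolding k_def by (intro tendsto_intros lim that)
    then show ?thesis by (simp add: indicator_def split: if_splits)
  qed
  define \<phi> where "\<phi> n x = (indicat_real E x - k n x)\<^sup>2 * (norm h)\<^sup>2" for n x
  let ?M = "lebesgue_on {0<..<T}"
  have km: "k n \<in> borel_measurable ?M" for n
    using borel_measurable_integrable[OF integrable_continuous_lebesgue_on[OF kc]] .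
  have Em: "indicat_real E \<in> borel_measurable ?M"
    using E by (intro measurable_restrict_space1 borel_measurable_indicator)
  have m: "\<phi> n \<in> borel_measurable ?M" for n
    unfolding \<phi>_def using km Em by simp
  have b: "(indicat_real E x - k n x)\<^sup>2 \<le> 1" for x n
    unfolding abs_square_le_1 k_def by (auto simp: indicator_def)
  have ci: "integrable ?M (\<lambda>_. (norm h)\<^sup>2)" by (rule integrable_continuous_lebesgue_on) simp
  have bb: "AE x in ?M. norm (\<phi> n x) \<le> (norm h)\<^sup>2" for n
    unfolding \<phi>_def using mult_right_mono[OF b, of "(norm h)\<^sup>2"] by (intro AE_I2) simp
  have "AE x in ?M. (\<lambda>n. \<phi> n x) \<longlonglongrightarrow> 0"
  proof -
    have "(\<lambda>n. \<phi> n x) \<longlonglongrightarrow> (indicat_real E x - indicat_real E x)\<^sup>2 * (norm h)\<^sup>2" if "x \<notin> N" for x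
      unfolding \<phi>_def by (intro tendsto_intros klim that)
    then have "\<forall>x\<in>{0<..<T} - N. (\<lambda>n. \<phi> n x) \<longlonglongrightarrow> 0" by simp
    then show ?thesis by (subst AE_lebesgue_on_iff) (simp, rule exI[of _ N], rule conjI[OF N])
  qed
  then have "(\<lambda>n. LINT x|?M. \<phi> n x) \<longlonglongrightarrow> (LINT x|?M. 0)"
    by (intro integral_dominated_convergence[OF _ m ci _ bb]) simp_all
  then have "\<forall>\<^sub>F n in sequentially. (LINT x|?M. \<phi> n x) < e"
    using e by (intro order_tendstoD) auto
  then obtain n where n: "(LINT x|?M. \<phi> n x) < e" using eventually_happens by force
  have "L2_near T e (\<lambda>t. indicat_real E t *\<^sub>R h) (\<lambda>t. k n t *\<^sub>R h)"
    unfolding L2_near_def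
  proof (intro exI[of _ "\<phi> n"] conjI)
    show "integrable ?M (\<phi> n)"
      by (rule Bochner_Integration.integrable_bound[OF ci m]) (use bb[of n] in auto)
    show "AE s in ?M. (norm (indicat_real E s *\<^sub>R h - k n s *\<^sub>R h))\<^sup>2 \<le> \<phi> n s"
      unfolding \<phi>_def scaleR_diff_left[symmetric] by (simp add: power_mult_distrib)
  qed (use n in simp)
  then show "\<exists>f. L2_approx T f \<and> L2_near T e (\<lambda>t. indicat_real E t *\<^sub>R h) f"
    using L2_approx_continuous[OF T kc] by blast
qed

lemma L2_approx_simple:
  assumes T: "0 < T" and s: "simple_function (lebesgue_on {0<..<T}) s"
  shows "L2_approx T s"
proof (rule L2_approx_closed)
  fix e :: real assume e: "0 < e"
  let ?I = "{0<..<T}"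
  have fin: "finite (s ` ?I)" using s unfolding simple_function_def by simp
  define E where "E y = s -` {y} \<inter> ?I" for y
  have E: "E y \<in> sets lebesgue" if "y \<in> s ` ?I" for y
    using s that unfolding simple_function_def E_def by (auto simp: sets_restrict_space_iff)
  have eq: "s t = (\<Sum>y\<in>s ` ?I. indicat_real (E y) t *\<^sub>R y)" if "t \<in> ?I" for t
  proof -
    have "(\<Sum>y\<in>s ` ?I. indicat_real (E y) t *\<^sub>R y) = (\<Sum>y\<in>s ` ?I. if y = s t then y else 0)"
      using that by (intro sum.cong) (auto simp: E_def indicator_def)
    then show ?thesis using fin that by simp
  qed
  \<comment> \<open>The combination of indicators agrees with \<open>s\<close> only inside (0,T),
    hence a second function at distance 0 in place of an equality.\<close>
  define z where "z t = (\<Sum>y\<in>s ` ?I. indicat_real (E y) t *\<^sub>R y)" for t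
  have "norm (s t - z t) \<le> 0" if "t \<in> ?I" for t
    unfolding z_def by (subst eq[OF that]) simp
  from L2_near_uniform[OF this] have "L2_near T 0 s z" using T by simp
  then have "L2_near T e s z"
    unfolding L2_near_def using e by (meson order_trans less_imp_le)
  moreover have "L2_approx T z"
    unfolding z_def by (intro L2_approx_sum L2_approx_indicator T E)
  ultimately show "\<exists>h. L2_approx T h \<and> L2_near T e s h" by blast
qed

lemma L2_space_imp_approx:
  assumes T: "0 < T" and g: "g \<in> L2_space T"
  shows "L2_approx T g"
proof (rule L2_approx_closed)
  fix e :: real assume e: "0 < e"
  let ?M = "lebesgue_on {0<..<T}"
  have sm: "strongly_measurable ?M g" and gi: "integrable ?M (\<lambda>s. (norm (g s))\<^sup>2)"
    using g unfolding L2_space_def by auto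
  obtain s where s: "\<And>n. simple_function ?M (s n)" "AE x in ?M. (\<lambda>n. s n x) \<longlonglongrightarrow> g x"
    using sm unfolding strongly_measurable_def by blast
  have gm: "(\<lambda>x. norm (g x)) \<in> borel_measurable ?M" by (rule strongly_measurable_norm[OF _ sm]) simp
  \<comment> \<open>Values of the simple approximant exceeding 2 |g| are replaced by 0. Convergence
    is kept, since near a nonzero g the threshold is not exceeded and for g = 0 only 0 remains; the
    gain is |g - z| \<le> 3 |g|, hence the majorant 9 |g|^2.\<close>
  define z where "z n x = (if norm (s n x) \<le> 2 * norm (g x) then s n x else 0)" for n x
  have nsm: "(\<lambda>x. norm (s n x)) \<in> borel_measurable ?M" for n
    by (rule borel_measurable_simple_function[OF simple_function_compose1[OF s(1)]])
  have z: "simple_function ?M (z n)" for n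
    unfolding z_def by (rule simple_function_If[OF s(1)]) (use gm nsm in measurable)
  define \<phi> where "\<phi> n x = (norm (g x - z n x))\<^sup>2" for n x
  have m: "\<phi> n \<in> borel_measurable ?M" for n
  proof -
    have "simple_function ?M (\<lambda>x. - z n x)" by (rule simple_function_compose1[OF z])
    then have "strongly_measurable ?M (\<lambda>x. g x + - z n x)"
      by (intro strongly_measurable_add sm strongly_measurable_simple)
    from strongly_measurable_norm[OF _ this] show ?thesis unfolding \<phi>_def by simp
  qed
  have b: "\<phi> n x \<le> 9 * (norm (g x))\<^sup>2" for n x
  proof -
    have "norm (g x - z n x) \<le> 3 * norm (g x)"
      unfolding z_def using norm_triangle_ineq4[of "g x" "s n x"] by auto
    then have "(norm (g x - z n x))\<^sup>2 \<le> (3 * norm (g x))\<^sup>2" by (intro power_mono) auto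
    then show ?thesis unfolding \<phi>_def by (simp add: power_mult_distrib)
  qed
  have ci: "integrable ?M (\<lambda>x. 9 * (norm (g x))\<^sup>2)" using gi by simp
  have bb: "AE x in ?M. norm (\<phi> n x) \<le> 9 * (norm (g x))\<^sup>2" for n
    using b by (intro AE_I2) (simp add: \<phi>_def)
  have lim: "AE x in ?M. (\<lambda>n. \<phi> n x) \<longlonglongrightarrow> 0"
    using s(2)
  proof eventually_elim
    fix x assume x: "(\<lambda>n. s n x) \<longlonglongrightarrow> g x"
    have "(\<lambda>n. z n x) \<longlonglongrightarrow> g x"
    proof (cases "g x = 0")
      case True
      then show ?thesis unfolding z_def by (auto intro!: tendsto_eventually always_eventually)
    next
      case False
      then have "\<forall>\<^sub>F n in sequentially. norm (s n x) < 2 * norm (g x)"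
        by (intro order_tendstoD(2)[OF tendsto_norm[OF x]]) auto
      then show ?thesis
        by (intro Lim_transform_eventually[OF x]) (auto simp: z_def elim!: eventually_mono)
    qed
    then have "(\<lambda>n. \<phi> n x) \<longlonglongrightarrow> (norm (g x - g x))\<^sup>2" unfolding \<phi>_def by (intro tendsto_intros)
    then show "(\<lambda>n. \<phi> n x) \<longlonglongrightarrow> 0" by simp
  qed
  have "(\<lambda>n. LINT x|?M. \<phi> n x) \<longlonglongrightarrow> (LINT x|?M. 0)"
    by (rule integral_dominated_convergence[OF _ m ci lim bb]) simp
  then have "\<forall>\<^sub>F n in sequentially. (LINT x|?M. \<phi> n x) < e"
    using e by (intro order_tendstoD) auto
  then obtain n where n: "(LINT x|?M. \<phi> n x) < e" using eventually_happens by force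
  have "L2_near T e g (z n)"
    unfolding L2_near_def
  proof (intro exI[of _ "\<phi> n"] conjI)
    show "integrable ?M (\<phi> n)"
      by (rule Bochner_Integration.integrable_bound[OF ci m]) (use bb[of n] in auto)
    show "(LINT x|?M. \<phi> n x) \<le> e" using n by simp
  qed (simp add: \<phi>_def)
  then show "\<exists>h. L2_approx T h \<and> L2_near T e g h" using L2_approx_simple[OF T z] by blast
qed

section \<open>Square-mean distances and almost everywhere convergence\<close>

lemma continuous_on_atLeast_if_bounded_intervals:
  fixes U :: "real \<Rightarrow> 'a::topological_space"
  assumes "\<And>T. continuous_on {0..T} U"
  shows "continuous_on {0..} U"
  unfolding continuous_on_eq_continuous_within
proof
  fix t :: real assume "t \<in> {0..}"
  then show "continuous (at t within {0..}) U"
    using assms[of "t+1"] at_within_atLeast_eq[of t "t+1"]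
    unfolding continuous_on_eq_continuous_within continuous_within by auto
qed

lemma L2_near_sym: "L2_near T e f g \<Longrightarrow> L2_near T e g f"
  unfolding L2_near_def by (simp add: norm_minus_commute)

lemma L2_near_subinterval:
  assumes "L2_near T e f g" "T' \<le> T"
  shows "L2_near T' e f g"
proof -
  obtain \<phi> where \<phi>: "integrable (lebesgue_on {0<..<T}) \<phi>" "(LINT s|lebesgue_on {0<..<T}. \<phi> s) \<le> e"
     "AE s in lebesgue_on {0<..<T}. (norm (f s - g s))\<^sup>2 \<le> \<phi> s" using assms(1) unfolding L2_near_def by blast
  have sub: "{0<..<T'} \<subseteq> {0<..<T}" using assms by auto
  \<comment> \<open>A majorant of a square is nonnegative almost everywhere, so shrinking the
    interval cannot increase its integral.\<close>
  have "AE s in lebesgue_on {0<..<T}. 0 \<le> \<phi> s" using \<phi>(3)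
    by eventually_elim (meson order_trans zero_le_power2)
  then have "(LINT s|lebesgue_on {0<..<T'}. \<phi> s) \<le> (LINT s|lebesgue_on {0<..<T}. \<phi> s)"
    by (intro integral_mono_lebesgue_on_AE[OF \<phi>(1) _ _ sub]) auto
  moreover have "AE s in lebesgue_on {0<..<T'}. (norm (f s - g s))\<^sup>2 \<le> \<phi> s"
    using \<phi>(3) sub by (auto simp: AE_lebesgue_on_iff)
  moreover have "integrable (lebesgue_on {0<..<T'}) \<phi>"
    by (rule integrable_lebesgue_on_subset[OF \<phi>(1) sub]) auto
  ultimately show ?thesis unfolding L2_near_def using \<phi>(2) by (meson order_trans)
qed

lemma has_integral_closed_interval:
  fixes \<phi> :: "real \<Rightarrow> real"
  assumes "integrable (lebesgue_on {0<..<t}) \<phi>"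
  shows "(\<phi> has_integral (LINT s|lebesgue_on {0<..<t}. \<phi> s)) {0..t}"
proof -
  have "(\<phi> has_integral (LINT s|lebesgue_on {0<..<t}. \<phi> s)) {0<..<t}"
    by (rule has_integral_integral_lebesgue_on[OF assms]) simp
  then show ?thesis by (simp add: has_integral_Icc_iff_Ioo)
qed

text \<open>Monotone convergence in the extended reals: the integral of the sum is the sum of the
  integrals, which is finite, and this forces the sum to be finite almost everywhere.\<close>

lemma AE_summable_of_summable_integrals:
  fixes f :: "nat \<Rightarrow> 'a \<Rightarrow> real"
  assumes i: "\<And>n. integrable M (f n)" and nn: "\<And>n x. 0 \<le> f n x" and s: "summable (\<lambda>n. LINT x|M. f n x)"
  shows "AE x in M. summable (\<lambda>n. f n x)" and "integrable M (\<lambda>x. suminf (\<lambda>n. f n x))"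
proof -
  have [measurable]: "f n \<in> borel_measurable M" for n using i by simp
  have "(\<integral>\<^sup>+ x. suminf (\<lambda>n. ennreal (f n x)) \<partial>M) = suminf (\<lambda>n. \<integral>\<^sup>+ x. ennreal (f n x) \<partial>M)"
    by (rule nn_integral_suminf) (use i in auto)
  also have "\<dots> = suminf (\<lambda>n. ennreal (LINT x|M. f n x))"
    using i nn by (simp add: nn_integral_eq_integral)
  also have "\<dots> \<noteq> \<infinity>"
    by (subst suminf_ennreal2[OF _ s]) (use nn in \<open>auto intro: integral_nonneg_AE\<close>)
  finally have "AE x in M. suminf (\<lambda>n. ennreal (f n x)) \<noteq> \<infinity>"
    by (intro nn_integral_noteq_infinite) auto
  then show ae: "AE x in M. summable (\<lambda>n. f n x)"
    by eventually_elim (rule summable_suminf_not_top, use nn in auto)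
  show "integrable M (\<lambda>x. suminf (\<lambda>n. f n x))"
    by (rule integrable_suminf[OF i]) (use ae s nn in auto)
qed

text \<open>Energy estimates control squares of increments. The weight 4^k turns summability into
  increments of size at most (1/2)^k times the root of the sum, so the sequence converges
  geometrically at a rate read off from that sum, which will later be an integrable function of
  time.\<close>

lemma weighted_square_summable_convergent:
  fixes x :: "nat \<Rightarrow> 'a::banach"
  assumes s: "summable (\<lambda>k. 4 ^ k * (norm (x (Suc k) - x k))\<^sup>2)"
  shows "\<exists>v. x \<longlonglongrightarrow> v \<and> (\<forall>n. norm (v - x n) \<le> 2 * (1/2) ^ n * sqrt (suminf (\<lambda>k. 4 ^ k * (norm (x (Suc k) - x k))\<^sup>2)))"
proof -
  define G where "G = sqrt (suminf (\<lambda>k. 4 ^ k * (norm (x (Suc k) - x k))\<^sup>2))"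
  have G0: "0 \<le> G" unfolding G_def using s by (auto intro!: suminf_nonneg)
  have step: "norm (x (Suc k) - x k) \<le> G * (1/2) ^ k" for k
  proof -
    have "4 ^ k * (norm (x (Suc k) - x k))\<^sup>2 \<le> suminf (\<lambda>k. 4 ^ k * (norm (x (Suc k) - x k))\<^sup>2)"
      using sum_le_suminf[OF s, of "{k}"] by simp
    then have "(2 ^ k * norm (x (Suc k) - x k))\<^sup>2 \<le> suminf (\<lambda>k. 4 ^ k * (norm (x (Suc k) - x k))\<^sup>2)"
      by (simp add: power_mult_distrib power_mult[symmetric] mult.commute[of _ 2] power_mult)
    then have "2 ^ k * norm (x (Suc k) - x k) \<le> G" unfolding G_def by (rule real_le_rsqrt)
    then show ?thesis by (simp add: field_simps)
  qed
  \<comment> \<open>The bracket is the sum of (1/2)^k for k from n to n + m - 1, in closed form so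
    that the induction telescopes.\<close>
  have far: "norm (x (n + m) - x n) \<le> G * (2 * (1/2) ^ n - 2 * (1/2) ^ (n + m))" for n m
  proof (induction m)
    case (Suc m)
    have "norm (x (n + Suc m) - x n) \<le> norm (x (Suc (n + m)) - x (n + m)) + norm (x (n + m) - x n)"
      using norm_triangle_ineq[of "x (Suc (n + m)) - x (n + m)" "x (n + m) - x n"] by simp
    also have "\<dots> \<le> G * (1/2) ^ (n + m) + G * (2 * (1/2) ^ n - 2 * (1/2) ^ (n + m))"
      using Suc step by (intro add_mono)
    also have "\<dots> = G * (2 * (1/2) ^ n - 2 * (1/2) ^ (n + Suc m))" by (simp add: algebra_simps)
    finally show ?case .
  qed simp
  have far': "norm (x m - x n) \<le> 2 * (1/2) ^ n * G" if "n \<le> m" for n m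
  proof -
    have "norm (x m - x n) \<le> G * (2 * (1/2) ^ n - 2 * (1/2) ^ m)" using far[of n "m - n"] that by simp
    also have "\<dots> \<le> G * (2 * (1/2) ^ n)" using G0 by (intro mult_left_mono) auto
    finally show ?thesis by (simp add: algebra_simps)
  qed
  have "Cauchy x"
  proof (rule CauchyI')
    fix e :: real assume e: "0 < e"
    have "(\<lambda>n. 2 * (1/2) ^ n * G) \<longlonglongrightarrow> 2 * 0 * G"
      by (intro tendsto_intros LIMSEQ_realpow_zero) auto
    then have "\<forall>\<^sub>F n in sequentially. 2 * (1/2) ^ n * G < e" using e by (intro order_tendstoD) auto
    then obtain N where N: "\<And>n. n \<ge> N \<Longrightarrow> 2 * (1/2) ^ n * G < e" unfolding eventually_sequentially by blast
    have "dist (x m) (x n) < e" if "N \<le> m" "m < n" for m n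
    proof -
      have "norm (x n - x m) \<le> 2 * (1/2) ^ m * G" using far'[of m n] that by simp
      also have "\<dots> < e" by (rule N[OF that(1)])
      finally show ?thesis by (simp add: dist_norm norm_minus_commute)
    qed
    then show "\<exists>M. \<forall>m\<ge>M. \<forall>n>m. dist (x m) (x n) < e" by blast
  qed
  then obtain v where v: "x \<longlonglongrightarrow> v" using Cauchy_convergent convergent_def by blast
  have "norm (v - x n) \<le> 2 * (1/2) ^ n * G" for n
  proof (rule tendsto_upperbound)
    show "(\<lambda>m. norm (x m - x n)) \<longlonglongrightarrow> norm (v - x n)" by (intro tendsto_intros v)
    show "\<forall>\<^sub>F m in sequentially. norm (x m - x n) \<le> 2 * (1/2) ^ n * G"
      unfolding eventually_sequentially using far' by blast
  qed simp
  then show ?thesis using v unfolding G_def by blast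
qed

lemma L2_near_mono: "L2_near T e f g \<Longrightarrow> e \<le> e' \<Longrightarrow> L2_near T e' f g"
  unfolding L2_near_def by (meson order_trans)

lemma L2_space_exp_integrable:
  assumes "g \<in> L2_space T" "0 < c"
  shows "integrable (lebesgue_on {0<..<T}) (\<lambda>s. exp (c * s) * (norm (g s))\<^sup>2)"
proof -
  let ?M = "lebesgue_on {0<..<T}"
  have gi: "integrable ?M (\<lambda>s. (norm (g s))\<^sup>2)" using assms unfolding L2_space_def by auto
  have "(\<lambda>s. exp (c * s)) \<in> borel_measurable ?M"
    by (rule borel_measurable_integrable[OF integrable_continuous_lebesgue_on]) (intro continuous_intros)
  then have m: "(\<lambda>s. exp (c * s) * (norm (g s))\<^sup>2) \<in> borel_measurable ?M"
    using borel_measurable_integrable[OF gi] by (rule borel_measurable_times)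
  have i: "integrable ?M (\<lambda>s. exp (c * T) * (norm (g s))\<^sup>2)" using gi by simp
  show ?thesis
    by (rule Bochner_Integration.integrable_bound[OF i m])
      (use assms in \<open>auto intro!: AE_I2 mult_right_mono\<close>)
qed

lemma L2_space_AE_cong:
  fixes f h :: "real \<Rightarrow> 'b::real_normed_vector"
  assumes f: "f \<in> L2_space T" and e: "AE s in lebesgue_on {0<..<T}. f s = h s"
  shows "h \<in> L2_space T"
proof -
  let ?M = "lebesgue_on {0<..<T}"
  obtain s where s: "\<And>n. simple_function ?M (s n)" "AE x in ?M. (\<lambda>n. s n x) \<longlonglongrightarrow> f x"
    using f unfolding L2_space_def strongly_measurable_def by blast
  have "AE x in ?M. (\<lambda>n. s n x) \<longlonglongrightarrow> h x" using s(2) e by eventually_elim simp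
  then have sm: "strongly_measurable ?M h" unfolding strongly_measurable_def using s(1) by blast
  have i: "integrable ?M (\<lambda>x. (norm (f x))\<^sup>2)" using f unfolding L2_space_def by auto
  have "integrable ?M (\<lambda>x. (norm (h x))\<^sup>2)"
  proof (rule integrable_cong_AE_imp[OF i])
    show "(\<lambda>x. (norm (h x))\<^sup>2) \<in> borel_measurable ?M" using strongly_measurable_norm[OF _ sm] by simp
    show "AE x in ?M. (norm (f x))\<^sup>2 = (norm (h x))\<^sup>2" using e by eventually_elim simp
  qed
  then show ?thesis using sm unfolding L2_space_def by simp
qed

lemma AE_intervals_negligible:
  assumes P: "\<And>T. 0 < T \<Longrightarrow> AE s in lebesgue_on {0<..<T::real}. P s" and t: "0 \<le> t"
  shows "\<exists>N. negligible N \<and> (\<forall>s\<in>{0..t} - N. P s)"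
proof -
  \<comment> \<open>The hypothesis speaks of open intervals: the endpoint t is reached through t +
    1, and 0 is added to the null set.\<close>
  have "AE s in lebesgue_on {0<..<t + 1}. P s" using t by (intro P) simp
  then have "\<exists>N. negligible N \<and> (\<forall>s\<in>{0<..<t + 1} - N. P s)"
    by (subst (asm) AE_lebesgue_on_iff) simp_all
  then obtain N where N: "negligible N" "\<And>s. s \<in> {0<..<t + 1} - N \<Longrightarrow> P s" by blast
  have "negligible (insert 0 N)" using N(1) by simp
  moreover have "P s" if "s \<in> {0..t} - insert 0 N" for s using that by (intro N(2)) auto
  ultimately show ?thesis by blast
qed

text \<open>Off the range, \<open>inv f\<close> is arbitrary; range membership therefore has to be
  carried along, almost everywhere in time.\<close>

lemma inv_add_range:
  assumes "linear f" "inj f" "x \<in> range f" "y \<in> range f"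
  shows "inv f (x + y) = inv f x + inv f y" and "inv f (x - y) = inv f x - inv f y"
  using assms by (auto simp: linear_add[symmetric] linear_diff[symmetric])

section \<open>Exponential decay\<close>

lemma exp_decay_tendsto_0:
  fixes c :: real
  assumes "0 < c"
  shows "((\<lambda>t. exp (- c * t)) \<longlongrightarrow> 0) at_top"
proof -
  have "filterlim (\<lambda>t. c * t) at_top at_top"
    by (rule filterlim_tendsto_pos_mult_at_top[OF tendsto_const assms filterlim_ident])
  then have "filterlim (\<lambda>t. - c * t) at_bot at_top" by (simp add: filterlim_uminus_at_bot)
  then show ?thesis by (rule filterlim_compose[OF exp_at_bot])
qed

text \<open>Up to a suitable time T the integral is a constant, which exp(- c t) kills; beyond T the
  squared source is below some small d, and integrating exp(c s) leaves at most d / c.\<close>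

lemma exp_weighted_average_tendsto_0:
  fixes k :: "real \<Rightarrow> 'b::real_normed_vector"
  assumes k: "\<And>T. 0 < T \<Longrightarrow> k \<in> L2_space T" and lim: "(k \<longlongrightarrow> 0) at_top" and c: "0 < c"
  shows "((\<lambda>t. exp (- c * t) * (LINT s|lebesgue_on {0<..<t}. exp (c * s) * (norm (k s))\<^sup>2)) \<longlongrightarrow> 0) at_top"
proof (rule tendstoI)
  fix e :: real assume e: "0 < e"
  \<comment> \<open>Makes the tail contribution d / c equal to e / 2.\<close>
  define d where "d = e * c / 2"
  have d: "0 < d" using e c by (simp add: d_def)
  have "((\<lambda>s. (norm (k s))\<^sup>2) \<longlongrightarrow> (norm (0::'b))\<^sup>2) at_top" by (intro tendsto_intros lim)
  then have "\<forall>\<^sub>F s in at_top. (norm (k s))\<^sup>2 < d" using d by (intro order_tendstoD) auto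
  then obtain T1 where T1: "\<And>s. T1 \<le> s \<Longrightarrow> (norm (k s))\<^sup>2 < d" unfolding eventually_at_top_linorder by blast
  define T where "T = max 1 T1"
  have T: "0 < T" "\<And>s. T \<le> s \<Longrightarrow> (norm (k s))\<^sup>2 < d" using T1 by (auto simp: T_def)
  let ?F = "\<lambda>s. exp (c * s) * (norm (k s))\<^sup>2"
  define J where "J t = (LINT s|lebesgue_on {0<..<t}. ?F s)" for t
  have J0: "0 \<le> J t" for t unfolding J_def by (rule integral_nonneg_AE) simp
  have Jt: "J t \<le> J T + d / c * exp (c * t)" if t: "T \<le> t" for t
  proof -
    let ?M = "lebesgue_on {0<..<t}"
    have t0: "0 < t" using t T by simp
    have iT: "integrable (lebesgue_on {0<..<T}) ?F" by (rule L2_space_exp_integrable[OF k[OF T(1)] c])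
    have "integrable lebesgue (\<lambda>s. if s \<in> {0<..<T} then ?F s else 0)"
      using iT Lebesgue_Measure.integrable_restrict_UNIV[of "{0<..<T}" ?F] by simp
    then have "integrable (lebesgue_on UNIV) (\<lambda>s. if s \<in> {0<..<T} then ?F s else 0)"
      by (simp only: lebesgue_on_UNIV_eq)
    then have i1: "integrable ?M (\<lambda>s. if s \<in> {0<..<T} then ?F s else 0)"
      by (rule integrable_lebesgue_on_subset) auto
    have i2: "integrable ?M (\<lambda>s. exp (c * s))" by (rule integrable_continuous_lebesgue_on) (intro continuous_intros)
    have "J t \<le> (LINT s|?M. (if s \<in> {0<..<T} then ?F s else 0) + d * exp (c * s))"
      unfolding J_def
    proof (rule integral_mono_AE[OF L2_space_exp_integrable[OF k[OF t0] c]])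
      show "integrable ?M (\<lambda>s. (if s \<in> {0<..<T} then ?F s else 0) + d * exp (c * s))"
        by (intro Bochner_Integration.integrable_add i1 integrable_mult_right i2)
      show "AE s in ?M. ?F s \<le> (if s \<in> {0<..<T} then ?F s else 0) + d * exp (c * s)"
      proof (rule AE_I2)
        fix s assume "s \<in> space ?M"
        then have s: "0 < s" by simp
        show "?F s \<le> (if s \<in> {0<..<T} then ?F s else 0) + d * exp (c * s)"
        proof (cases "s < T")
          case True then show ?thesis using s d by simp
        next
          case False
          then have "(norm (k s))\<^sup>2 \<le> d" using T(2)[of s] by simp
          then show ?thesis using False by (simp add: mult.commute)
        qed
      qed
    qed
    also have "\<dots> = (LINT s|?M. (if s \<in> {0<..<T} then ?F s else 0)) + (LINT s|?M. d * exp (c * s))"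
      by (intro Bochner_Integration.integral_add i1 integrable_mult_right i2)
    also have "(LINT s|?M. (if s \<in> {0<..<T} then ?F s else 0)) = J T"
      unfolding J_def by (rule Lebesgue_Measure.integral_restrict) (use t in auto)
    also have "(LINT s|?M. d * exp (c * s)) = d * (LINT s|?M. exp (c * s))" by simp
    also have "(LINT s|?M. exp (c * s)) \<le> exp (c * t) / c"
    proof -
      have "((\<lambda>s. exp (c * s)) has_integral (exp (c * t) / c - exp (c * 0) / c)) {0..t}"
        by (rule fundamental_theorem_of_calculus)
          (use t0 c in \<open>auto intro!: derivative_eq_intros simp: has_real_derivative_iff_has_vector_derivative[symmetric]\<close>)
      from has_integral_unique[OF this has_integral_closed_interval[OF i2]] 
      have "(LINT s|?M. exp (c * s)) = exp (c * t) / c - 1 / c" by simp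
      moreover have "0 < 1 / c" using c by simp
      ultimately show ?thesis by linarith
    qed
    finally show ?thesis using d by simp
  qed
  have "((\<lambda>t. exp (- c * t) * J T + d / c) \<longlongrightarrow> 0 * J T + d / c) at_top"
    by (intro tendsto_intros exp_decay_tendsto_0 c)
  moreover have "d / c = e / 2" using c by (simp add: d_def)
  ultimately have "\<forall>\<^sub>F t in at_top. exp (- c * t) * J T + d / c < e"
    using e by (intro order_tendstoD(2)[where y = "0 * J T + d / c"]) auto
  then show "\<forall>\<^sub>F t in at_top. dist (exp (- c * t) * (LINT s|lebesgue_on {0<..<t}. ?F s)) 0 < e"
    using eventually_ge_at_top[of T]
  proof eventually_elim
    case (elim t)
    have "exp (- c * t) * J t \<le> exp (- c * t) * (J T + d / c * exp (c * t))"
      using Jt[OF elim(2)] by (intro mult_left_mono) auto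
    also have "\<dots> = exp (- c * t) * J T + d / c" by (simp add: algebra_simps exp_minus)
    also have "\<dots> < e" by (rule elim(1))
    finally show ?case using J0[of t] by (simp add: J_def[symmetric])
  qed
qed

section \<open>The evolution equation in a single Hilbert space\<close>

text \<open>The normal triple with \<open>V'\<close> identified with \<open>V\<close> by the Riesz isomorphism: \<open>adj\<close> is the
  embedding of \<open>H\<close> in \<open>V'\<close> and \<open>a\<close> the operator \<open>A\<close>.\<close>

locale coercive_triple =
  fixes iV :: "'v::{real_inner, banach} \<Rightarrow> 'h::{real_inner, banach}"
    and adj :: "'h \<Rightarrow> 'v" and a :: "'v \<Rightarrow> 'v" and \<kappa> c :: real
  assumes iV: "bounded_linear iV" and iV_inj: "inj iV" and iV_dense: "closure (range iV) = UNIV"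
    and adj: "bounded_linear adj" and adj_inner: "\<And>h v. adj h \<bullet> v = h \<bullet> iV v"
    and adj_dense: "closure (range adj) = UNIV"
    and a: "bounded_linear a" and \<kappa>: "0 < \<kappa>" and c: "0 < c"
    and coercive: "\<And>v. a v \<bullet> v + \<kappa> * (norm v)\<^sup>2 \<le> - c * (norm (iV v))\<^sup>2"
begin

interpretation iV: bounded_linear iV by (rule iV)
interpretation adj: bounded_linear adj by (rule adj)
interpretation a: bounded_linear a by (rule a)

lemma a_nonpos: "a v \<bullet> v \<le> - \<kappa> * (norm v)\<^sup>2" "a v \<bullet> v \<le> 0"
proof -
  show *: "a v \<bullet> v \<le> - \<kappa> * (norm v)\<^sup>2" using coercive[of v] c
    by (smt (verit) mult_nonneg_nonneg mult_minus_left zero_le_power2)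
  moreover have "0 \<le> \<kappa> * (norm v)\<^sup>2" using \<kappa> by simp
  ultimately show "a v \<bullet> v \<le> 0" by simp
qed

text \<open>It is - a that is coercive and can be inverted; the two minus signs turn its inverse
  into that of \<open>a\<close>.\<close>

definition a_inv :: "'v \<Rightarrow> 'v" where "a_inv y = inv (\<lambda>v. - a v) (- y)"

lemma a_inv: "bounded_linear a_inv" "a (a_inv y) = y" "a_inv (a x) = x"
proof -
  have bl: "bounded_linear (\<lambda>v. - a v)" by (intro bounded_linear_minus a)
  have k: "\<kappa> * (norm v)\<^sup>2 \<le> - a v \<bullet> v" for v using a_nonpos[of v] by simp
  note b = coercive_bijective[OF bl \<kappa> k]
  show "bounded_linear a_inv" unfolding a_inv_def
    by (rule bounded_linear_compose[OF b(2)]) (intro bounded_linear_minus bounded_linear_ident)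
  have "- a (inv (\<lambda>v. - a v) (- y)) = - y" using b(1) by (meson bij_inv_eq_iff)
  then show "a (a_inv y) = y" unfolding a_inv_def by simp
  show "a_inv (a x) = x" unfolding a_inv_def using b(1) bij_is_inj inv_f_f by fastforce
qed

text \<open>\<open>adj (iV (u s))\<close> is the image of u s in V', so the time derivative is taken
  there, one-sided at 0, while u itself is continuous in V. This surplus of regularity makes the
  energy identity elementary.\<close>

definition classical :: "(real \<Rightarrow> 'v) \<Rightarrow> (real \<Rightarrow> 'h) \<Rightarrow> bool" where
  "classical u g \<longleftrightarrow> continuous_on {0..} u \<and> continuous_on {0..} g \<and>
     (\<forall>t\<ge>0. ((\<lambda>s. adj (iV (u s))) has_vector_derivative (a (u t) + adj (g t))) (at t within {0..}))"

lemma classical_add: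
  assumes "classical u g" "classical v h"
  shows "classical (\<lambda>t. u t + v t) (\<lambda>t. g t + h t)"
  using assms unfolding classical_def
  by (auto intro!: continuous_on_add simp: iV.add adj.add a.add add.assoc
      intro!: derivative_eq_intros)

lemma classical_diff:
  assumes "classical u g" "classical v h"
  shows "classical (\<lambda>t. u t - v t) (\<lambda>t. g t - h t)"
  using assms unfolding classical_def
  by (auto intro!: continuous_on_diff simp: iV.diff adj.diff a.diff
      intro!: derivative_eq_intros)

text \<open>The operator \<open>B\<close> is bounded and coercive on V, so the equation becomes u' =
  K u with \<open>K\<close> bounded. The velocity v solves the same equation, and its energy, the
  inner product of B v and v, decreases because \<open>a\<close> is dissipative. It starts below
  |h|^2 for every \<epsilon>, which is the point of requiring a x to lie in the range of
  \<open>adj\<close>.\<close>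

lemma regularised_solution:
  assumes \<epsilon>: "0 < \<epsilon>" and x: "a x = adj h"
  shows "\<exists>u v. u 0 = x \<and> (\<forall>t. (u has_vector_derivative v t) (at t)) \<and>
      (\<forall>t. adj (iV (v t)) + \<epsilon>\<^sup>2 *\<^sub>R v t = a (u t)) \<and>
      (\<forall>t\<ge>0. norm (iV (v t)) \<le> norm h \<and> \<epsilon> * norm (v t) \<le> norm h)"
proof -
  define B where "B v = adj (iV v) + \<epsilon>\<^sup>2 *\<^sub>R v" for v
  have B_inner: "B v \<bullet> w = iV v \<bullet> iV w + \<epsilon>\<^sup>2 * (v \<bullet> w)" for v w
    unfolding B_def by (simp add: inner_add_left adj_inner)
  have B: "bounded_linear B" unfolding B_def
    by (intro bounded_linear_add bounded_linear_compose[OF adj iV] bounded_linear_scaleR_right)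
  have k: "\<epsilon>\<^sup>2 * (norm v)\<^sup>2 \<le> B v \<bullet> v" for v
    unfolding B_inner power2_norm_eq_inner by simp
  note b = coercive_bijective[OF B _ k]
  define K where "K v = inv B (a v)" for v
  have K: "bounded_linear K" unfolding K_def using \<epsilon> by (intro bounded_linear_compose[OF b(2) a]) auto
  have BK: "B (K v) = a v" for v
    unfolding K_def using b(1) \<epsilon> by (simp add: bij_is_surj surj_f_inv_f)
  define u where "u = op_exp K x"
  define v where "v = op_exp K (K x)"
  have v: "v t = K (u t)" for t unfolding u_def v_def by (simp add: op_exp_commute[OF K])
  define E where "E t = (norm (iV (v t)))\<^sup>2 + \<epsilon>\<^sup>2 * (norm (v t))\<^sup>2" for t
  have v': "(v has_vector_derivative K (v t)) (at t within S)" for t S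
    unfolding v_def by (rule has_vector_derivative_at_within[OF op_exp_has_vector_derivative[OF K]])
  have E': "(E has_real_derivative 2 * (a (v t) \<bullet> v t)) (at t within S)" for t S
    unfolding E_def[abs_def] BK[symmetric] B_inner
    by (rule DERIV_cong[OF DERIV_add[OF norm_square_has_derivative[OF iV.has_vector_derivative[OF v']]
            DERIV_cmult[OF norm_square_has_derivative[OF v']]]]) (simp add: algebra_simps)
  \<comment> \<open>B (v 0) = a x = adj h, so \<epsilon> drops out of the initial energy.\<close>
  have E0: "E 0 \<le> norm h * norm (iV (v 0))"
  proof -
    have "E 0 = B (v 0) \<bullet> v 0" unfolding E_def B_inner power2_norm_eq_inner ..
    also have "\<dots> = h \<bullet> iV (v 0)" unfolding v BK u_def op_exp_0[OF K] x adj_inner ..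
    finally show ?thesis using norm_cauchy_schwarz by simp
  qed
  have "(norm (iV (v 0)))\<^sup>2 \<le> norm h * norm (iV (v 0))"
    using E0 unfolding E_def by (smt (verit) mult_nonneg_nonneg zero_le_power2)
  then have "norm (iV (v 0)) \<le> norm h"
    by (cases "norm (iV (v 0)) = 0") (auto simp: power2_eq_square)
  then have E0': "E 0 \<le> (norm h)\<^sup>2" using E0 mult_left_mono[of _ "norm h" "norm h"]
    by (fastforce simp: power2_eq_square)
  have Et: "E t \<le> (norm h)\<^sup>2" if "0 \<le> t" for t
  proof -
    have "E t \<le> E 0" by (rule nonpos_derivative_imp_le[OF E' _ that]) (use a_nonpos in auto)
    then show ?thesis using E0' by simp
  qed
  have 1: "norm (iV (v t)) \<le> norm h" "\<epsilon> * norm (v t) \<le> norm h" if "0 \<le> t" for t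
  proof -
    have "(norm (iV (v t)))\<^sup>2 \<le> (norm h)\<^sup>2" "(\<epsilon> * norm (v t))\<^sup>2 \<le> (norm h)\<^sup>2"
      using Et[OF that] unfolding E_def power_mult_distrib
      by (smt (verit) mult_nonneg_nonneg zero_le_power2)+
    then show "norm (iV (v t)) \<le> norm h" "\<epsilon> * norm (v t) \<le> norm h" by (auto intro: power2_le_imp_le)
  qed
  have 2: "(u has_vector_derivative v t) (at t)" for t
    unfolding v unfolding u_def by (rule op_exp_has_vector_derivative[OF K])
  show ?thesis
    by (rule exI[of _ u], rule exI[of _ v])
      (use 1 2 BK in \<open>auto simp: u_def op_exp_0[OF K] v B_def\<close>)
qed

text \<open>The difference w solves the unregularised equation up to an error of norm at most (e1 +
  e2) h. Testing with w over [0,t] makes w small in H; testing again at the single time t, where w'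
  is at most 2 h in H, turns this into smallness in V.\<close>

lemma regularised_difference:
  assumes h: "0 \<le> h" and e: "0 \<le> e1" "0 \<le> e2" and t: "0 \<le> t"
    and u: "\<And>t. (u1 has_vector_derivative v1 t) (at t)" "\<And>t. (u2 has_vector_derivative v2 t) (at t)" "u1 0 = u2 0"
    and eq: "\<And>t. adj (iV (v1 t)) + e1\<^sup>2 *\<^sub>R v1 t = a (u1 t)" "\<And>t. adj (iV (v2 t)) + e2\<^sup>2 *\<^sub>R v2 t = a (u2 t)"
    and b1: "\<And>t. 0 \<le> t \<Longrightarrow> norm (iV (v1 t)) \<le> h \<and> e1 * norm (v1 t) \<le> h"
    and b2: "\<And>t. 0 \<le> t \<Longrightarrow> norm (iV (v2 t)) \<le> h \<and> e2 * norm (v2 t) \<le> h"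
  shows "(norm (u1 t - u2 t))\<^sup>2 \<le> (2 / \<kappa>) * (2 * h * sqrt (t / \<kappa>) * ((e1 + e2) * h) + ((e1 + e2) * h)\<^sup>2 / (2 * \<kappa>))"
proof -
  define \<eta> where "\<eta> = (e1 + e2) * h"
  have \<eta>0: "0 \<le> \<eta>" using h e by (simp add: \<eta>_def)
  define w where "w s = u1 s - u2 s" for s
  define w' where "w' s = v1 s - v2 s" for s
  define z where "z s = e1\<^sup>2 *\<^sub>R v1 s - e2\<^sup>2 *\<^sub>R v2 s" for s
  have z: "norm (z s) \<le> \<eta>" if "0 \<le> s" for s
  proof -
    have "norm (z s) \<le> e1 * (e1 * norm (v1 s)) + e2 * (e2 * norm (v2 s))"
      unfolding z_def by (rule order_trans[OF norm_triangle_ineq4]) (simp add: power2_eq_square mult.assoc)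
    also have "\<dots> \<le> e1 * h + e2 * h" using b1 b2 that e by (intro add_mono mult_left_mono) auto
    finally show ?thesis by (simp add: \<eta>_def algebra_simps)
  qed
  have eqw: "adj (iV (w' s)) = a (w s) - z s" for s
    unfolding w_def w'_def z_def a.diff iV.diff adj.diff eq[symmetric] by simp
  have w0: "(w has_vector_derivative w' s) (at s within S)" for s S
    unfolding w_def[abs_def] w'_def
    by (intro derivative_intros has_vector_derivative_at_within[OF u(1)] has_vector_derivative_at_within[OF u(2)])
  have ww: "iV (w' s) \<bullet> iV (w s) = a (w s) \<bullet> w s - z s \<bullet> w s" for s
    unfolding adj_inner[symmetric] eqw inner_diff_left ..
  have zw: "- (z s \<bullet> w s) \<le> \<eta> * norm (w s)" if "0 \<le> s" for s
    using Cauchy_Schwarz_ineq2[of "z s" "w s"] mult_right_mono[OF z[OF that], of "norm (w s)"] by auto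
  \<comment> \<open>Young's inequality weighted so that half of the dissipation \<kappa> |w|^2
    absorbs the error term.\<close>
  have young: "\<eta> * r \<le> \<eta>\<^sup>2 / (2 * \<kappa>) + \<kappa> / 2 * r\<^sup>2" for r
  proof -
    have "0 \<le> (\<eta> - \<kappa> * r)\<^sup>2 / (2 * \<kappa>)" using \<kappa> by simp
    also have "\<dots> = \<eta>\<^sup>2 / (2 * \<kappa>) + \<kappa> / 2 * r\<^sup>2 - \<eta> * r"
      using \<kappa> by (simp add: field_simps power2_eq_square)
    finally show ?thesis by simp
  qed
  define \<psi> where "\<psi> s = (norm (iV (w s)))\<^sup>2 - s * (\<eta>\<^sup>2 / \<kappa>)" for s
  have "\<psi> t \<le> \<psi> 0"
  proof (rule nonpos_derivative_imp_le[OF _ _ t])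
    fix s :: real assume s: "0 \<le> s"
    show "(\<psi> has_real_derivative (2 * (iV (w' s) \<bullet> iV (w s)) - \<eta>\<^sup>2 / \<kappa>)) (at s within {0..})"
      unfolding \<psi>_def[abs_def]
      by (rule DERIV_diff[OF norm_square_has_derivative[OF iV.has_vector_derivative[OF w0]]])
        (use \<kappa> in \<open>auto intro!: derivative_eq_intros\<close>)
    have "0 \<le> \<kappa> * (norm (w s))\<^sup>2" using \<kappa> by simp
    then show "2 * (iV (w' s) \<bullet> iV (w s)) - \<eta>\<^sup>2 / \<kappa> \<le> 0"
      unfolding ww using a_nonpos(1)[of "w s"] zw[OF s] young[of "norm (w s)"] by simp
  qed
  then have "(norm (iV (w t)))\<^sup>2 \<le> t * (\<eta>\<^sup>2 / \<kappa>)" using u(3) by (simp add: \<psi>_def w_def iV.zero)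
  then have "norm (iV (w t)) \<le> sqrt (t * (\<eta>\<^sup>2 / \<kappa>))" by (simp add: real_le_rsqrt)
  also have "\<dots> = sqrt (t / \<kappa>) * \<eta>" using \<eta>0 by (simp add: real_sqrt_mult real_sqrt_divide)
  finally have wt: "norm (iV (w t)) \<le> sqrt (t / \<kappa>) * \<eta>" .
  \<comment> \<open>Second use of the equation, now as an identity at time t: the dissipation is
    bounded by the H-product of w' and w, up to the error term.\<close>
  have "norm (iV (w' t)) \<le> 2 * h"
    unfolding w'_def iV.diff using b1[OF t] b2[OF t] norm_triangle_ineq4[of "iV (v1 t)" "iV (v2 t)"] by simp
  then have "- (iV (w' t) \<bullet> iV (w t)) \<le> 2 * h * (sqrt (t / \<kappa>) * \<eta>)"
    using Cauchy_Schwarz_ineq2[of "iV (w' t)" "iV (w t)"] wt h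
      mult_mono[of "norm (iV (w' t))" "2 * h" "norm (iV (w t))" "sqrt (t / \<kappa>) * \<eta>"] by auto
  then have "\<kappa> * (norm (w t))\<^sup>2 \<le> 2 * h * (sqrt (t / \<kappa>) * \<eta>) + (\<eta>\<^sup>2 / (2 * \<kappa>) + \<kappa> / 2 * (norm (w t))\<^sup>2)"
    using ww[of t] a_nonpos(1)[of "w t"] zw[OF t] young[of "norm (w t)"] by simp
  then have "\<kappa> / 2 * (norm (w t))\<^sup>2 \<le> 2 * h * (sqrt (t / \<kappa>) * \<eta>) + \<eta>\<^sup>2 / (2 * \<kappa>)" by simp
  then show ?thesis using \<kappa> unfolding w_def[symmetric] \<eta>_def[symmetric]
    by (simp add: field_simps)
qed

lemma homogeneous_classical:
  assumes x: "a x = adj h"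
  shows "\<exists>u. classical u (\<lambda>_. 0) \<and> u 0 = x"
proof -
  define d where "d n = inverse (real (Suc n))" for n
  have d: "0 < d n" "d n \<le> 1" for n unfolding d_def by (auto simp: field_simps)
  have d0: "d \<longlonglongrightarrow> 0" unfolding d_def by (rule LIMSEQ_inverse_real_of_nat)
  have "\<forall>n. \<exists>p. fst p 0 = x \<and> (\<forall>t. (fst p has_vector_derivative snd p t) (at t)) \<and>
      (\<forall>t. adj (iV (snd p t)) + (d n)\<^sup>2 *\<^sub>R snd p t = a (fst p t)) \<and>
      (\<forall>t\<ge>0. norm (iV (snd p t)) \<le> norm h \<and> d n * norm (snd p t) \<le> norm h)"
    using regularised_solution[OF d(1) x] by simp
  then obtain p where p: "\<And>n. fst (p n) 0 = x \<and> (\<forall>t. (fst (p n) has_vector_derivative snd (p n) t) (at t)) \<and>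
      (\<forall>t. adj (iV (snd (p n) t)) + (d n)\<^sup>2 *\<^sub>R snd (p n) t = a (fst (p n) t)) \<and>
      (\<forall>t\<ge>0. norm (iV (snd (p n) t)) \<le> norm h \<and> d n * norm (snd (p n) t) \<le> norm h)" by metis
  define u where "u n = fst (p n)" for n
  define v where "v n = snd (p n)" for n
  have u0: "u n 0 = x" and u': "(u n has_vector_derivative v n t) (at t)"
    and eq: "adj (iV (v n t)) + (d n)\<^sup>2 *\<^sub>R v n t = a (u n t)" for n t
    using p unfolding u_def v_def by auto
  have b: "norm (iV (v n t)) \<le> norm h \<and> d n * norm (v n t) \<le> norm h" if "0 \<le> t" for n t
    using p that unfolding v_def by auto
  have est: "(norm (u n t - u m t))\<^sup>2 \<le> C * (d n + d m)"
    if "0 \<le> t" "t \<le> T" and C: "C = (2 / \<kappa>) * (2 * norm h * sqrt (T / \<kappa>) * norm h + 2 * (norm h)\<^sup>2 / (2 * \<kappa>))"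
    for n m t T C
  proof -
    let ?e = "d n + d m"
    have e: "0 \<le> ?e" "?e \<le> 2" using d[of n] d[of m] by auto
    have "(norm (u n t - u m t))\<^sup>2 \<le>
        (2 / \<kappa>) * (2 * norm h * sqrt (t / \<kappa>) * (?e * norm h) + (?e * norm h)\<^sup>2 / (2 * \<kappa>))"
      by (rule regularised_difference[OF _ _ _ that(1) u' u' _ eq eq b b]) (use d u0 in \<open>auto intro: less_imp_le\<close>)
    also have "\<dots> \<le> (2 / \<kappa>) * (2 * norm h * sqrt (T / \<kappa>) * (?e * norm h) + (2 * ?e) * (norm h)\<^sup>2 / (2 * \<kappa>))"
    proof (intro mult_left_mono add_mono mult_right_mono divide_right_mono)
      have "?e * ?e \<le> 2 * ?e" using e by (intro mult_right_mono)
      then show "(?e * norm h)\<^sup>2 \<le> (2 * ?e) * (norm h)\<^sup>2"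
        unfolding power_mult_distrib by (intro mult_right_mono) (auto simp: power2_eq_square)
      show "sqrt (t / \<kappa>) \<le> sqrt (T / \<kappa>)" using that \<kappa> by (simp add: divide_right_mono)
    qed (use \<kappa> e in auto)
    also have "\<dots> = C * ?e" unfolding C using \<kappa> by (simp add: field_simps)
    finally show ?thesis .
  qed
  have ul: "uniformly_Cauchy_on {0..T} u" for T
  proof (rule uniformly_Cauchy_onI)
    fix e :: real assume e: "0 < e"
    define C where "C = (2 / \<kappa>) * (2 * norm h * sqrt (T / \<kappa>) * norm h + 2 * (norm h)\<^sup>2 / (2 * \<kappa>))"
    have "(\<lambda>n. C * (d n + d n)) \<longlonglongrightarrow> C * (0 + 0)" by (intro tendsto_intros d0)
    then have "\<forall>\<^sub>F n in sequentially. \<bar>C * (d n + d n)\<bar> < e\<^sup>2"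
      using tendstoD[of "\<lambda>n. C * (d n + d n)" 0 sequentially "e\<^sup>2"] e by (simp add: dist_real_def)
    then obtain N where N: "\<And>n. n \<ge> N \<Longrightarrow> \<bar>C * (d n + d n)\<bar> < e\<^sup>2" unfolding eventually_sequentially by blast
    have "dist (u m t) (u n t) < e" if "m \<ge> N" "n \<ge> N" "t \<in> {0..T}" for m n t
    proof -
      have "(norm (u m t - u n t))\<^sup>2 \<le> C * (d m + d n)" using est[of t T C m n] that C_def by simp
      also have "\<dots> < e\<^sup>2" using N[OF that(1)] N[OF that(2)] by (simp add: algebra_simps)
      finally show ?thesis using e by (simp add: dist_norm power2_less_imp_less)
    qed
    then show "\<exists>M. \<forall>x\<in>{0..T}. \<forall>m\<ge>M. \<forall>n\<ge>M. dist (u m x) (u n x) < e" by blast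
  qed
  define U where "U t = lim (\<lambda>n. u n t)" for t
  have UL: "uniform_limit {0..T} u U sequentially" for T
    using Cauchy_uniformly_convergent[OF ul] unfolding uniformly_convergent_uniform_limit_iff U_def[abs_def] .
  have uc: "continuous_on S (u n)" for n S
    by (rule continuous_at_imp_continuous_on) (use u' has_vector_derivative_continuous in blast)
  have UcT: "continuous_on {0..T} U" for T
    by (rule uniform_limit_theorem[OF _ UL]) (use uc in auto)
  have Uc: "continuous_on {0..} U" by (rule continuous_on_atLeast_if_bounded_intervals[OF UcT])
  have U0: "U 0 = x" unfolding U_def u0 by simp
  obtain Ca where Ca: "0 < Ca" "\<And>y. norm (a y) \<le> norm y * Ca" using a.pos_bounded by blast
  obtain Cj where Cj: "0 < Cj" "\<And>y. norm (adj (iV y)) \<le> norm y * Cj"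
    using bounded_linear.pos_bounded[OF bounded_linear_compose[OF adj iV]] by blast
  \<comment> \<open>The velocities are only known to be bounded in H, so the limit is taken in the
    integrated equation; the derivative returns through the continuity of a (U s).\<close>
  have int: "((\<lambda>s. a (U s)) has_integral (adj (iV (U t)) - adj (iV (U 0)))) {0..t}" if t: "0 \<le> t" for t
    unfolding cbox_interval[symmetric]
  proof (rule has_integral_approximation[OF negligible_empty])
    fix e :: real assume e: "0 < e"
    \<comment> \<open>The two bounds serve the boundary term and the integrand; t + 1 avoids
      dividing by zero at t = 0. The regularising term of the integrand is d n times d n |v n|,
      hence at most d n |h|.\<close>
    define r where "r = min (e / Cj) (e / (2 * Ca * (t + 1)))"
    have r: "0 < r" using e Cj Ca t by (simp add: r_def)
    have "\<forall>\<^sub>F n in sequentially. \<forall>s\<in>{0..t}. dist (u n s) (U s) < r"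
      using UL[of t] r unfolding uniform_limit_iff by blast
    moreover have "\<forall>\<^sub>F n in sequentially. dist (d n * norm h) 0 < e / (2 * (t + 1))"
      using tendstoD[OF tendsto_mult_left_zero[OF d0, of "norm h"], of "e / (2 * (t + 1))"] e t by simp
    ultimately have "\<forall>\<^sub>F n in sequentially. (\<forall>s\<in>{0..t}. dist (u n s) (U s) < r) \<and> dist (d n * norm h) 0 < e / (2 * (t + 1))"
      by eventually_elim auto
    then obtain n where n: "\<And>s. 0 \<le> s \<Longrightarrow> s \<le> t \<Longrightarrow> dist (u n s) (U s) < r" "dist (d n * norm h) 0 < e / (2 * (t + 1))"
      using eventually_happens[of _ sequentially] by (metis (no_types, lifting) atLeastAtMost_iff sequentially_bot)
    define F where "F s = a (u n s) - (d n)\<^sup>2 *\<^sub>R v n s" for s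
    have F: "(F has_integral (adj (iV (u n t)) - adj (iV (u n 0)))) {0..t}"
    proof (rule fundamental_theorem_of_calculus[OF t])
      fix s
      have "F s = adj (iV (v n s))" unfolding F_def eq[symmetric] by simp
      then show "((\<lambda>s. adj (iV (u n s))) has_vector_derivative F s) (at s within {0..t})"
        using adj.has_vector_derivative[OF iV.has_vector_derivative[OF has_vector_derivative_at_within[OF u']]]
        by simp
    qed
    show "\<exists>F I h i. (F has_integral I) (cbox 0 t) \<and> norm (I - (adj (iV (U t)) - adj (iV (U 0)))) \<le> e \<and>
        (h has_integral i) (cbox 0 t) \<and> i \<le> e \<and> (\<forall>s\<in>cbox 0 t - {}. norm (F s - a (U s)) \<le> h s)"
    proof (intro exI conjI ballI)
      show "(F has_integral (adj (iV (u n t)) - adj (iV (u n 0)))) (cbox 0 t)" using F by simp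
      have "norm (adj (iV (u n t - U t))) \<le> norm (u n t - U t) * Cj" by (rule Cj)
      also have "\<dots> \<le> (e / Cj) * Cj"
        using n(1)[of t] t Cj by (intro mult_right_mono) (auto simp: dist_norm r_def)
      finally show "norm (adj (iV (u n t)) - adj (iV (u n 0)) - (adj (iV (U t)) - adj (iV (U 0)))) \<le> e"
        using Cj by (simp add: iV.diff adj.diff u0 U0)
      show "((\<lambda>s. e / (t + 1)) has_integral (e / (t + 1) * t)) (cbox 0 t)"
        using has_integral_const_real[of "e / (t + 1)" 0 t] t by (simp add: mult.commute)
      show "e / (t + 1) * t \<le> e" using t e by (simp add: field_simps)
      fix s assume "s \<in> cbox 0 t - {}"
      then have s: "0 \<le> s" "s \<le> t" by auto
      have "norm (F s - a (U s)) = norm (a (u n s - U s) - (d n)\<^sup>2 *\<^sub>R v n s)"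
        unfolding F_def a.diff by (simp add: algebra_simps)
      also have "\<dots> \<le> norm (u n s - U s) * Ca + d n * (d n * norm (v n s))"
        using norm_triangle_ineq4[of "a (u n s - U s)" "(d n)\<^sup>2 *\<^sub>R v n s"] Ca(2)[of "u n s - U s"]
        by (simp add: power2_eq_square mult.assoc)
      also have "\<dots> \<le> (e / (2 * Ca * (t + 1))) * Ca + d n * norm h"
        using n(1)[OF s] Ca b[OF s(1)] d[of n]
        by (intro add_mono mult_right_mono mult_left_mono) (auto simp: dist_norm r_def)
      also have "\<dots> \<le> e / (2 * (t + 1)) + e / (2 * (t + 1))"
      proof (rule add_mono)
        show "e / (2 * Ca * (t + 1)) * Ca \<le> e / (2 * (t + 1))" using Ca(1) t by simp
        show "d n * norm h \<le> e / (2 * (t + 1))" using n(2) unfolding dist_real_def by linarith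
      qed
      also have "\<dots> = e / (t + 1)" using field_sum_of_halves[of "e / (t + 1)"] by (simp add: mult.commute)
      finally show "norm (F s - a (U s)) \<le> e / (t + 1)" .
    qed
  qed
  have aUc: "continuous_on {0..} (\<lambda>s. a (U s))" by (intro a.continuous_on Uc)
  have "classical U (\<lambda>_. 0)"
    unfolding classical_def using has_vector_derivative_of_integral[OF aUc int] Uc
    by (auto simp: adj.zero)
  then show ?thesis using U0 by blast
qed

text \<open>With a q = - adj h, the function t^(k+1) q balances the source t^(k+1) h except for its
  own time derivative, which acts as a further source of degree k; the induction hypothesis cancels
  it. In degree 0 the solution is constant.\<close>

lemma monomial_classical: "\<exists>u. classical u (\<lambda>t. t ^ k *\<^sub>R h)"
proof (induction k arbitrary: h)
  case 0
  have "classical (\<lambda>t. a_inv (- adj h)) (\<lambda>t. t ^ 0 *\<^sub>R h)"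
    unfolding classical_def by (auto simp: a_inv(2))
  then show ?case by blast
next
  case (Suc k)
  define q where "q = a_inv (- adj h)"
  obtain r where r: "classical r (\<lambda>t. t ^ k *\<^sub>R (- (real (Suc k) *\<^sub>R iV q)))" using Suc by blast
  have "classical (\<lambda>t. t ^ Suc k *\<^sub>R q) (\<lambda>t. t ^ Suc k *\<^sub>R h + t ^ k *\<^sub>R (real (Suc k) *\<^sub>R iV q))"
    unfolding classical_def
  proof (intro conjI allI impI)
    fix t :: real
    have "((\<lambda>t. t ^ Suc k) has_real_derivative (real (Suc k) * t ^ k)) (at t within {0..})"
      by (rule derivative_eq_intros refl | simp)+
    then have "((\<lambda>t. t ^ Suc k *\<^sub>R adj (iV q)) has_vector_derivative (real (Suc k) * t ^ k) *\<^sub>R adj (iV q)) (at t within {0..})"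
      using has_vector_derivative_scaleR[OF _ has_vector_derivative_const[of "adj (iV q)"]] by fastforce
    then show "((\<lambda>s. adj (iV (s ^ Suc k *\<^sub>R q))) has_vector_derivative
        a (t ^ Suc k *\<^sub>R q) + adj (t ^ Suc k *\<^sub>R h + t ^ k *\<^sub>R (real (Suc k) *\<^sub>R iV q))) (at t within {0..})"
      unfolding adj.scaleR iV.scaleR a.scaleR adj.add q_def a_inv(2)
      by (simp add: mult.commute del: of_nat_Suc power_Suc)
  qed (intro continuous_intros)+
  from classical_add[OF this r] have "classical (\<lambda>t. t ^ Suc k *\<^sub>R q + r t) (\<lambda>t. t ^ Suc k *\<^sub>R h)"
    by (simp del: of_nat_Suc power_Suc)
  then show ?case by blast
qed

section \<open>The energy identity for classical solutions\<close>

text \<open>With values of \<open>u\<close> in \<open>V\<close>, differentiability of \<open>u\<close> in \<open>V'\<close> is enough for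
  \<open>\<parallel>u\<parallel>\<^sub>H\<^sup>2\<close> to be differentiable.\<close>

lemma classical_norm_derivative:
  assumes u: "classical u g" and t: "0 \<le> t"
  shows "((\<lambda>s. (norm (iV (u s)))\<^sup>2) has_real_derivative 2 * ((a (u t) + adj (g t)) \<bullet> u t)) (at t within {0..})"
proof -
  define y where "y s = adj (iV (u s))" for s
  have y: "(y has_vector_derivative (a (u t) + adj (g t))) (at t within {0..})"
    using u t unfolding classical_def y_def[abs_def] by auto
  have uc: "(u \<longlongrightarrow> u t) (at t within {0..})"
    using u t unfolding classical_def continuous_on_def by auto
  have yl: "((\<lambda>s. (y s - y t) /\<^sub>R (s - t)) \<longlongrightarrow> a (u t) + adj (g t)) (at t within {0..})"
  proof (rule LIM_zero_cancel, rule tendsto_norm_zero_cancel, rule Lim_transform_eventually)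
    show "((\<lambda>s. norm ((y s - y t) - (s - t) *\<^sub>R (a (u t) + adj (g t))) / norm (s - t)) \<longlongrightarrow> 0) (at t within {0..})"
      using y unfolding has_vector_derivative_def has_derivative_iff_norm by blast
    show "\<forall>\<^sub>F s in at t within {0..}. norm ((y s - y t) - (s - t) *\<^sub>R (a (u t) + adj (g t))) / norm (s - t) =
        norm ((y s - y t) /\<^sub>R (s - t) - (a (u t) + adj (g t)))"
      unfolding eventually_at_filter
    proof (rule always_eventually, intro allI impI)
      fix s assume "s \<noteq> t"
      then have "(y s - y t) /\<^sub>R (s - t) - (a (u t) + adj (g t)) =
          inverse (s - t) *\<^sub>R ((y s - y t) - (s - t) *\<^sub>R (a (u t) + adj (g t)))"
        by (simp add: scaleR_diff_right)
      then show "norm ((y s - y t) - (s - t) *\<^sub>R (a (u t) + adj (g t))) / norm (s - t) =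
        norm ((y s - y t) /\<^sub>R (s - t) - (a (u t) + adj (g t)))"
        by (simp add: divide_inverse mult.commute)
    qed
  qed
  show ?thesis
    unfolding has_field_derivative_iff
  proof (rule Lim_transform_eventually)
    \<comment> \<open>|x|^2 - |y|^2 is the product of x - y and x + y: the difference quotient
      converges in V' and u s + u t in V, so their pairing converges.\<close>
    show "((\<lambda>s. ((y s - y t) /\<^sub>R (s - t)) \<bullet> (u s + u t)) \<longlongrightarrow> 2 * ((a (u t) + adj (g t)) \<bullet> u t)) (at t within {0..})"
      using tendsto_inner[OF yl tendsto_add[OF uc tendsto_const[of "u t"]]] by (simp add: inner_add_right)
    show "\<forall>\<^sub>F s in at t within {0..}. ((y s - y t) /\<^sub>R (s - t)) \<bullet> (u s + u t) =
        ((norm (iV (u s)))\<^sup>2 - (norm (iV (u t)))\<^sup>2) / (s - t)"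
    \<comment> \<open>At s = t both sides are 0, division by 0 being 0, so the identity holds
      without exception.\<close>
    proof (rule always_eventually, rule allI)
      fix s
      have "(y s - y t) \<bullet> (u s + u t) = (norm (iV (u s)))\<^sup>2 - (norm (iV (u t)))\<^sup>2"
        unfolding y_def inner_diff_left adj_inner iV.add inner_add_right power2_norm_eq_inner
        by (simp add: inner_commute)
      then show "((y s - y t) /\<^sub>R (s - t)) \<bullet> (u s + u t) =
        ((norm (iV (u s)))\<^sup>2 - (norm (iV (u t)))\<^sup>2) / (s - t)"
        by (simp add: divide_inverse mult.commute)
    qed
  qed
qed

text \<open>Coercivity dissipates 2 c |u|^2 in H. Half of it absorbs the derivative of the factor
  exp(c t), the other half the term c |u|^2 that Young's inequality produces from the source; hence
  the constant 1 / c.\<close>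

lemma classical_energy:
  assumes u: "classical u g" and t: "0 \<le> t"
  shows "exp (c * t) * (norm (iV (u t)))\<^sup>2 + 2 * \<kappa> * integral {0..t} (\<lambda>s. exp (c * s) * (norm (u s))\<^sup>2)
     \<le> (norm (iV (u 0)))\<^sup>2 + (1 / c) * integral {0..t} (\<lambda>s. exp (c * s) * (norm (g s))\<^sup>2)"
proof -
  have uc: "continuous_on {0..} u" and gc: "continuous_on {0..} g" using u unfolding classical_def by auto
  define p where "p s = exp (c * s) * (norm (u s))\<^sup>2" for s
  define q where "q s = exp (c * s) * (norm (g s))\<^sup>2" for s
  have pc: "continuous_on {0..} p" and qc: "continuous_on {0..} q"
    unfolding p_def q_def by (intro continuous_intros uc gc)+
  have der: "((\<lambda>t. integral {0..t} f) has_real_derivative f s) (at s within {0..})"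
    if "continuous_on {0..} f" "0 \<le> s" for f s
    unfolding has_real_derivative_iff_has_vector_derivative
    by (rule has_vector_derivative_of_integral[OF that(1) _ that(2)])
      (use that(1) in \<open>auto intro!: integrable_integral integrable_continuous_real intro: continuous_on_subset\<close>)
  define \<psi> where "\<psi> s = exp (c * s) * (norm (iV (u s)))\<^sup>2 + 2 * \<kappa> * integral {0..s} p - (1 / c) * integral {0..s} q" for s
  have "\<psi> t \<le> \<psi> 0"
  proof (rule nonpos_derivative_imp_le[OF _ _ t])
    fix s :: real assume s: "0 \<le> s"
    have e: "((\<lambda>s. exp (c * s)) has_real_derivative c * exp (c * s)) (at s within {0..})"
      by (auto intro!: derivative_eq_intros)
    show "(\<psi> has_real_derivative
        (c * exp (c * s)) * (norm (iV (u s)))\<^sup>2 + (2 * ((a (u s) + adj (g s)) \<bullet> u s)) * exp (c * s)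
        + 2 * \<kappa> * p s - (1 / c) * q s) (at s within {0..})"
      unfolding \<psi>_def[abs_def]
      by (rule DERIV_diff[OF DERIV_add[OF DERIV_mult[OF e classical_norm_derivative[OF u s]]
              DERIV_cmult[OF der[OF pc s]]] DERIV_cmult[OF der[OF qc s]]])
    have "2 * (g s \<bullet> iV (u s)) \<le> c * (norm (iV (u s)))\<^sup>2 + (norm (g s))\<^sup>2 / c"
    proof -
      have "0 \<le> (c * norm (iV (u s)) - norm (g s))\<^sup>2 / c" using c by simp
      also have "\<dots> = c * (norm (iV (u s)))\<^sup>2 + (norm (g s))\<^sup>2 / c - 2 * (norm (g s) * norm (iV (u s)))"
        using c by (simp add: field_simps power2_eq_square)
      finally show ?thesis using norm_cauchy_schwarz[of "g s" "iV (u s)"] by linarith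
    qed
    then have "c * (norm (iV (u s)))\<^sup>2 + 2 * ((a (u s) + adj (g s)) \<bullet> u s) + 2 * \<kappa> * (norm (u s))\<^sup>2 - (1 / c) * (norm (g s))\<^sup>2 \<le> 0"
      using coercive[of "u s"] by (simp add: inner_add_left adj_inner)
    then have "exp (c * s) * (c * (norm (iV (u s)))\<^sup>2 + 2 * ((a (u s) + adj (g s)) \<bullet> u s) + 2 * \<kappa> * (norm (u s))\<^sup>2 - (1 / c) * (norm (g s))\<^sup>2) \<le> 0"
      by (simp add: mult_le_0_iff)
    then show "(c * exp (c * s)) * (norm (iV (u s)))\<^sup>2 + (2 * ((a (u s) + adj (g s)) \<bullet> u s)) * exp (c * s)
        + 2 * \<kappa> * p s - (1 / c) * q s \<le> 0"
      unfolding p_def q_def by (simp add: algebra_simps)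
  qed
  then show ?thesis unfolding \<psi>_def p_def q_def by simp
qed

text \<open>Two densities in turn: y is approximated by some v in V, then a v by some
  \<open>adj h\<close>; the bounded composition of \<open>iV\<close> and \<open>a_inv\<close>
  carries the second error back to H.\<close>

lemma initial_values_dense:
  assumes "0 < e"
  shows "\<exists>x h. a x = adj h \<and> norm (iV x - y) < e"
proof -
  obtain v where v: "norm (iV v - y) < e / 2"
    using iV_dense assms closure_approachable[of y "range iV"]
    by (metis UNIV_I dist_norm half_gt_zero imageE)
  obtain C where C: "0 < C" "\<And>w. norm (iV (a_inv w)) \<le> norm w * C"
    using bounded_linear.pos_bounded[OF bounded_linear_compose[OF iV a_inv(1)]] by blast
  have "0 < e / (2 * C)" using assms C by simp
  then obtain h where h: "norm (adj h - a v) < e / (2 * C)"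
    using adj_dense closure_approachable[of "a v" "range adj"]
    by (metis UNIV_I dist_norm imageE)
  have "iV (a_inv (adj h)) - iV v = iV (a_inv (adj h - a v))"
    by (simp add: bounded_linear.linear[OF a_inv(1)] linear_diff a_inv(3) iV.diff)
  then have "norm (iV (a_inv (adj h)) - iV v) \<le> norm (adj h - a v) * C" using C by simp
  also have "\<dots> < e / 2" using h C by (simp add: field_simps)
  finally have "norm (iV (a_inv (adj h)) - y) < e"
    using v norm_triangle_ineq[of "iV (a_inv (adj h)) - iV v" "iV v - y"] by simp
  then show ?thesis using a_inv(2) by blast
qed

text \<open>The reason for an inductive \<open>vpoly\<close>: rule induction is superposition of
  monomial sources.\<close>

lemma vpoly_classical: "vpoly p \<Longrightarrow> \<exists>u. classical u p"
proof (induction rule: vpoly.induct)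
  case (monomial k h) show ?case by (rule monomial_classical)
next
  case (add p q) then show ?case using classical_add by blast
qed

lemma classical_approximation:
  assumes g: "g \<in> L2_space T" and T: "0 < T" and e: "0 < e" "0 < d"
  shows "\<exists>u p. classical u p \<and> L2_near T e g p \<and> norm (iV (u 0) - u0) < d"
proof -
  obtain p where p: "vpoly p" "L2_near T e g p"
    using L2_space_imp_approx[OF T g] e unfolding L2_approx_def by blast
  obtain u1 where u1: "classical u1 p" using vpoly_classical[OF p(1)] by blast
  \<comment> \<open>The particular solution has an uncontrolled initial value; a homogeneous
    solution starting near u0 - iV (u1 0) corrects it.\<close>
  obtain x h where x: "a x = adj h" "norm (iV x - (u0 - iV (u1 0))) < d" using initial_values_dense[OF e(2)] by blast
  obtain u2 where u2: "classical u2 (\<lambda>_. 0)" "u2 0 = x" using homogeneous_classical[OF x(1)] by blast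
  have "classical (\<lambda>t. u1 t + u2 t) p" using classical_add[OF u1 u2(1)] by simp
  moreover have "norm (iV (u1 0 + u2 0) - u0) < d" using x(2) u2(2) by (simp add: iV.add algebra_simps)
  ultimately show ?thesis using p(2) by blast
qed

section \<open>Integrated estimates and weak solutions\<close>

lemma classical_integrable:
  assumes "classical u g"
  shows "integrable (lebesgue_on {0<..<T}) (\<lambda>s. (norm (u s))\<^sup>2)"
    and "integrable (lebesgue_on {0<..<T}) (\<lambda>s. (norm (g s))\<^sup>2)"
    and "integrable (lebesgue_on {0<..<T}) (\<lambda>s. exp (c * s) * (norm (u s))\<^sup>2)"
    and "integrable (lebesgue_on {0<..<T}) (\<lambda>s. exp (c * s) * (norm (g s))\<^sup>2)"
  using assms unfolding classical_def
  by (auto intro!: integrable_continuous_lebesgue_on continuous_intros)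

lemma classical_energy_L2:
  assumes u: "classical u g" and t: "0 \<le> t"
  shows "exp (c * t) * (norm (iV (u t)))\<^sup>2 + 2 * \<kappa> * (LINT s|lebesgue_on {0<..<t}. exp (c * s) * (norm (u s))\<^sup>2)
     \<le> (norm (iV (u 0)))\<^sup>2 + (1 / c) * (LINT s|lebesgue_on {0<..<t}. exp (c * s) * (norm (g s))\<^sup>2)"
  using classical_energy[OF u t]
  unfolding integral_unique[OF has_integral_closed_interval[OF classical_integrable(3)[OF u]]]
    integral_unique[OF has_integral_closed_interval[OF classical_integrable(4)[OF u]]] .

text \<open>Intended for differences of approximate solutions: the bounds make these summable
  uniformly in H and in the square mean in V.\<close>

lemma classical_estimate:
  assumes u: "classical u g" and near: "L2_near T e g (\<lambda>_. 0)" and t: "0 \<le> t" "t \<le> T"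
  shows "(norm (iV (u t)))\<^sup>2 \<le> (norm (iV (u 0)))\<^sup>2 + exp (c * T) / c * e"
    and "2 * \<kappa> * (LINT s|lebesgue_on {0<..<t}. (norm (u s))\<^sup>2) \<le> (norm (iV (u 0)))\<^sup>2 + exp (c * T) / c * e"
proof -
  obtain \<phi> where \<phi>: "integrable (lebesgue_on {0<..<t}) \<phi>" "(LINT s|lebesgue_on {0<..<t}. \<phi> s) \<le> e"
     "AE s in lebesgue_on {0<..<t}. (norm (g s))\<^sup>2 \<le> \<phi> s"
    using L2_near_subinterval[OF near t(2)] unfolding L2_near_def by auto
  have ex: "exp (c * s) \<le> exp (c * T)" if "s \<le> T" for s using that c by simp
  have ex1: "1 \<le> exp (c * s)" if "0 \<le> s" for s using that c by simp
  have "(LINT s|lebesgue_on {0<..<t}. exp (c * s) * (norm (g s))\<^sup>2) \<le> (LINT s|lebesgue_on {0<..<t}. exp (c * T) * \<phi> s)"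
  proof (rule integral_mono_AE[OF classical_integrable(4)[OF u]])
    show "AE s in lebesgue_on {0<..<t}. exp (c * s) * (norm (g s))\<^sup>2 \<le> exp (c * T) * \<phi> s"
      using \<phi>(3) AE_space by eventually_elim (use ex t c in \<open>auto intro!: mult_mono\<close>)
  qed (use \<phi> in simp)
  also have "\<dots> \<le> exp (c * T) * e" using \<phi>(2) by simp
  finally have "(1 / c) * (LINT s|lebesgue_on {0<..<t}. exp (c * s) * (norm (g s))\<^sup>2) \<le> exp (c * T) / c * e"
    using c by (simp add: field_simps)
  with classical_energy_L2[OF u t(1)]
  have main: "exp (c * t) * (norm (iV (u t)))\<^sup>2 + 2 * \<kappa> * (LINT s|lebesgue_on {0<..<t}. exp (c * s) * (norm (u s))\<^sup>2)
    \<le> (norm (iV (u 0)))\<^sup>2 + exp (c * T) / c * e" by simp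
  have "0 \<le> (LINT s|lebesgue_on {0<..<t}. exp (c * s) * (norm (u s))\<^sup>2)" by (rule integral_nonneg_AE) simp
  then have "0 \<le> 2 * \<kappa> * (LINT s|lebesgue_on {0<..<t}. exp (c * s) * (norm (u s))\<^sup>2)" using \<kappa> by simp
  moreover have "(norm (iV (u t)))\<^sup>2 \<le> exp (c * t) * (norm (iV (u t)))\<^sup>2"
    using mult_right_mono[OF ex1[OF t(1)], of "(norm (iV (u t)))\<^sup>2"] by simp
  ultimately show "(norm (iV (u t)))\<^sup>2 \<le> (norm (iV (u 0)))\<^sup>2 + exp (c * T) / c * e" using main by linarith
  have "(LINT s|lebesgue_on {0<..<t}. (norm (u s))\<^sup>2) \<le> (LINT s|lebesgue_on {0<..<t}. exp (c * s) * (norm (u s))\<^sup>2)"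
  proof (rule integral_mono_AE[OF classical_integrable(1)[OF u] classical_integrable(3)[OF u]], rule AE_I2)
    fix s assume "s \<in> space (lebesgue_on {0<..<t})"
    then show "(norm (u s))\<^sup>2 \<le> exp (c * s) * (norm (u s))\<^sup>2"
      using mult_right_mono[OF ex1[of s], of "(norm (u s))\<^sup>2"] by simp
  qed
  then have "2 * \<kappa> * (LINT s|lebesgue_on {0<..<t}. (norm (u s))\<^sup>2) \<le> 2 * \<kappa> * (LINT s|lebesgue_on {0<..<t}. exp (c * s) * (norm (u s))\<^sup>2)"
    using \<kappa> by simp
  moreover have "0 \<le> exp (c * t) * (norm (iV (u t)))\<^sup>2" by simp
  ultimately show "2 * \<kappa> * (LINT s|lebesgue_on {0<..<t}. (norm (u s))\<^sup>2) \<le> (norm (iV (u 0)))\<^sup>2 + exp (c * T) / c * e"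
    using main by linarith
qed

text \<open>The n-th approximation is good on (0, n + 1), so for each T all but finitely many serve,
  and one sequence yields the solution for all times. It converges in H uniformly on bounded
  intervals, in V only at almost every time.\<close>

lemma weak_solution_exists:
  assumes g: "\<And>T. 0 < T \<Longrightarrow> g \<in> L2_space T"
  shows "\<exists>U. continuous_on {0..} U \<and> (\<forall>T>0. U \<in> L2V_space iV T) \<and>
    (\<forall>t\<ge>0. ((\<lambda>s. a (inv iV (U s)) + adj (g s)) has_integral (adj (U t) - adj u0)) {0..t}) \<and>
    (\<forall>t>0. exp (c * t) * (norm (U t))\<^sup>2 \<le>
       (norm u0)\<^sup>2 + (2 / c) * (LINT s|lebesgue_on {0<..<t}. exp (c * s) * (norm (g s))\<^sup>2))"
proof -
  \<comment> \<open>Squared source errors of (1/16)^n and initial errors of (1/4)^n, whose squares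
    are (1/16)^n too, remain summable after multiplication by 4^n, as convergence almost everywhere
    in V will require.\<close>
  have "\<exists>q. classical (fst q) (snd q) \<and> L2_near (real n + 1) ((1/16) ^ n) g (snd q) \<and> norm (iV (fst q 0) - u0) < (1/4) ^ n" for n
    using classical_approximation[OF g, of "real n + 1" "(1/16) ^ n" "(1/4) ^ n" u0] by auto
  then obtain q where q: "\<And>n. classical (fst (q n)) (snd (q n)) \<and> L2_near (real n + 1) ((1/16) ^ n) g (snd (q n))
      \<and> norm (iV (fst (q n) 0) - u0) < (1/4) ^ n" by metis
  define u where "u n = fst (q n)" for n
  define p where "p n = snd (q n)" for n
  have cl: "classical (u n) (p n)" and near: "L2_near (real n + 1) ((1/16) ^ n) g (p n)"
    and u0: "norm (iV (u n 0) - u0) < (1/4) ^ n" for n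
    using q unfolding u_def p_def by auto
  have uc: "continuous_on {0..} (u n)" for n using cl unfolding classical_def by blast
  have nearT: "L2_near T ((1/16) ^ n) g (p n)" if "T \<le> real n" for n T
    using L2_near_subinterval[OF near] that by simp
  define d where "d n t = u (Suc n) t - u n t" for n t
  have dcl: "classical (d n) (\<lambda>t. p (Suc n) t - p n t)" for n
    unfolding d_def[abs_def] by (rule classical_diff[OF cl cl])
  have dnear: "L2_near T (4 * (1/16) ^ n) (\<lambda>t. p (Suc n) t - p n t) (\<lambda>_. 0)" if "T \<le> real n" for n T
  proof -
    have "T \<le> real (Suc n)" using that by simp
    from L2_near_trans[OF L2_near_sym[OF nearT[OF this]] nearT[OF that]]
    have "L2_near T (4 * (1/16) ^ n) (p (Suc n)) (p n)" by (rule L2_near_mono) simp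
    then show ?thesis unfolding L2_near_def by simp
  qed
  have d0: "(norm (iV (d n 0)))\<^sup>2 \<le> 4 * (1/16) ^ n" for n
  proof -
    have "norm (iV (d n 0)) \<le> norm (iV (u (Suc n) 0) - u0) + norm (iV (u n 0) - u0)"
      unfolding d_def iV.diff using norm_triangle_ineq4[of "iV (u (Suc n) 0) - u0" "iV (u n 0) - u0"] by simp
    also have "\<dots> \<le> (1/4) ^ Suc n + (1/4) ^ n" using u0 by (intro add_mono less_imp_le)
    also have "\<dots> \<le> 2 * (1/4) ^ n" by simp
    finally have "(norm (iV (d n 0)))\<^sup>2 \<le> (2 * (1/4) ^ n)\<^sup>2" by (intro power_mono) auto
    also have "\<dots> = 4 * (1/16) ^ n"
      by (simp add: power_mult_distrib power_mult[symmetric] mult.commute[of _ 2]) (simp add: power_mult power2_eq_square power_one_over)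
    finally show ?thesis .
  qed
  \<comment> \<open>4 (1/16)^n bounds both the squared initial difference and, by
    \<open>dnear\<close>, the squared source difference; \<open>classical_estimate\<close> combines
    the two.\<close>
  define K where "K T = 4 + exp (c * T) / c * 4" for T
  have K0: "0 \<le> K T" for T unfolding K_def using c by simp
  have est: "(norm (iV (d n t)))\<^sup>2 \<le> K T * (1/16) ^ n"
    "2 * \<kappa> * (LINT s|lebesgue_on {0<..<t}. (norm (d n s))\<^sup>2) \<le> K T * (1/16) ^ n"
    if "0 \<le> t" "t \<le> T" "T \<le> real n" for n t T
    using classical_estimate[OF dcl dnear[OF that(3)] that(1,2)] d0[of n]
    unfolding K_def by (simp_all add: algebra_simps)
  have est1: "norm (iV (d n t)) \<le> sqrt (K T) * (1/4) ^ n" if "0 \<le> t" "t \<le> T" "T \<le> real n" for n t T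
  proof -
    have "(1/16::real) ^ n = ((1/4) ^ n)\<^sup>2"
      by (simp add: power_mult[symmetric] mult.commute[of _ 2]) (simp add: power_mult power2_eq_square power_one_over)
    then have "(norm (iV (d n t)))\<^sup>2 \<le> (sqrt (K T) * (1/4) ^ n)\<^sup>2"
      using est(1)[OF that] K0[of T] by (simp add: power_mult_distrib)
    then show ?thesis using K0[of T] by (auto intro: power2_le_imp_le)
  qed
  have tele: "u n t = u 0 t + (\<Sum>k<n. d k t)" for n t
    unfolding d_def by (induction n) auto
  have iVtele: "(\<lambda>n t. iV (u n t)) = (\<lambda>n t. iV (u 0 t) + (\<Sum>k<n. iV (d k t)))"
  proof (intro ext)
    fix n t
    have "iV (u n t) = iV (u 0 t + (\<Sum>k<n. d k t))" by (rule arg_cong[OF tele])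
    then show "iV (u n t) = iV (u 0 t) + (\<Sum>k<n. iV (d k t))" by (simp add: iV.add iV.sum)
  qed
  have ev: "\<forall>\<^sub>F n in sequentially. T \<le> real n" for T
    using filterlim_real_sequentially unfolding filterlim_at_top by auto
  \<comment> \<open>A telescoping series in H, so that the Weierstrass test applies on [0,T] to the
    indices n \<ge> T.\<close>
  define U where "U t = iV (u 0 t) + suminf (\<lambda>k. iV (d k t))" for t
  have UL: "uniform_limit {0..T} (\<lambda>n t. iV (u n t)) U sequentially" for T
  proof -
    have "uniform_limit {0..T} (\<lambda>n t. \<Sum>k<n. iV (d k t)) (\<lambda>t. suminf (\<lambda>k. iV (d k t))) sequentially"
    proof (rule Weierstrass_m_test_ev)
      show "\<forall>\<^sub>F n in sequentially. \<forall>t\<in>{0..T}. norm (iV (d n t)) \<le> sqrt (K T) * (1/4) ^ n"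
        using ev[of T]
      proof eventually_elim
        case (elim n) then show ?case using est1[of _ T n] by simp
      qed
      show "summable (\<lambda>n. sqrt (K T) * (1/4) ^ n)" by (intro summable_mult summable_geometric) simp
    qed
    from uniform_limit_add[OF uniform_limit_const this, of "\<lambda>t. iV (u 0 t)"]
    show ?thesis unfolding U_def[abs_def] iVtele .
  qed
  have Ulim: "(\<lambda>n. iV (u n t)) \<longlonglongrightarrow> U t" if "0 \<le> t" for t
    using tendsto_uniform_limitI[OF UL[of t], of t] that by simp
  have U0: "U 0 = u0"
  proof (rule LIMSEQ_unique[OF Ulim])
    have "(\<lambda>n. iV (u n 0) - u0) \<longlonglongrightarrow> 0"
      by (rule Lim_null_comparison[of _ "\<lambda>n. (1/4) ^ n"])
        (auto intro!: always_eventually less_imp_le u0 LIMSEQ_realpow_zero)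
    then show "(\<lambda>n. iV (u n 0)) \<longlonglongrightarrow> u0" by (rule LIM_zero_cancel)
  qed simp
  have Uc: "continuous_on {0..} U"
  proof (rule continuous_on_atLeast_if_bounded_intervals)
    fix T
    show "continuous_on {0..T} U"
      by (rule uniform_limit_theorem[OF _ UL])
        (auto intro!: always_eventually iV.continuous_on continuous_on_subset[OF uc])
  qed
  define v where "v s = inv iV (U s)" for s
  \<comment> \<open>The integrable function of time that governs the V-errors: |v - u n| is at most
    2 (1/2)^n times its square root, wherever the series converges.\<close>
  define G where "G s = suminf (\<lambda>k. 4 ^ k * (norm (d k s))\<^sup>2)" for s
  have GS: "AE s in lebesgue_on {0<..<T}. summable (\<lambda>k. 4 ^ k * (norm (d k s))\<^sup>2)"
    and Gi: "integrable (lebesgue_on {0<..<T}) G" if T: "0 < T" for T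
  proof -
    let ?M = "lebesgue_on {0<..<T}"
    have i: "integrable ?M (\<lambda>s. 4 ^ k * (norm (d k s))\<^sup>2)" for k
      using classical_integrable(1)[OF dcl] by simp
    have s: "summable (\<lambda>k. LINT s|?M. 4 ^ k * (norm (d k s))\<^sup>2)"
    proof (rule summable_comparison_test_ev)
      show "\<forall>\<^sub>F k in sequentially. norm (LINT s|?M. 4 ^ k * (norm (d k s))\<^sup>2) \<le> K T / (2 * \<kappa>) * (1/4) ^ k"
        using ev[of T]
      proof eventually_elim
        case (elim k)
        have nn: "0 \<le> (LINT s|?M. (norm (d k s))\<^sup>2)" by (rule integral_nonneg_AE) simp
        have "(LINT s|?M. (norm (d k s))\<^sup>2) \<le> K T / (2 * \<kappa>) * (1/16) ^ k"
          using est(2)[of T T k] elim T \<kappa> by (simp add: field_simps)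
        then have "4 ^ k * (LINT s|?M. (norm (d k s))\<^sup>2) \<le> 4 ^ k * (K T / (2 * \<kappa>) * (1/16) ^ k)"
          by (intro mult_left_mono) auto
        also have "\<dots> = K T / (2 * \<kappa>) * (4 ^ k * (1/16) ^ k)" by simp
        also have "(4::real) ^ k * (1/16) ^ k = (1/4) ^ k" by (simp flip: power_mult_distrib)
        finally show ?case using nn by simp
      qed
      show "summable (\<lambda>k. K T / (2 * \<kappa>) * (1/4) ^ k)" by (intro summable_mult summable_geometric) simp
    qed
    have nn: "0 \<le> 4 ^ k * (norm (d k s))\<^sup>2" for k s by simp
    show "AE s in ?M. summable (\<lambda>k. 4 ^ k * (norm (d k s))\<^sup>2)"
      by (rule AE_summable_of_summable_integrals(1)[OF i nn s])
    show "integrable ?M G" unfolding G_def[abs_def]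
      by (rule AE_summable_of_summable_integrals(2)[OF i nn s])
  qed
  have key: "U s \<in> range iV \<and> (\<lambda>n. u n s) \<longlonglongrightarrow> v s \<and> 0 \<le> G s \<and> (\<forall>n. norm (v s - u n s) \<le> 2 * (1/2) ^ n * sqrt (G s))"
    if s0: "0 \<le> s" and ss: "summable (\<lambda>k. 4 ^ k * (norm (d k s))\<^sup>2)" for s
  proof -
    obtain w where w: "(\<lambda>n. u n s) \<longlonglongrightarrow> w" "\<And>n. norm (w - u n s) \<le> 2 * (1/2) ^ n * sqrt (G s)"
      using weighted_square_summable_convergent[of "\<lambda>n. u n s"] ss unfolding d_def G_def by blast
    have "U s = iV w" using LIMSEQ_unique[OF Ulim[OF s0] iV.tendsto[OF w(1)]] .
    then have "v s = w" "U s \<in> range iV" unfolding v_def using iV_inj by auto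
    moreover have "0 \<le> G s" unfolding G_def by (rule suminf_nonneg[OF ss]) simp
    ultimately show ?thesis using w by simp
  qed
  have keyAE: "AE s in lebesgue_on {0<..<T}. U s \<in> range iV \<and> (\<lambda>n. u n s) \<longlonglongrightarrow> v s \<and> 0 \<le> G s \<and> (\<forall>n. norm (v s - u n s) \<le> 2 * (1/2) ^ n * sqrt (G s))"
    if "0 < T" for T
    using GS[OF that] AE_space by eventually_elim (rule key, auto)
  have L2V: "U \<in> L2V_space iV T" if T: "0 < T" for T
  proof -
    let ?M = "lebesgue_on {0<..<T}"
    have sm: "strongly_measurable ?M v"
      by (rule strongly_measurable_AE_limit[OF uc]) (use keyAE[OF T] in \<open>auto elim: eventually_mono\<close>)
    have i: "integrable ?M (\<lambda>s. 2 * (norm (u 0 s))\<^sup>2 + 8 * G s)"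
      using classical_integrable(1)[OF cl] Gi[OF T] by simp
    have "integrable ?M (\<lambda>s. (norm (v s))\<^sup>2)"
    proof (rule Bochner_Integration.integrable_bound[OF i])
      show "(\<lambda>s. (norm (v s))\<^sup>2) \<in> borel_measurable ?M" using strongly_measurable_norm[OF _ sm] by simp
      show "AE s in ?M. norm ((norm (v s))\<^sup>2) \<le> norm (2 * (norm (u 0 s))\<^sup>2 + 8 * G s)"
        using keyAE[OF T]
      proof eventually_elim
        case (elim s)
        then have "norm (v s - u 0 s) \<le> 2 * sqrt (G s)" by (metis mult.right_neutral power_0)
        then have "(norm (v s - u 0 s))\<^sup>2 \<le> (2 * sqrt (G s))\<^sup>2" by (intro power_mono) auto
        then have "(norm (v s - u 0 s))\<^sup>2 \<le> 4 * G s" using elim by (simp add: power_mult_distrib)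
        then show ?case using norm_add_square_le[of "u 0 s" "v s - u 0 s"] elim by simp
      qed
    qed
    then show ?thesis using sm keyAE[OF T] unfolding L2V_space_def L2_space_def v_def
      by (auto elim: eventually_mono)
  qed
  obtain Ca where Ca: "0 < Ca" "\<And>y. norm (a y) \<le> norm y * Ca" using a.pos_bounded by blast
  obtain Cj where Cj: "0 < Cj" "\<And>y. norm (adj y) \<le> norm y * Cj" using adj.pos_bounded by blast
  have int: "((\<lambda>s. a (v s) + adj (g s)) has_integral (adj (U t) - adj u0)) {0..t}" if t: "0 \<le> t" for t
  proof (cases "t = 0")
    case True then show ?thesis using U0 has_integral_refl(2)[of "\<lambda>s. a (v s) + adj (g s)" 0] by simp
  next
    case False
    with t have t0: "0 < t" by simp
    let ?M = "lebesgue_on {0<..<t}"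
    have "\<forall>n. \<exists>\<phi>. t \<le> real n \<longrightarrow> integrable ?M \<phi> \<and> (LINT s|?M. \<phi> s) \<le> (1/16) ^ n \<and> (AE s in ?M. (norm (g s - p n s))\<^sup>2 \<le> \<phi> s)"
      using nearT[of t] unfolding L2_near_def by simp
    from choice[OF this] obtain \<phi> where \<phi>: "\<And>n. t \<le> real n \<Longrightarrow> integrable ?M (\<phi> n) \<and> (LINT s|?M. \<phi> n s) \<le> (1/16) ^ n \<and> (AE s in ?M. (norm (g s - p n s))\<^sup>2 \<le> \<phi> n s)"
      by auto
    define Q where "Q s \<longleftrightarrow> (0 \<le> G s \<and> (\<forall>n. norm (v s - u n s) \<le> 2 * (1/2) ^ n * sqrt (G s))) \<and>
        (\<forall>n. t \<le> real n \<longrightarrow> (norm (g s - p n s))\<^sup>2 \<le> \<phi> n s)" for s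
    have "AE s in ?M. \<forall>n. t \<le> real n \<longrightarrow> (norm (g s - p n s))\<^sup>2 \<le> \<phi> n s"
      unfolding AE_all_countable using \<phi> by auto
    with keyAE[OF t0] have "AE s in ?M. Q s"
      by eventually_elim (simp add: Q_def)
    then have "\<exists>N. negligible N \<and> (\<forall>s\<in>{0<..<t} - N. Q s)"
      by (subst (asm) AE_lebesgue_on_iff) simp_all
    then obtain N0 where N0: "negligible N0" and N0': "\<And>s. s \<in> {0<..<t} - N0 \<Longrightarrow> Q s" by blast
    \<comment> \<open>The endpoints are added because \<open>Q\<close> is known only inside the open
      interval.\<close>
    define N where "N = insert 0 (insert t N0)"
    have N: "negligible N" unfolding N_def using N0 by simp
    \<comment> \<open>Majorant of the error in the integrand. It is linear in \<open>G\<close> and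
      \<phi>, as only their integrals are controlled: sqrt(G) \<le> 1 + G, and a source error x
      satisfies x \<le> (1/2)^n + 2^n x^2. The factor 2^n is harmless against (1/16)^n.\<close>
    define h where "h n s = Ca * (2 * (1/2) ^ n * (1 + G s)) + Cj * ((1/2) ^ n + 2 ^ n * \<phi> n s)" for n s
    have h: "norm (a (u n s) + adj (p n s) - (a (v s) + adj (g s))) \<le> h n s"
      if s: "s \<in> {0..t} - N" and n: "t \<le> real n" for n s
    proof -
      have s': "s \<in> {0<..<t} - N0" using s unfolding N_def by auto
      note k = N0'[OF s', unfolded Q_def]
      have sq: "sqrt (G s) \<le> 1 + G s"
        using k by (intro real_le_lsqrt) (auto simp: power2_eq_square algebra_simps)
      have "norm (v s - u n s) \<le> 2 * (1/2) ^ n * sqrt (G s)" using k by blast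
      also have "\<dots> \<le> 2 * (1/2) ^ n * (1 + G s)" using sq by (intro mult_left_mono) auto
      finally have 1: "norm (a (u n s - v s)) \<le> Ca * (2 * (1/2) ^ n * (1 + G s))"
        using Ca order_trans[OF Ca(2)[of "u n s - v s"] mult_right_mono]
        by (simp add: norm_minus_commute mult.commute[of Ca])
      have "norm (p n s - g s) \<le> (1/2) ^ n + 2 ^ n * (norm (p n s - g s))\<^sup>2"
      proof -
        define x where "x = norm (p n s - g s)"
        define y where "y = 2 ^ n * x"
        have "0 \<le> (y - 1)\<^sup>2" by simp
        moreover have y0: "0 \<le> y" unfolding y_def x_def by simp
        ultimately have "y \<le> 1 + y\<^sup>2" by (simp add: power2_eq_square algebra_simps)
        then have "(1/2) ^ n * y \<le> (1/2) ^ n * (1 + y\<^sup>2)" by (intro mult_left_mono) auto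
        moreover have "(1/2) ^ n * y = x" unfolding y_def by (simp add: power_one_over)
        moreover have "(1/2) ^ n * (1 + y\<^sup>2) = (1/2) ^ n + 2 ^ n * x\<^sup>2"
          unfolding y_def by (simp add: power_mult_distrib algebra_simps power_one_over power2_eq_square)
        ultimately show ?thesis unfolding x_def by simp
      qed
      also have "\<dots> \<le> (1/2) ^ n + 2 ^ n * \<phi> n s" using k n by (auto simp: norm_minus_commute)
      finally have 2: "norm (adj (p n s - g s)) \<le> Cj * ((1/2) ^ n + 2 ^ n * \<phi> n s)"
        using Cj order_trans[OF Cj(2)[of "p n s - g s"] mult_right_mono]
        by (simp add: mult.commute[of Cj])
      have "a (u n s) + adj (p n s) - (a (v s) + adj (g s)) = a (u n s - v s) + adj (p n s - g s)"
        by (simp add: a.diff adj.diff)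
      then show ?thesis using norm_triangle_le[of "a (u n s - v s)"] 1 2 unfolding h_def by (metis add_mono)
    qed
    have fint: "integrable ?M (\<lambda>s. 1 + G s)"
      using Gi[OF t0] integrable_continuous_lebesgue_on[of "\<lambda>_. 1" t] by (intro Bochner_Integration.integrable_add) auto
    have cint: "integrable ?M (\<lambda>s. k)" for k :: real
      by (rule integrable_continuous_lebesgue_on) simp
    have hint: "(h n has_integral (LINT s|?M. h n s)) {0..t}" if n: "t \<le> real n" for n
      by (rule has_integral_closed_interval) (use \<phi>[OF n] fint cint in \<open>simp add: h_def[abs_def] del: integrable_const\<close>)
    define i where "i = (LINT s|?M. 1 + G s)"
    have hle: "(LINT s|?M. h n s) \<le> (2 * Ca * i + Cj * (t + 1)) * (1/2) ^ n" if n: "t \<le> real n" for n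
    proof -
      have "(LINT s|?M. h n s) = Ca * (2 * (1/2) ^ n * i) + Cj * ((LINT s|?M. (1/2) ^ n) + 2 ^ n * (LINT s|?M. \<phi> n s))"
        unfolding h_def i_def using \<phi>[OF n] fint cint
        by (simp del: integrable_const lebesgue_integral_const)
      also have "(LINT s|?M. (1/2) ^ n) = t * (1/2) ^ n" using t0 by (simp add: measure_restrict_space)
      also have "Ca * (2 * (1/2) ^ n * i) + Cj * (t * (1/2) ^ n + 2 ^ n * (LINT s|?M. \<phi> n s))
         \<le> Ca * (2 * (1/2) ^ n * i) + Cj * (t * (1/2) ^ n + 2 ^ n * (1/16) ^ n)"
        using \<phi>[OF n] Cj by (intro add_left_mono mult_left_mono) auto
      also have "(2::real) ^ n * (1/16) ^ n = (1/8) ^ n" by (simp flip: power_mult_distrib)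
      also have "Ca * (2 * (1/2) ^ n * i) + Cj * (t * (1/2) ^ n + (1/8) ^ n)
        \<le> Ca * (2 * (1/2) ^ n * i) + Cj * (t * (1/2) ^ n + (1/2) ^ n)"
        using Cj by (intro add_left_mono mult_left_mono power_mono) auto
      also have "\<dots> = (2 * Ca * i + Cj * (t + 1)) * (1/2) ^ n" by (simp add: algebra_simps)
      finally show ?thesis .
    qed
    show ?thesis unfolding cbox_interval[symmetric]
    proof (rule has_integral_approximation[OF N])
      fix e :: real assume e: "0 < e"
      have "(\<lambda>n. (2 * Ca * i + Cj * (t + 1)) * (1/2) ^ n) \<longlonglongrightarrow> (2 * Ca * i + Cj * (t + 1)) * 0"
        by (intro tendsto_intros LIMSEQ_realpow_zero) auto
      then have "\<forall>\<^sub>F n in sequentially. (2 * Ca * i + Cj * (t + 1)) * (1/2) ^ n < e"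
        using e by (intro order_tendstoD) auto
      moreover have "(\<lambda>n. norm ((adj (iV (u n t)) - adj (iV (u n 0))) - (adj (U t) - adj u0))) \<longlonglongrightarrow>
          norm ((adj (U t) - adj (U 0)) - (adj (U t) - adj u0))"
        by (intro tendsto_intros adj.tendsto Ulim t) simp
      then have "\<forall>\<^sub>F n in sequentially. norm ((adj (iV (u n t)) - adj (iV (u n 0))) - (adj (U t) - adj u0)) < e"
        using e U0 by (intro order_tendstoD) auto
      ultimately have "\<forall>\<^sub>F n in sequentially. t \<le> real n \<and> (2 * Ca * i + Cj * (t + 1)) * (1/2) ^ n < e \<and>
          norm ((adj (iV (u n t)) - adj (iV (u n 0))) - (adj (U t) - adj u0)) < e"
        using ev[of t] by eventually_elim auto
      then obtain n where n: "t \<le> real n" "(2 * Ca * i + Cj * (t + 1)) * (1/2) ^ n < e"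
          "norm ((adj (iV (u n t)) - adj (iV (u n 0))) - (adj (U t) - adj u0)) < e"
        using eventually_happens by force
      have F: "((\<lambda>s. a (u n s) + adj (p n s)) has_integral (adj (iV (u n t)) - adj (iV (u n 0)))) {0..t}"
      proof (rule fundamental_theorem_of_calculus[OF t])
        fix s assume "s \<in> {0..t}"
        then show "((\<lambda>s. adj (iV (u n s))) has_vector_derivative a (u n s) + adj (p n s)) (at s within {0..t})"
          using cl[of n] unfolding classical_def
          by (auto intro: has_vector_derivative_within_subset)
      qed
      show "\<exists>F I h i. (F has_integral I) (cbox 0 t) \<and> norm (I - (adj (U t) - adj u0)) \<le> e \<and>
          (h has_integral i) (cbox 0 t) \<and> i \<le> e \<and> (\<forall>s\<in>cbox 0 t - N. norm (F s - (a (v s) + adj (g s))) \<le> h s)"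
        using F n hint[OF n(1)] hle[OF n(1)] h[OF _ n(1)] unfolding cbox_interval
        by (intro exI[of _ "\<lambda>s. a (u n s) + adj (p n s)"] exI[of _ "adj (iV (u n t)) - adj (iV (u n 0))"]
            exI[of _ "h n"] exI[of _ "LINT s|?M. h n s"]) auto
    qed
  qed
  \<comment> \<open>The constant 2 / c in place of 1 / c comes from |p n|^2 \<le> 2 |g|^2 + 2 |g - p
    n|^2, whose last term tends to 0 in the mean.\<close>
  have en: "exp (c * t) * (norm (U t))\<^sup>2 \<le>
       (norm u0)\<^sup>2 + (2 / c) * (LINT s|lebesgue_on {0<..<t}. exp (c * s) * (norm (g s))\<^sup>2)" if t: "0 < t" for t
  proof (rule tendsto_le)
    let ?M = "lebesgue_on {0<..<t}"
    let ?J = "LINT s|?M. exp (c * s) * (norm (g s))\<^sup>2"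
    show "(\<lambda>n. exp (c * t) * (norm (iV (u n t)))\<^sup>2) \<longlonglongrightarrow> exp (c * t) * (norm (U t))\<^sup>2"
      using t by (intro tendsto_intros Ulim) simp
    have "(\<lambda>n. (norm (iV (u n 0)))\<^sup>2 + (1 / c) * (2 * ?J + 2 * (exp (c * t) * (1/16) ^ n))) \<longlonglongrightarrow>
       (norm (U 0))\<^sup>2 + (1 / c) * (2 * ?J + 2 * (exp (c * t) * 0))"
      by (intro tendsto_intros Ulim LIMSEQ_realpow_zero) auto
    then show "(\<lambda>n. (norm (iV (u n 0)))\<^sup>2 + (1 / c) * (2 * ?J + 2 * (exp (c * t) * (1/16) ^ n))) \<longlonglongrightarrow>
       (norm u0)\<^sup>2 + (2 / c) * ?J" using U0 by simp
    show "\<forall>\<^sub>F n in sequentially. exp (c * t) * (norm (iV (u n t)))\<^sup>2 \<le>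
       (norm (iV (u n 0)))\<^sup>2 + (1 / c) * (2 * ?J + 2 * (exp (c * t) * (1/16) ^ n))"
      using ev[of t]
    proof eventually_elim
      case (elim n)
      obtain \<phi> where \<phi>: "integrable ?M \<phi>" "(LINT s|?M. \<phi> s) \<le> (1/16) ^ n"
         "AE s in ?M. (norm (g s - p n s))\<^sup>2 \<le> \<phi> s" using nearT[OF elim] unfolding L2_near_def by blast
      have gi: "integrable ?M (\<lambda>s. exp (c * s) * (norm (g s))\<^sup>2)" by (rule L2_space_exp_integrable[OF g[OF t] c])
      have "(LINT s|?M. exp (c * s) * (norm (p n s))\<^sup>2) \<le> (LINT s|?M. 2 * (exp (c * s) * (norm (g s))\<^sup>2) + 2 * (exp (c * t) * \<phi> s))"
      proof (rule integral_mono_AE[OF classical_integrable(4)[OF cl]])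
        show "integrable ?M (\<lambda>s. 2 * (exp (c * s) * (norm (g s))\<^sup>2) + 2 * (exp (c * t) * \<phi> s))"
          using gi \<phi> by simp
        show "AE s in ?M. exp (c * s) * (norm (p n s))\<^sup>2 \<le> 2 * (exp (c * s) * (norm (g s))\<^sup>2) + 2 * (exp (c * t) * \<phi> s)"
          using \<phi>(3) AE_space
        proof eventually_elim
          fix s assume s: "(norm (g s - p n s))\<^sup>2 \<le> \<phi> s" "s \<in> space ?M"
          have "(norm (p n s))\<^sup>2 \<le> 2 * (norm (g s))\<^sup>2 + 2 * (norm (p n s - g s))\<^sup>2"
            using norm_add_square_le[of "g s" "p n s - g s"] by simp
          then have "exp (c * s) * (norm (p n s))\<^sup>2 \<le> exp (c * s) * (2 * (norm (g s))\<^sup>2 + 2 * (norm (g s - p n s))\<^sup>2)"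
            by (simp add: norm_minus_commute)
          also have "\<dots> = 2 * (exp (c * s) * (norm (g s))\<^sup>2) + 2 * (exp (c * s) * (norm (g s - p n s))\<^sup>2)"
            by (simp add: algebra_simps)
          also have "exp (c * s) * (norm (g s - p n s))\<^sup>2 \<le> exp (c * t) * \<phi> s"
            using s c by (intro mult_mono) auto
          finally show "exp (c * s) * (norm (p n s))\<^sup>2 \<le> 2 * (exp (c * s) * (norm (g s))\<^sup>2) + 2 * (exp (c * t) * \<phi> s)"
            by simp
        qed
      qed
      also have "\<dots> = 2 * ?J + 2 * (exp (c * t) * (LINT s|?M. \<phi> s))"
        using gi \<phi>(1) by simp
      also have "\<dots> \<le> 2 * ?J + 2 * (exp (c * t) * (1/16) ^ n)" using \<phi>(2) by simp
      finally have 1: "(1 / c) * (LINT s|?M. exp (c * s) * (norm (p n s))\<^sup>2) \<le> (1 / c) * (2 * ?J + 2 * (exp (c * t) * (1/16) ^ n))"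
        using c by (intro mult_left_mono) auto
      have "0 \<le> (LINT s|?M. exp (c * s) * (norm (u n s))\<^sup>2)" by (rule integral_nonneg_AE) simp
      then have "0 \<le> 2 * \<kappa> * (LINT s|?M. exp (c * s) * (norm (u n s))\<^sup>2)" using \<kappa> by simp
      then show ?case using classical_energy_L2[OF cl, of t n] t 1 by linarith
    qed
  qed simp
  show ?thesis
    by (rule exI[of _ U]) (use Uc L2V int[unfolded v_def] en in blast)
qed

text \<open>Subtracting the stationary state q leaves an equation whose source g - gs tends to 0.
  Its energy bound, multiplied by exp(- c t), consists of a decaying initial term and an
  exponentially weighted average of that source.\<close>

lemma convergent_weak_solution_exists:
  assumes g: "\<And>T. 0 < T \<Longrightarrow> g \<in> L2_space T" and lim: "(g \<longlongrightarrow> gs) at_top" and q: "a q = - adj gs"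
  shows "\<exists>U. continuous_on {0..} U \<and> (\<forall>T>0. U \<in> L2V_space iV T) \<and>
    (\<forall>t\<ge>0. ((\<lambda>s. a (inv iV (U s)) + adj (g s)) has_integral (adj (U t) - adj u0)) {0..t}) \<and>
    (U \<longlongrightarrow> iV q) at_top"
proof -
  define k where "k s = g s + (- gs)" for s
  have k: "k \<in> L2_space T" if "0 < T" for T
    unfolding k_def[abs_def] by (intro L2_space_add g that L2_space_continuous continuous_on_const)
  have klim: "(k \<longlongrightarrow> 0) at_top" using LIM_zero[OF lim] by (simp add: k_def[abs_def])
  define z0 where "z0 = u0 - iV q"
  obtain z where zc: "continuous_on {0..} z" and zL: "\<And>T. 0 < T \<Longrightarrow> z \<in> L2V_space iV T"
    and zi: "\<And>t. 0 \<le> t \<Longrightarrow> ((\<lambda>s. a (inv iV (z s)) + adj (k s)) has_integral (adj (z t) - adj z0)) {0..t}"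
    and ze: "\<And>t. 0 < t \<Longrightarrow> exp (c * t) * (norm (z t))\<^sup>2 \<le>
       (norm z0)\<^sup>2 + (2 / c) * (LINT s|lebesgue_on {0<..<t}. exp (c * s) * (norm (k s))\<^sup>2)"
    using weak_solution_exists[OF k, of z0] by blast
  define U where "U s = z s + iV q" for s
  have inv: "inv iV (U s) = inv iV (z s) + q" if "z s \<in> range iV" for s
    using inv_add_range(1)[OF iV.linear iV_inj that, of "iV q"] iV_inj by (simp add: U_def)
  have zr: "AE s in lebesgue_on {0<..<T}. z s \<in> range iV" if "0 < T" for T
    using zL[OF that] unfolding L2V_space_def by simp
  have "U \<in> L2V_space iV T" if T: "0 < T" for T
  proof -
    have "(\<lambda>s. inv iV (z s) + q) \<in> L2_space T"
      using zL[OF T] unfolding L2V_space_def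
      by (intro L2_space_add[OF _ L2_space_continuous[OF continuous_on_const]]) simp
    moreover have "AE s in lebesgue_on {0<..<T}. inv iV (z s) + q = inv iV (U s)"
      using zr[OF T] by eventually_elim (simp add: inv)
    ultimately have "(\<lambda>s. inv iV (U s)) \<in> L2_space T" by (rule L2_space_AE_cong)
    moreover have "AE s in lebesgue_on {0<..<T}. U s \<in> range iV"
      using zr[OF T] by eventually_elim (auto simp: U_def iV.add[symmetric])
    ultimately show ?thesis unfolding L2V_space_def by simp
  qed
  moreover have "continuous_on {0..} U" unfolding U_def[abs_def] by (intro continuous_intros zc)
  moreover have "((\<lambda>s. a (inv iV (U s)) + adj (g s)) has_integral (adj (U t) - adj u0)) {0..t}" if t: "0 \<le> t" for t
  proof -
    obtain N where N: "negligible N" "\<And>s. s \<in> {0..t} - N \<Longrightarrow> z s \<in> range iV"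
      using AE_intervals_negligible[OF zr t] by blast
    have "((\<lambda>s. a (inv iV (U s)) + adj (g s)) has_integral (adj (z t) - adj z0)) {0..t}"
    proof (rule has_integral_spike[OF _ _ zi[OF t]])
      show "negligible N" by (rule N)
      fix s assume "s \<in> {0..t} - N"
      then have "inv iV (U s) = inv iV (z s) + q" by (intro inv N(2)) auto
      then show "a (inv iV (U s)) + adj (g s) = a (inv iV (z s)) + adj (k s)"
        by (simp add: a.add q k_def adj.diff)
    qed
    then show ?thesis by (simp add: U_def z0_def adj.add adj.diff algebra_simps)
  qed
  moreover have "(U \<longlongrightarrow> iV q) at_top"
  proof -
    define J where "J t = (LINT s|lebesgue_on {0<..<t}. exp (c * s) * (norm (k s))\<^sup>2)" for t
    have Jl: "((\<lambda>t. exp (- c * t) * J t) \<longlongrightarrow> 0) at_top"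
      unfolding J_def by (rule exp_weighted_average_tendsto_0[OF k klim c])
    have "((\<lambda>t. (norm (z t))\<^sup>2) \<longlongrightarrow> 0) at_top"
    proof (rule Lim_null_comparison)
      have "((\<lambda>t. exp (- c * t) * (norm z0)\<^sup>2 + (2 / c) * (exp (- c * t) * J t)) \<longlongrightarrow> 0 * (norm z0)\<^sup>2 + (2 / c) * 0) at_top"
        by (intro tendsto_intros exp_decay_tendsto_0 c Jl)
      then show "((\<lambda>t. exp (- c * t) * (norm z0)\<^sup>2 + (2 / c) * (exp (- c * t) * J t)) \<longlongrightarrow> 0) at_top" by simp
      show "\<forall>\<^sub>F t in at_top. norm ((norm (z t))\<^sup>2) \<le> exp (- c * t) * (norm z0)\<^sup>2 + (2 / c) * (exp (- c * t) * J t)"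
        using eventually_gt_at_top[of 0]
      proof eventually_elim
        case (elim t)
        have "(norm (z t))\<^sup>2 = exp (- c * t) * (exp (c * t) * (norm (z t))\<^sup>2)" by (simp add: exp_minus)
        also have "\<dots> \<le> exp (- c * t) * ((norm z0)\<^sup>2 + (2 / c) * J t)"
          using ze[OF elim] unfolding J_def by (intro mult_left_mono) auto
        finally show ?case by (simp add: algebra_simps)
      qed
    qed
    then have "((\<lambda>t. sqrt ((norm (z t))\<^sup>2)) \<longlongrightarrow> sqrt 0) at_top" by (rule tendsto_real_sqrt)
    then have "((\<lambda>t. norm (z t)) \<longlongrightarrow> 0) at_top" by simp
    then have "(z \<longlongrightarrow> 0) at_top" by (rule tendsto_norm_zero_cancel)
    from tendsto_add[OF this tendsto_const[of "iV q"]] show ?thesis by (simp add: U_def[abs_def])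
  qed
  ultimately show ?thesis by (intro exI[of _ U]) blast
qed

section \<open>Uniqueness for the homogeneous weak equation\<close>

lemma adj_eq_0: "adj h = 0 \<Longrightarrow> h = 0"
proof -
  assume "adj h = 0"
  then have "iV v \<in> {x. h \<bullet> x = 0}" for v using adj_inner[of h v] by simp
  moreover have "closed {x. h \<bullet> x = 0}" by (rule closed_Collect_eq) (intro continuous_intros)+
  ultimately have "closure (range iV) \<subseteq> {x. h \<bullet> x = 0}" by (intro closure_minimal) auto
  then have "h \<in> {x. h \<bullet> x = 0}" using iV_dense by blast
  then show "h = 0" by simp
qed

text \<open>The primitive \<open>Z\<close> of a solution \<open>z\<close> of the homogeneous equation lies in \<open>V\<close>, and
  \<open>a Z(t) = adj z(t)\<close>; so \<open>\<parallel>Z\<parallel>\<^sub>H\<^sup>2\<close> is differentiable without any regularity of \<open>z\<close> in time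
  beyond continuity in \<open>H\<close>.\<close>

lemma homogeneous_weak_solution_zero:
  fixes z :: "real \<Rightarrow> 'h"
  assumes zc: "continuous_on {0..} z"
    and zr: "\<And>T. 0 < T \<Longrightarrow> AE s in lebesgue_on {0<..<T}. z s \<in> range iV"
    and zi: "\<And>t. 0 \<le> t \<Longrightarrow> ((\<lambda>s. a (inv iV (z s))) has_integral adj (z t)) {0..t}"
    and t: "0 \<le> t"
  shows "z t = 0"
proof -
  define Z where "Z t = a_inv (adj (z t))" for t
  interpret a_inv: bounded_linear a_inv by (rule a_inv(1))
  \<comment> \<open>Over the degenerate interval the integral is 0, which supplies the initial
    condition adj (z 0) = 0.\<close>
  have "((\<lambda>s. a (inv iV (z s))) has_integral adj (z 0)) {0}" using zi[of 0] by simp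
  from has_integral_unique[OF this has_integral_refl(2)] have "adj (z 0) = 0" .
  then have Z0: "Z 0 = 0" by (simp add: Z_def a_inv.zero)
  have zint: "(z has_integral (iV (Z t) - iV (Z 0))) {0..t}" if t: "0 \<le> t" for t
  proof -
    \<comment> \<open>Applying the inverse of \<open>a\<close> under the integral identifies Z t as
      the primitive of z in V; \<open>iV\<close> then carries it to H, where z is
      continuous.\<close>
    have "((a_inv \<circ> (\<lambda>s. a (inv iV (z s)))) has_integral Z t) {0..t}"
      unfolding Z_def by (rule has_integral_linear[OF zi[OF t] a_inv(1)])
    then have "((\<lambda>s. inv iV (z s)) has_integral Z t) {0..t}" by (simp add: o_def a_inv(3))
    then have i: "((iV \<circ> (\<lambda>s. inv iV (z s))) has_integral iV (Z t)) {0..t}" by (rule has_integral_linear[OF _ iV])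
    obtain N where N: "negligible N" "\<And>s. s \<in> {0..t} - N \<Longrightarrow> z s \<in> range iV"
      using AE_intervals_negligible[OF zr t] by blast
    have "(z has_integral iV (Z t)) {0..t}"
    proof (rule has_integral_spike[OF _ _ i])
      show "negligible N" by (rule N)
      fix s assume "s \<in> {0..t} - N"
      then have "z s \<in> range iV" by (intro N(2)) auto
      then show "z s = (iV \<circ> (\<lambda>s. inv iV (z s))) s" by (simp add: f_inv_into_f)
    qed
    then show ?thesis by (simp add: Z0 iV.zero)
  qed
  have der: "((\<lambda>s. iV (Z s)) has_vector_derivative z s) (at s within {0..})" if "0 \<le> s" for s
    by (rule has_vector_derivative_of_integral[OF zc zint that])
  have aZ: "a (Z s) = adj (z s)" for s unfolding Z_def by (rule a_inv(2))
  have "(norm (iV (Z t)))\<^sup>2 \<le> (norm (iV (Z 0)))\<^sup>2"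
  proof (rule nonpos_derivative_imp_le[OF norm_square_has_derivative[OF der] _ t])
    show "2 * (z s \<bullet> iV (Z s)) \<le> 0" for s
      using a_nonpos(2)[of "Z s"] unfolding aZ adj_inner by simp
  qed
  then have "iV (Z t) = 0" by (simp add: Z0 iV.zero)
  then have "Z t = 0" using iV_inj by (metis injD iV.zero)
  then have "adj (z t) = 0" using aZ[of t] by (simp add: a.zero)
  then show ?thesis by (rule adj_eq_0)
qed

end

section \<open>The evolution equation in a normal triple\<close>

context normal_triple
begin

text \<open>A occurs here because boundedness of the inverse is drawn from coercivity: each x is R
  (A v) with |v| \<le> |x| / \<kappa>, so inv R x = A v is bounded by a multiple of |x|.\<close>

lemma riesz_isomorphism:
  assumes A: "bounded_linear A" and \<kappa>: "0 < \<kappa>" and coer: "\<And>v. pair (A v) v \<le> - \<kappa> * (norm v)\<^sup>2"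
  shows "\<exists>R L. bounded_linear R \<and> bounded_linear L \<and> (\<forall>w. L (R w) = w) \<and> (\<forall>x. R (L x) = x) \<and>
    (\<forall>w v. R w \<bullet> v = pair w v)"
proof -
  interpret pair: bounded_bilinear pair by (rule pair_bilinear)
  interpret A: bounded_linear A by (rule A)
  have "\<exists>x. \<forall>v. pair w v = x \<bullet> v" for w
    by (rule riesz_representation[OF pair.bounded_linear_right]) blast
  then obtain R where R: "\<And>w v. R w \<bullet> v = pair w v" by metis
  have ext: "x = y" if "\<And>v. x \<bullet> v = y \<bullet> v" for x y :: 'v using that vector_eq_rdot by blast
  obtain C where C: "0 \<le> C" "\<And>w v. norm (pair w v) \<le> norm w * norm v * C" using pair.nonneg_bounded by blast
  have Rb: "bounded_linear R"
  proof (rule bounded_linear_intro)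
    show "R (x + y) = R x + R y" for x y by (rule ext) (simp add: R inner_add_left pair.add_left)
    show "R (r *\<^sub>R x) = r *\<^sub>R R x" for r x by (rule ext) (simp add: R pair.scaleR_left)
    show "norm (R w) \<le> norm w * C" for w
    proof (cases "R w = 0")
      case True
      then show ?thesis using C(1) by simp
    next
      case False
      have "norm (R w) * norm (R w) = pair w (R w)" by (simp add: R[symmetric] power2_eq_square[symmetric] power2_norm_eq_inner)
      also have "\<dots> \<le> norm w * norm (R w) * C" using C(2)[of w "R w"] by simp
      finally show ?thesis using False by (simp add: mult.commute mult.left_commute)
    qed
  qed
  \<comment> \<open>Uniqueness in \<open>dual\<close> gives injectivity; existence gives
    surjectivity below.\<close>
  have Rinj: "inj R"
  proof (rule injI)
    fix x y assume "R x = R y"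
    then have "pair x v = pair y v" for v by (simp flip: R)
    moreover have "\<exists>!w. \<forall>v. pair w v = pair x v" by (rule dual[OF pair.bounded_linear_right])
    ultimately show "x = y" by metis
  qed
  have "surj R"
    unfolding surj_def
  proof
    fix x
    obtain w where "\<And>v. pair w v = x \<bullet> v" using dual[OF bounded_linear_inner_right[of x]] by blast
    then show "\<exists>w. x = R w" by (intro exI[of _ w] ext) (simp add: R)
  qed
  then have RL: "R (inv R x) = x" for x by (simp add: surj_f_inv_f)
  have LR: "inv R (R w) = w" for w using Rinj by simp
  have T: "bounded_linear (\<lambda>v. - R (A v))" by (intro bounded_linear_minus bounded_linear_compose[OF Rb A])
  have Tc: "\<kappa> * (norm v)\<^sup>2 \<le> - R (A v) \<bullet> v" for v using coer[of v] by (simp add: R)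
  have Ts: "surj (\<lambda>v. - R (A v))" using coercive_bijective(1)[OF T \<kappa> Tc] by (rule bij_is_surj)
  obtain CA where CA: "0 < CA" "\<And>v. norm (A v) \<le> norm v * CA" using A.pos_bounded by blast
  have "bounded_linear (inv R)"
  proof (rule bounded_linear_intro)
    show "inv R (x + y) = inv R x + inv R y" for x y
      using LR[of "inv R x + inv R y"] by (simp add: bounded_linear.linear[OF Rb] linear_add RL)
    show "inv R (r *\<^sub>R x) = r *\<^sub>R inv R x" for r x
      using LR[of "r *\<^sub>R inv R x"] by (simp add: bounded_linear.linear[OF Rb] linear_scale RL)
    show "norm (inv R x) \<le> norm x * (CA / \<kappa>)" for x
    proof -
      obtain v where v: "- x = - R (A v)" using surjD[OF Ts, of "- x"] by blast
      then have x: "x = R (A v)" by simp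
      have "\<kappa> * norm v * norm v \<le> norm x * norm v"
        using Tc[of v] norm_cauchy_schwarz[of "- x" v] by (simp add: x power2_eq_square)
      then have "\<kappa> * norm v \<le> norm x" by (cases "v = 0") auto
      then have "norm v \<le> norm x / \<kappa>" using \<kappa> by (simp add: field_simps)
      then have "norm v * CA \<le> norm x / \<kappa> * CA" using CA by (intro mult_right_mono) auto
      then show ?thesis using CA(2)[of v] by (simp add: x LR)
    qed
  qed
  then show ?thesis using Rb LR RL R by blast
qed

end

locale coercive_normal_triple = normal_triple iV iH pair
  for iV :: "'v::{real_inner, banach} \<Rightarrow> 'h::{real_inner, banach}"
    and iH :: "'h \<Rightarrow> 'd::{real_inner, banach}"
    and pair :: "'d \<Rightarrow> 'v \<Rightarrow> real" +
  fixes A :: "'v \<Rightarrow> 'd" and \<kappa> c :: real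
  assumes A: "bounded_linear A" and \<kappa>: "0 < \<kappa>" and c: "0 < c"
    and coercive: "\<And>v. pair (A v) v + \<kappa> * (norm v)\<^sup>2 \<le> - c * (norm (iV v))\<^sup>2"
begin

lemma riesz_triple:
  "\<exists>R L. bounded_linear R \<and> bounded_linear L \<and> (\<forall>w. L (R w) = w) \<and>
    coercive_triple iV (\<lambda>h. R (iH h)) (\<lambda>v. R (A v)) \<kappa> c"
proof -
  have "pair (A v) v \<le> - \<kappa> * (norm v)\<^sup>2" for v
    using coercive[of v] c by (smt (verit) mult_nonneg_nonneg mult_minus_left zero_le_power2)
  then obtain R L where RL: "bounded_linear R" "bounded_linear L" "\<And>w. L (R w) = w" "\<And>x. R (L x) = x"
    "\<And>w v. R w \<bullet> v = pair w v" using riesz_isomorphism[OF A \<kappa>] by auto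
  have "R ` closure (range iH) \<subseteq> closure (R ` range iH)"
    by (intro image_closure_subset bounded_linear.continuous_on[OF RL(1)] continuous_on_id closed_closure closure_subset)
  moreover have "R ` UNIV = UNIV" using RL(4) by (metis surjI)
  ultimately have "closure (range (\<lambda>h. R (iH h))) = UNIV"
    using H_embedding(3) by (auto simp: image_image)
  moreover have "R (A v) \<bullet> v + \<kappa> * (norm v)\<^sup>2 \<le> - c * (norm (iV v))\<^sup>2" for v
    using coercive[of v] by (simp add: RL(5))
  ultimately have "coercive_triple iV (\<lambda>h. R (iH h)) (\<lambda>v. R (A v)) \<kappa> c"
    using bounded_linear_compose[OF RL(1) H_embedding(1)] bounded_linear_compose[OF RL(1) A] RL(5) pair_inner
    by (intro coercive_triple.intro V_embedding \<kappa> c) simp_all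
  then show ?thesis using RL(1-3) by blast
qed

lemma A_inj: "A v = A w \<Longrightarrow> v = w"
proof -
  assume e: "A v = A w"
  obtain R where "coercive_triple iV (\<lambda>h. R (iH h)) (\<lambda>v. R (A v)) \<kappa> c"
    using riesz_triple by auto
  then interpret coercive_triple iV "\<lambda>h. R (iH h)" "\<lambda>v. R (A v)" \<kappa> c .
  show "v = w" using a_inv(3)[of v] a_inv(3)[of w] e by metis
qed

text \<open>The Riesz map moves the problem to V; its inverse is bounded and linear, hence passes
  under the integral and moves the solution back.\<close>

lemma convergent_solution_exists:
  assumes g: "\<And>T. 0 < T \<Longrightarrow> g \<in> L2_space T" and lim: "(g \<longlongrightarrow> gs) at_top"
  shows "\<exists>U q. - A q = iH gs \<and> continuous_on {0..} U \<and> (\<forall>T>0. U \<in> L2V_space iV T) \<and>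
    (\<forall>t\<ge>0. \<exists>I. ((\<lambda>s. A (inv iV (U s)) + iH (g s)) has_integral I) {0..t} \<and> iH (U t) = iH u0 + I) \<and>
    (U \<longlongrightarrow> iV q) at_top"
proof -
  obtain R L where R: "bounded_linear R" and L: "bounded_linear L" and LR: "\<And>w. L (R w) = w"
    and "coercive_triple iV (\<lambda>h. R (iH h)) (\<lambda>v. R (A v)) \<kappa> c"
    using riesz_triple by auto
  then interpret T: coercive_triple iV "\<lambda>h. R (iH h)" "\<lambda>v. R (A v)" \<kappa> c by simp
  interpret R: bounded_linear R by (rule R)
  interpret L: bounded_linear L by (rule L)
  define q where "q = T.a_inv (- R (iH gs))"
  have q: "R (A q) = - R (iH gs)" unfolding q_def by (rule T.a_inv(2))
  then have "A q = - iH gs" by (metis LR R.neg)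
  then have q': "- A q = iH gs" by simp
  obtain U where U: "continuous_on {0..} U" "\<forall>T>0. U \<in> L2V_space iV T"
    "\<And>t. 0 \<le> t \<Longrightarrow> ((\<lambda>s. R (A (inv iV (U s))) + R (iH (g s))) has_integral (R (iH (U t)) - R (iH u0))) {0..t}"
    "(U \<longlongrightarrow> iV q) at_top"
    using T.convergent_weak_solution_exists[OF g lim q, of u0] by blast
  have "((\<lambda>s. A (inv iV (U s)) + iH (g s)) has_integral (iH (U t) - iH u0)) {0..t}" if "0 \<le> t" for t
    using has_integral_linear[OF U(3)[OF that] L] by (simp add: o_def L.add L.diff LR)
  then have "\<forall>t\<ge>0. \<exists>I. ((\<lambda>s. A (inv iV (U s)) + iH (g s)) has_integral I) {0..t} \<and> iH (U t) = iH u0 + I"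
    by (metis add_diff_cancel_left' diff_add_cancel add.commute)
  then show ?thesis using q' U by blast
qed

text \<open>The sources are compared for s \<ge> 0 only, since the lower chaos coefficients
  contained in them are determined only there.\<close>

lemma solution_unique:
  assumes w: "continuous_on {0..} w1" "continuous_on {0..} w2"
    "\<And>T. 0 < T \<Longrightarrow> w1 \<in> L2V_space iV T" "\<And>T. 0 < T \<Longrightarrow> w2 \<in> L2V_space iV T"
    and g: "\<And>s. 0 \<le> s \<Longrightarrow> g1 s = g2 s"
    and w1: "\<And>t. 0 \<le> t \<Longrightarrow> \<exists>I. ((\<lambda>s. A (inv iV (w1 s)) + g1 s) has_integral I) {0..t} \<and> iH (w1 t) = x + I"
    and w2: "\<And>t. 0 \<le> t \<Longrightarrow> \<exists>I. ((\<lambda>s. A (inv iV (w2 s)) + g2 s) has_integral I) {0..t} \<and> iH (w2 t) = x + I"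
    and t: "0 \<le> t"
  shows "w1 t = w2 t"
proof -
  obtain R L where R: "bounded_linear R" and LR: "\<And>w. L (R w) = w"
    and "coercive_triple iV (\<lambda>h. R (iH h)) (\<lambda>v. R (A v)) \<kappa> c"
    using riesz_triple by auto
  then interpret T: coercive_triple iV "\<lambda>h. R (iH h)" "\<lambda>v. R (A v)" \<kappa> c by simp
  interpret R: bounded_linear R by (rule R)
  interpret A: bounded_linear A by (rule A)
  interpret iV: bounded_linear iV by (rule V_embedding)
  interpret iH: bounded_linear iH by (rule H_embedding)
  have wr: "AE s in lebesgue_on {0<..<T}. w1 s \<in> range iV \<and> w2 s \<in> range iV" if "0 < T" for T
    using w(3,4)[OF that] unfolding L2V_space_def by auto
  have "w1 t - w2 t = 0"
  proof (rule T.homogeneous_weak_solution_zero[OF _ _ _ t])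
    show "continuous_on {0..} (\<lambda>t. w1 t - w2 t)" by (intro continuous_intros w)
    show "AE s in lebesgue_on {0<..<T}. w1 s - w2 s \<in> range iV" if "0 < T" for T
      using wr[OF that] by eventually_elim (auto simp: iV.diff[symmetric])
    fix t :: real assume t: "0 \<le> t"
    obtain I1 I2 where I1: "((\<lambda>s. A (inv iV (w1 s)) + g1 s) has_integral I1) {0..t}" "iH (w1 t) = x + I1"
      and I2: "((\<lambda>s. A (inv iV (w2 s)) + g2 s) has_integral I2) {0..t}" "iH (w2 t) = x + I2"
      using w1[OF t] w2[OF t] by blast
    obtain N where N: "negligible N" "\<And>s. s \<in> {0..t} - N \<Longrightarrow> w1 s \<in> range iV \<and> w2 s \<in> range iV"
      using AE_intervals_negligible[OF wr t] by blast
    have "((\<lambda>s. A (inv iV (w1 s - w2 s))) has_integral (I1 - I2)) {0..t}"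
    proof (rule has_integral_spike[OF _ _ has_integral_diff[OF I1(1) I2(1)]])
      show "negligible N" by (rule N)
      fix s assume s: "s \<in> {0..t} - N"
      then have r: "w1 s \<in> range iV" "w2 s \<in> range iV" using N(2)[of s] by auto
      show "A (inv iV (w1 s - w2 s)) = A (inv iV (w1 s)) + g1 s - (A (inv iV (w2 s)) + g2 s)"
        unfolding inv_add_range(2)[OF iV.linear V_embedding(2) r] using g[of s] s by (simp add: A.diff)
    qed
    moreover have "I1 - I2 = iH (w1 t - w2 t)" using I1(2) I2(2) by (simp add: iH.diff)
    ultimately have "((\<lambda>s. A (inv iV (w1 s - w2 s))) has_integral iH (w1 t - w2 t)) {0..t}" by simp
    from has_integral_linear[OF this R]
    show "((\<lambda>s. R (A (inv iV (w1 s - w2 s)))) has_integral R (iH (w1 t - w2 t))) {0..t}" by (simp add: o_def)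
  qed
  then show ?thesis by simp
qed

end

section \<open>Multi-indices and weights\<close>

text \<open>A multi-index is coded by the finite graph of its nonzero entries, and a countable set
  has countably many finite subsets.\<close>

lemma countable_multiindex: "countable (UNIV :: multiindex set)"
proof -
  define G where "G \<alpha> = (\<lambda>k. (k, Poly_Mapping.lookup \<alpha> k)) ` Poly_Mapping.keys \<alpha>" for \<alpha> :: multiindex
  have "inj G"
  proof (rule injI, rule poly_mapping_eqI)
    fix \<alpha> \<beta> :: multiindex and k assume e: "G \<alpha> = G \<beta>"
    have *: "(k, n) \<in> G \<gamma> \<longleftrightarrow> n \<noteq> 0 \<and> Poly_Mapping.lookup \<gamma> k = n" for n \<gamma>
      unfolding G_def by (auto simp: in_keys_iff)
    show "Poly_Mapping.lookup \<alpha> k = Poly_Mapping.lookup \<beta> k"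
      using *[of _ \<alpha>] *[of _ \<beta>] e by metis
  qed
  moreover have "countable (range G)"
    by (rule countable_subset[OF _ countable_Collect_finite]) (auto simp: G_def)
  ultimately show ?thesis by (rule countable_image_inj_on[rotated])
qed

text \<open>Immediate predecessors only, without transitive closure: exactly the indices at which
  \<open>wick_coeff\<close> at \<alpha> evaluates the series.\<close>

definition multiindex_order :: "(multiindex \<times> multiindex) set" where
  "multiindex_order = {(\<beta>, \<alpha>). \<exists>k\<in>Poly_Mapping.keys \<alpha>. \<beta> = \<alpha> - unit_index k}"

lemma wf_multiindex_order: "wf multiindex_order"
proof (rule wf_subset[OF wf_measure])
  let ?d = "\<lambda>\<alpha>::multiindex. \<Sum>k\<in>Poly_Mapping.keys \<alpha>. Poly_Mapping.lookup \<alpha> k"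
  show "multiindex_order \<subseteq> Wellfounded.measure ?d"
  proof
    fix x assume "x \<in> multiindex_order"
    then obtain \<alpha> k where k: "k \<in> Poly_Mapping.keys \<alpha>" and x: "x = (\<alpha> - unit_index k, \<alpha>)"
      unfolding multiindex_order_def by auto
    \<comment> \<open>Subtraction is truncated; the sum of the entries drops strictly because k is a
      key.\<close>
    have l: "Poly_Mapping.lookup (\<alpha> - unit_index k) i = Poly_Mapping.lookup \<alpha> i - (if i = k then 1 else 0)" for i
      by (simp add: lookup_minus lookup_single when_def)
    have "?d (\<alpha> - unit_index k) = (\<Sum>i\<in>Poly_Mapping.keys \<alpha>. Poly_Mapping.lookup (\<alpha> - unit_index k) i)"
      by (rule sum.mono_neutral_left) (auto simp: in_keys_iff l[simplified])
    also have "\<dots> < ?d \<alpha>"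
      by (rule sum_strict_mono_ex1) (use k in \<open>auto simp: l[simplified] in_keys_iff intro!: bexI[of _ k]\<close>)
    finally show "x \<in> Wellfounded.measure ?d" by (simp add: x)
  qed
qed

lemma multiindex_order_I: "k \<in> Poly_Mapping.keys \<alpha> \<Longrightarrow> (\<alpha> - unit_index k, \<alpha>) \<in> multiindex_order"
  unfolding multiindex_order_def by blast

lemma wick_coeff_cong:
  assumes "\<And>\<beta>. (\<beta>, \<alpha>) \<in> multiindex_order \<Longrightarrow> u \<beta> = v \<beta>"
  shows "wick_coeff M u \<alpha> = wick_coeff M v \<alpha>"
  unfolding wick_coeff_def using assms multiindex_order_I by (intro sum.cong) auto

lemma continuous_on_wick_coeff:
  assumes M: "\<And>k. bounded_linear (M k)"
    and u: "\<And>\<beta>. (\<beta>, \<alpha>) \<in> multiindex_order \<Longrightarrow> continuous_on S (u \<beta>)"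
  shows "continuous_on S (\<lambda>s. wick_coeff M (\<lambda>\<beta>. u \<beta> s) \<alpha>)"
  unfolding wick_coeff_def
  by (intro continuous_on_sum continuous_on_scaleR continuous_on_const bounded_linear.continuous_on[OF M] u multiindex_order_I)

lemma tendsto_wick_coeff:
  assumes M: "\<And>k. bounded_linear (M k)"
    and u: "\<And>\<beta>. (\<beta>, \<alpha>) \<in> multiindex_order \<Longrightarrow> (u \<beta> \<longlongrightarrow> l \<beta>) F"
  shows "((\<lambda>s. wick_coeff M (\<lambda>\<beta>. u \<beta> s) \<alpha>) \<longlongrightarrow> wick_coeff M l \<alpha>) F"
  unfolding wick_coeff_def
  by (intro tendsto_sum tendsto_scaleR tendsto_const bounded_linear.tendsto[OF M] u multiindex_order_I)

section \<open>Choice of weights and convergence of weighted norms\<close>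

lemma summable_on_geometric_multiindex:
  fixes n :: "multiindex \<Rightarrow> nat"
  assumes "inj n"
  shows "(\<lambda>\<alpha>. (1/4::real) ^ n \<alpha>) summable_on UNIV"
proof -
  have "(\<lambda>k. (1/4::real) ^ k) summable_on UNIV"
    by (subst summable_on_UNIV_nonneg_real_iff) (auto intro: summable_geometric)
  then have "(\<lambda>k. (1/4::real) ^ k) summable_on range n" by (rule summable_on_subset_banach) simp
  then show ?thesis using summable_on_reindex[OF assms, of "\<lambda>k. (1/4::real) ^ k"] by (simp add: o_def)
qed

text \<open>As the multi-indices are countable, a single system of weights tames countably many
  coefficients for all times at once: the index with number \<open>n\<close> is weighted so as to be
  small up to time \<open>n\<close>, and each \<open>T\<close> exceeds only finitely many \<open>n\<close>.\<close>

lemma bounded_weights_exist: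
  fixes N :: "multiindex \<Rightarrow> real \<Rightarrow> real" and S :: "multiindex \<Rightarrow> real"
  assumes N0: "\<And>\<alpha> T. 0 \<le> N \<alpha> T" and N: "\<And>\<alpha> T T'. 0 < T \<Longrightarrow> T \<le> T' \<Longrightarrow> N \<alpha> T \<le> N \<alpha> T'" and S0: "\<And>\<alpha>. 0 \<le> S \<alpha>"
  shows "\<exists>r w. bounded_weights r \<and> (\<forall>T>0. (\<lambda>\<alpha>. (r \<alpha>)\<^sup>2 * (N \<alpha> T)\<^sup>2) summable_on UNIV) \<and>
    w summable_on UNIV \<and> (\<forall>\<alpha>. (r \<alpha>)\<^sup>2 * (S \<alpha>)\<^sup>2 \<le> w \<alpha>)"
proof -
  obtain n :: "multiindex \<Rightarrow> nat" where n: "inj n"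
    using countable_multiindex unfolding countable_def by blast
  \<comment> \<open>The summand 1 keeps the weights at most 1. The time at which \<open>N\<close> is
    taken is the number of the index, since \<open>N\<close> need not be bounded in time.\<close>
  define D where "D \<alpha> = 1 + N \<alpha> (real (n \<alpha>)) + S \<alpha>" for \<alpha>
  have D: "1 \<le> D \<alpha>" "N \<alpha> (real (n \<alpha>)) \<le> D \<alpha>" "S \<alpha> \<le> D \<alpha>" for \<alpha>
    unfolding D_def using N0[of \<alpha> "real (n \<alpha>)"] S0[of \<alpha>] by auto
  define r where "r \<alpha> = (1/2) ^ n \<alpha> / D \<alpha>" for \<alpha>
  define w where "w \<alpha> = (1/4::real) ^ n \<alpha>" for \<alpha>
  have w: "w summable_on UNIV" unfolding w_def by (rule summable_on_geometric_multiindex[OF n])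
  have r0: "0 < r \<alpha>" for \<alpha> unfolding r_def using D(1)[of \<alpha>] by simp
  have "r \<alpha> \<le> 1" for \<alpha>
    unfolding r_def using D(1)[of \<alpha>] power_le_one[of "1/2::real" "n \<alpha>"] by (simp add: divide_le_eq)
  then have bw: "bounded_weights r" unfolding bounded_weights_def using r0 by blast
  have rw: "(r \<alpha>)\<^sup>2 * x\<^sup>2 \<le> w \<alpha>" if "0 \<le> x" "x \<le> D \<alpha>" for \<alpha> x
  proof -
    have "r \<alpha> * x \<le> r \<alpha> * D \<alpha>" using that r0[of \<alpha>] by (intro mult_left_mono) auto
    also have "\<dots> = (1/2) ^ n \<alpha>" unfolding r_def using D(1)[of \<alpha>] by simp
    finally have "(r \<alpha> * x)\<^sup>2 \<le> ((1/2) ^ n \<alpha>)\<^sup>2" using that r0[of \<alpha>] by (intro power_mono) auto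
    moreover have "((1/2::real) ^ n \<alpha>)\<^sup>2 = w \<alpha>"
      unfolding w_def power2_eq_square by (simp flip: power_mult_distrib)
    ultimately show ?thesis by (simp add: power_mult_distrib)
  qed
  have "(\<lambda>\<alpha>. (r \<alpha>)\<^sup>2 * (N \<alpha> T)\<^sup>2) summable_on UNIV" if T: "0 < T" for T
  proof -
    \<comment> \<open>The finitely many indices numbered below T escape the bound by
      \<open>w\<close>; \<open>h\<close> accounts for their terms.\<close>
    define F where "F = {\<alpha>. real (n \<alpha>) < T}"
    have "finite (n -` {k. real k < T})"
    proof (rule finite_vimageI[OF _ n])
      have "{k. real k < T} \<subseteq> {..nat \<lceil>T\<rceil>}" by (auto simp: le_nat_iff) linarith
      then show "finite {k. real k < T}" by (rule finite_subset) simp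
    qed
    then have F: "finite F" unfolding F_def vimage_def by simp
    define h where "h \<alpha> = (if \<alpha> \<in> F then (r \<alpha>)\<^sup>2 * (N \<alpha> T)\<^sup>2 else 0)" for \<alpha>
    have hs: "h summable_on UNIV"
      by (rule finite_nonzero_values_imp_summable_on, rule finite_subset[OF _ F]) (auto simp: h_def)
    show ?thesis
    proof (rule summable_on_comparison_test[OF summable_on_add[OF w hs]])
      fix \<alpha>
      have w0: "0 \<le> w \<alpha>" unfolding w_def by simp
      show "(r \<alpha>)\<^sup>2 * (N \<alpha> T)\<^sup>2 \<le> w \<alpha> + h \<alpha>"
      proof (cases "\<alpha> \<in> F")
        case True then show ?thesis using w0 by (simp add: h_def)
      next
        case False
        then have "N \<alpha> T \<le> N \<alpha> (real (n \<alpha>))" using T by (intro N) (auto simp: F_def)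
        then show ?thesis using rw[OF N0, of \<alpha> T] D(2)[of \<alpha>] False by (simp add: h_def)
      qed
    qed simp
  qed
  moreover have "\<forall>\<alpha>. (r \<alpha>)\<^sup>2 * (S \<alpha>)\<^sup>2 \<le> w \<alpha>" using rw S0 D(3) by blast
  ultimately show ?thesis using bw w by blast
qed

text \<open>Dominated convergence for unordered sums along an arbitrary filter: a finite part tends
  to 0 and the rest is below the tail of w, each contributing at most e / 3.\<close>

lemma infsum_tendsto_0_dominated:
  fixes f :: "'a \<Rightarrow> 'b \<Rightarrow> real"
  assumes w: "w summable_on UNIV" and dom: "\<forall>\<^sub>F t in F. \<forall>\<alpha>. 0 \<le> f \<alpha> t \<and> f \<alpha> t \<le> w \<alpha>"
    and lim: "\<And>\<alpha>. (f \<alpha> \<longlongrightarrow> 0) F"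
  shows "((\<lambda>t. \<Sum>\<^sub>\<infinity>\<alpha>. f \<alpha> t) \<longlongrightarrow> 0) F"
proof (rule tendstoI)
  fix e :: real assume e: "0 < e"
  obtain A where A: "finite A" "dist (sum w A) (infsum w UNIV) \<le> e / 3"
    using infsum_finite_approximation[OF w, of "e/3"] e by auto
  have wA: "w summable_on (- A)" using w by (rule summable_on_subset_banach) simp
  have "infsum w (A \<union> - A) = infsum w A + infsum w (- A)"
    by (rule infsum_Un_disjoint) (use A wA in auto)
  then have tail: "infsum w (- A) \<le> e / 3" using A by (simp add: dist_real_def abs_le_iff)
  have "((\<lambda>t. \<Sum>\<alpha>\<in>A. f \<alpha> t) \<longlongrightarrow> (\<Sum>\<alpha>\<in>A. 0)) F" by (intro tendsto_sum lim)
  then have "\<forall>\<^sub>F t in F. (\<Sum>\<alpha>\<in>A. f \<alpha> t) < e / 3" using e by (intro order_tendstoD) auto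
  with dom show "\<forall>\<^sub>F t in F. dist (\<Sum>\<^sub>\<infinity>\<alpha>. f \<alpha> t) 0 < e"
  proof eventually_elim
    case (elim t)
    have s: "(\<lambda>\<alpha>. f \<alpha> t) summable_on UNIV"
      by (rule summable_on_comparison_test[OF w]) (use elim in auto)
    have sA: "(\<lambda>\<alpha>. f \<alpha> t) summable_on (- A)" using s by (rule summable_on_subset_banach) simp
    have "infsum (\<lambda>\<alpha>. f \<alpha> t) (A \<union> - A) = infsum (\<lambda>\<alpha>. f \<alpha> t) A + infsum (\<lambda>\<alpha>. f \<alpha> t) (- A)"
      by (rule infsum_Un_disjoint) (use A sA in auto)
    moreover have "infsum (\<lambda>\<alpha>. f \<alpha> t) (- A) \<le> infsum w (- A)"
      by (rule infsum_mono[OF sA wA]) (use elim in auto)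
    moreover have "0 \<le> (\<Sum>\<^sub>\<infinity>\<alpha>. f \<alpha> t)" by (rule infsum_nonneg) (use elim in auto)
    ultimately show ?case using elim(2) tail A e by (simp add: dist_real_def)
  qed
qed

text \<open>One term is at most the whole sum, so division by r \<alpha> transfers the limit.
  Eventual membership enters here: for a divergent sum the norm would be 0 and bound
  nothing.\<close>

lemma RL2_tendsto_at_top_coefficient:
  assumes r: "bounded_weights r" and lim: "RL2_tendsto_at_top r u v"
  shows "(u \<alpha> \<longlongrightarrow> v \<alpha>) at_top"
proof -
  have r0: "0 < r \<alpha>" using r unfolding bounded_weights_def by blast
  have "((\<lambda>t. u \<alpha> t - v \<alpha>) \<longlongrightarrow> 0) at_top"
  proof (rule Lim_null_comparison)
    let ?n = "\<lambda>t. RL2_norm r norm (\<lambda>\<alpha>. u \<alpha> t - v \<alpha>)"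
    show "((\<lambda>t. ?n t / r \<alpha>) \<longlongrightarrow> 0) at_top"
      using lim unfolding RL2_tendsto_at_top_def by (intro tendsto_divide_zero) blast
    have "\<forall>\<^sub>F t in at_top. (\<lambda>\<alpha>. u \<alpha> t - v \<alpha>) \<in> RL2_space r UNIV norm"
      using lim unfolding RL2_tendsto_at_top_def by blast
    then show "\<forall>\<^sub>F t in at_top. norm (u \<alpha> t - v \<alpha>) \<le> ?n t / r \<alpha>"
    proof eventually_elim
      case (elim t)
      then have "(\<lambda>\<alpha>. (r \<alpha>)\<^sup>2 * (norm (u \<alpha> t - v \<alpha>))\<^sup>2) summable_on UNIV" unfolding RL2_space_def by blast
      from finite_sum_le_infsum[OF this, of "{\<alpha>}"]
      have "(r \<alpha>)\<^sup>2 * (norm (u \<alpha> t - v \<alpha>))\<^sup>2 \<le> (\<Sum>\<^sub>\<infinity>\<alpha>. (r \<alpha>)\<^sup>2 * (norm (u \<alpha> t - v \<alpha>))\<^sup>2)" by simp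
      then have "r \<alpha> * norm (u \<alpha> t - v \<alpha>) \<le> ?n t"
        unfolding RL2_norm_def by (intro real_le_rsqrt) (simp add: power_mult_distrib)
      then show ?case using r0 by (simp add: field_simps)
    qed
  qed
  then show ?thesis by (rule LIM_zero_cancel)
qed

text \<open>Compactness bounds the deviation on [0,T], convergence beyond T. The weights need such a
  bound valid for all times at once.\<close>

lemma continuous_convergent_bounded:
  fixes U :: "real \<Rightarrow> 'a::real_normed_vector"
  assumes c: "continuous_on {0..} U" and l: "(U \<longlongrightarrow> L) at_top"
  shows "\<exists>B\<ge>0. \<forall>t\<ge>0. norm (U t - L) \<le> B"
proof -
  have "\<forall>\<^sub>F t in at_top. dist (U t) L < 1" using tendstoD[OF l, of 1] by simp
  then obtain T where T: "\<And>t. T \<le> t \<Longrightarrow> norm (U t - L) < 1"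
    unfolding eventually_at_top_linorder dist_norm by blast
  have "compact ((\<lambda>t. U t - L) ` {0..T})"
    by (intro compact_continuous_image continuous_intros continuous_on_subset[OF c]) auto
  then obtain B where B: "\<And>t. t \<in> {0..T} \<Longrightarrow> norm (U t - L) \<le> B"
    using compact_imp_bounded bounded_iff by (metis (no_types, lifting) imageI)
  have "norm (U t - L) \<le> max 1 B" if "0 \<le> t" for t
    using T[of t] B[of t] that by (cases "t \<le> T") (auto simp: less_imp_le)
  then show ?thesis by (intro exI[of _ "max 1 B"]) auto
qed

lemma L2V_norm_mono:
  assumes "g \<in> L2V_space iV T'" "T \<le> T'"
  shows "L2V_norm iV T g \<le> L2V_norm iV T' g"
  unfolding L2V_norm_def L2_norm_def
proof (intro real_sqrt_le_mono integral_mono_lebesgue_on_AE)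
  show "integrable (lebesgue_on {0<..<T'}) (\<lambda>s. (norm (inv iV (g s)))\<^sup>2)"
    using assms unfolding L2V_space_def L2_space_def by blast
qed (use assms in auto)

section \<open>The chaos expansion\<close>

context coercive_normal_triple
begin

text \<open>Both solutions come from one recursion: the source at \<alpha> contains the lower
  coefficients, and its limit in time is known only once these converge to their stationary
  counterparts.\<close>

lemma chaos_solution_exists:
  assumes M: "\<And>k. bounded_linear (M k)" and f: "\<And>\<alpha> T. 0 < T \<Longrightarrow> f \<alpha> \<in> L2_space T"
    and lim: "\<And>\<alpha>. (f \<alpha> \<longlongrightarrow> fstar \<alpha>) at_top"
  shows "\<exists>u ustar. evolution_solution iV iH A M f u0 u \<and> (\<forall>\<alpha>. \<forall>T>0. u \<alpha> \<in> L2V_space iV T) \<and>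
    stationary_solution iV iH A M fstar ustar \<and> (\<forall>\<alpha>. (u \<alpha> \<longlongrightarrow> iV (ustar \<alpha>)) at_top)"
proof -
  interpret iH: bounded_linear iH by (rule H_embedding)
  \<comment> \<open>Well-founded choice requires this condition to see F only at predecessors of
    \<alpha>, which the first case below checks.\<close>
  define Q where "Q F \<alpha> p \<longleftrightarrow>
      - A (snd p) = iH (fstar \<alpha> + wick_coeff M (\<lambda>\<beta>. iV (snd (F \<beta>))) \<alpha>) \<and>
      continuous_on {0..} (fst p) \<and> (\<forall>T>0. fst p \<in> L2V_space iV T) \<and>
      (\<forall>t\<ge>0. \<exists>I. ((\<lambda>s. A (inv iV (fst p s)) + iH (f \<alpha> s + wick_coeff M (\<lambda>\<beta>. fst (F \<beta>) s) \<alpha>)) has_integral I) {0..t} \<and>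
         iH (fst p t) = iH (u0 \<alpha>) + I) \<and> (fst p \<longlongrightarrow> iV (snd p)) at_top"
    for F :: "multiindex \<Rightarrow> (real \<Rightarrow> 'h) \<times> 'v" and \<alpha> p
  have "\<exists>F. \<forall>\<alpha>. Q F \<alpha> (F \<alpha>)"
  proof (rule dependent_wf_choice[OF wf_multiindex_order])
    fix F G :: "multiindex \<Rightarrow> (real \<Rightarrow> 'h) \<times> 'v" and \<alpha> p
    assume FG: "\<And>\<beta>. (\<beta>, \<alpha>) \<in> multiindex_order \<Longrightarrow> F \<beta> = G \<beta>"
    have 1: "wick_coeff M (\<lambda>\<beta>. iV (snd (F \<beta>))) \<alpha> = wick_coeff M (\<lambda>\<beta>. iV (snd (G \<beta>))) \<alpha>"
      by (rule wick_coeff_cong) (simp add: FG)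
    have 2: "wick_coeff M (\<lambda>\<beta>. fst (F \<beta>) s) \<alpha> = wick_coeff M (\<lambda>\<beta>. fst (G \<beta>) s) \<alpha>" for s
      by (rule wick_coeff_cong) (simp add: FG)
    show "Q F \<alpha> p = Q G \<alpha> p" unfolding Q_def 1 2 ..
  next
    fix \<alpha> and F :: "multiindex \<Rightarrow> (real \<Rightarrow> 'h) \<times> 'v"
    assume IH: "\<And>\<beta>. (\<beta>, \<alpha>) \<in> multiindex_order \<Longrightarrow> Q F \<beta> (F \<beta>)"
    have c: "continuous_on {0..} (fst (F \<beta>))" and l: "(fst (F \<beta>) \<longlongrightarrow> iV (snd (F \<beta>))) at_top"
      if "(\<beta>, \<alpha>) \<in> multiindex_order" for \<beta> using IH[OF that] unfolding Q_def by blast+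
    define g where "g s = f \<alpha> s + wick_coeff M (\<lambda>\<beta>. fst (F \<beta>) s) \<alpha>" for s
    define gs where "gs = fstar \<alpha> + wick_coeff M (\<lambda>\<beta>. iV (snd (F \<beta>))) \<alpha>"
    have "g \<in> L2_space T" if "0 < T" for T
      unfolding g_def[abs_def]
      by (intro L2_space_add[OF f[OF that]] L2_space_continuous continuous_on_wick_coeff[OF M] c)
    moreover have "(g \<longlongrightarrow> gs) at_top"
      unfolding g_def[abs_def] gs_def by (intro tendsto_add lim tendsto_wick_coeff[OF M] l)
    ultimately obtain U q where "- A q = iH gs" "continuous_on {0..} U" "\<forall>T>0. U \<in> L2V_space iV T"
      "\<forall>t\<ge>0. \<exists>I. ((\<lambda>s. A (inv iV (U s)) + iH (g s)) has_integral I) {0..t} \<and> iH (U t) = iH (u0 \<alpha>) + I"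
      "(U \<longlongrightarrow> iV q) at_top"
      using convergent_solution_exists[of g gs "u0 \<alpha>"] by blast
    then have "Q F \<alpha> (U, q)" unfolding Q_def g_def gs_def by simp
    then show "\<exists>p. Q F \<alpha> p" by blast
  qed
  then obtain F where F: "\<And>\<alpha>. Q F \<alpha> (F \<alpha>)" by blast
  define u where "u \<alpha> = fst (F \<alpha>)" for \<alpha>
  define ustar where "ustar \<alpha> = snd (F \<alpha>)" for \<alpha>
  note FF = F[unfolded Q_def iH.add, folded u_def ustar_def, folded add.assoc]
  have "evolution_solution iV iH A M f u0 u" "stationary_solution iV iH A M fstar ustar"
    unfolding evolution_solution_def stationary_solution_def using FF by blast+
  moreover have "\<forall>\<alpha>. \<forall>T>0. u \<alpha> \<in> L2V_space iV T" "\<forall>\<alpha>. (u \<alpha> \<longlongrightarrow> iV (ustar \<alpha>)) at_top"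
    using FF by blast+
  ultimately show ?thesis by blast
qed

lemma evolution_solution_unique:
  assumes u: "evolution_solution iV iH A M f u0 u" and uL: "\<And>\<alpha> T. 0 < T \<Longrightarrow> u \<alpha> \<in> L2V_space iV T"
    and w: "evolution_solution iV iH A M f u0 w" and wL: "\<And>\<alpha> T. 0 < T \<Longrightarrow> w \<alpha> \<in> L2V_space iV T"
  shows "\<forall>t\<ge>0. w \<alpha> t = u \<alpha> t"
proof (induction \<alpha> rule: wf_induct_rule[OF wf_multiindex_order])
  case (1 \<alpha>)
  note u' = u[unfolded evolution_solution_def add.assoc, rule_format, of \<alpha>]
  note w' = w[unfolded evolution_solution_def add.assoc, rule_format, of \<alpha>]
  show ?case
  proof (intro allI impI)
    fix t :: real assume t: "0 \<le> t"
    show "w \<alpha> t = u \<alpha> t"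
    proof (rule solution_unique[where x = "iH (u0 \<alpha>)", OF _ _ wL uL _ _ _ t])
      show "continuous_on {0..} (w \<alpha>)" "continuous_on {0..} (u \<alpha>)" using u' w' by blast+
      show "\<exists>I. ((\<lambda>s. A (inv iV (w \<alpha> s)) + (iH (f \<alpha> s) + iH (wick_coeff M (\<lambda>\<beta>. w \<beta> s) \<alpha>))) has_integral I) {0..t} \<and>
          iH (w \<alpha> t) = iH (u0 \<alpha>) + I" if "0 \<le> t" for t using w' that by blast
      show "\<exists>I. ((\<lambda>s. A (inv iV (u \<alpha> s)) + (iH (f \<alpha> s) + iH (wick_coeff M (\<lambda>\<beta>. u \<beta> s) \<alpha>))) has_integral I) {0..t} \<and>
          iH (u \<alpha> t) = iH (u0 \<alpha>) + I" if "0 \<le> t" for t using u' that by blast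
      fix s :: real assume s: "0 \<le> s"
      have "wick_coeff M (\<lambda>\<beta>. w \<beta> s) \<alpha> = wick_coeff M (\<lambda>\<beta>. u \<beta> s) \<alpha>"
        by (rule wick_coeff_cong) (use 1 s in blast)
      then show "iH (f \<alpha> s) + iH (wick_coeff M (\<lambda>\<beta>. w \<beta> s) \<alpha>) = iH (f \<alpha> s) + iH (wick_coeff M (\<lambda>\<beta>. u \<beta> s) \<alpha>)"
        by simp
    qed
  qed
qed

lemma stationary_solution_unique:
  assumes u: "stationary_solution iV iH A M f u" and w: "stationary_solution iV iH A M f w"
  shows "w = u"
proof
  fix \<alpha>
  show "w \<alpha> = u \<alpha>"
  proof (induction \<alpha> rule: wf_induct_rule[OF wf_multiindex_order])
    case (1 \<alpha>)
    have "wick_coeff M (\<lambda>\<beta>. iV (w \<beta>)) \<alpha> = wick_coeff M (\<lambda>\<beta>. iV (u \<beta>)) \<alpha>"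
      by (rule wick_coeff_cong) (simp add: 1)
    then have "- A (w \<alpha>) = - A (u \<alpha>)" using u w unfolding stationary_solution_def by metis
    then show ?case using A_inj by simp
  qed
qed

end

theorem theorem8:
  fixes P :: "'w measure"
    and W :: "'u::{real_inner, banach, second_countable_topology} \<Rightarrow> 'w \<Rightarrow> real"
    and e :: "nat \<Rightarrow> 'u"
    and iV :: "'v::{real_inner, banach} \<Rightarrow> 'h::{real_inner, banach}"
    and iH :: "'h \<Rightarrow> 'd::{real_inner, banach}"
    and pair :: "'d \<Rightarrow> 'v \<Rightarrow> real"
    and A :: "'v \<Rightarrow> 'd"
    and M :: "nat \<Rightarrow> 'h \<Rightarrow> 'h"
    and \<kappa> c :: real
    and rbar :: "multiindex \<Rightarrow> real"
    and f :: "(real \<Rightarrow> 'h) chaos_series"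
    and fstar u0 :: "'h chaos_series"
  assumes "gaussian_noise P W e"
    and "normal_triple iV iH pair"
    and "\<And>k. bounded_linear (M k)"
    and "bounded_linear A"
    and "\<kappa> > 0" and "c > 0"
    and "\<And>v. pair (A v) v + \<kappa> * (norm v)\<^sup>2 \<le> - c * (norm (iV v))\<^sup>2"
    and "bounded_weights rbar"
    and "\<And>T. T > 0 \<Longrightarrow> f \<in> RL2_space rbar (L2_space T) (L2_norm T)"
    and "fstar \<in> RL2_space rbar UNIV norm"
    and "RL2_tendsto_at_top rbar f fstar"
    and "u0 \<in> RL2_space rbar UNIV norm"
  shows "\<exists>r. bounded_weights r \<and>
    (\<exists>u ustar.
      (evolution_solution iV iH A M f u0 u \<and>
       (\<forall>T>0. u \<in> RL2_space r (L2V_space iV T) (L2V_norm iV T)) \<and>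
       (\<forall>w. evolution_solution iV iH A M f u0 w \<and>
            (\<forall>T>0. w \<in> RL2_space r (L2V_space iV T) (L2V_norm iV T)) \<longrightarrow>
            (\<forall>\<alpha>. \<forall>t\<ge>0. w \<alpha> t = u \<alpha> t))) \<and>
      (stationary_solution iV iH A M fstar ustar \<and>
       ustar \<in> RL2_space r UNIV norm \<and>
       (\<forall>w. stationary_solution iV iH A M fstar w \<and> w \<in> RL2_space r UNIV norm \<longrightarrow>
            w = ustar)) \<and>
      RL2_tendsto_at_top r u (\<lambda>\<alpha>. iV (ustar \<alpha>)))"
proof -
  interpret coercive_normal_triple iV iH pair A \<kappa> c
    using assms(2,4-7) by (simp add: coercive_normal_triple_def coercive_normal_triple_axioms_def)
  have f: "f \<alpha> \<in> L2_space T" if "0 < T" for \<alpha> T using assms(9)[OF that] unfolding RL2_space_def by blast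
  have flim: "(f \<alpha> \<longlongrightarrow> fstar \<alpha>) at_top" for \<alpha> by (rule RL2_tendsto_at_top_coefficient[OF assms(8,11)])
  obtain u ustar where u: "evolution_solution iV iH A M f u0 u" and uL: "\<And>\<alpha> T. 0 < T \<Longrightarrow> u \<alpha> \<in> L2V_space iV T"
    and us: "stationary_solution iV iH A M fstar ustar" and ul: "\<And>\<alpha>. (u \<alpha> \<longlongrightarrow> iV (ustar \<alpha>)) at_top"
    using chaos_solution_exists[where M = M and f = f and fstar = fstar and ?u0.0 = u0, OF assms(3) f flim]
    by blast
  have "continuous_on {0..} (u \<alpha>)" for \<alpha> using u unfolding evolution_solution_def by blast
  then have "\<forall>\<alpha>. \<exists>B\<ge>0. \<forall>t\<ge>0. norm (u \<alpha> t - iV (ustar \<alpha>)) \<le> B"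
    using continuous_convergent_bounded[OF _ ul] by blast
  then obtain B where B: "\<And>\<alpha>. 0 \<le> B \<alpha>" "\<And>\<alpha> t. 0 \<le> t \<Longrightarrow> norm (u \<alpha> t - iV (ustar \<alpha>)) \<le> B \<alpha>" by metis
  \<comment> \<open>One bound for two purposes: the deviation in H for all times, needed for the
    limit, and the V-norm of \<open>ustar\<close>, needed for its membership.\<close>
  define S where "S \<alpha> = B \<alpha> + norm (ustar \<alpha>)" for \<alpha>
  have "\<exists>r w. bounded_weights r \<and> (\<forall>T>0. (\<lambda>\<alpha>. (r \<alpha>)\<^sup>2 * (L2V_norm iV T (u \<alpha>))\<^sup>2) summable_on UNIV) \<and>
    w summable_on UNIV \<and> (\<forall>\<alpha>. (r \<alpha>)\<^sup>2 * (S \<alpha>)\<^sup>2 \<le> w \<alpha>)"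
  proof (rule bounded_weights_exist)
    show "0 \<le> L2V_norm iV T (u \<alpha>)" for \<alpha> T
      unfolding L2V_norm_def L2_norm_def by (simp add: integral_nonneg_AE)
    show "L2V_norm iV T (u \<alpha>) \<le> L2V_norm iV T' (u \<alpha>)" if "0 < T" "T \<le> T'" for \<alpha> T T'
      using that by (intro L2V_norm_mono uL) auto
    show "0 \<le> S \<alpha>" for \<alpha> unfolding S_def using B(1) by simp
  qed
  then obtain r w where r: "bounded_weights r" and rN: "\<And>T. 0 < T \<Longrightarrow> (\<lambda>\<alpha>. (r \<alpha>)\<^sup>2 * (L2V_norm iV T (u \<alpha>))\<^sup>2) summable_on UNIV"
    and ws: "w summable_on UNIV" and rw: "\<And>\<alpha>. (r \<alpha>)\<^sup>2 * (S \<alpha>)\<^sup>2 \<le> w \<alpha>" by blast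
  have rw': "(r \<alpha>)\<^sup>2 * x\<^sup>2 \<le> w \<alpha>" if "0 \<le> x" "x \<le> S \<alpha>" for \<alpha> x
  proof -
    have "(r \<alpha>)\<^sup>2 * x\<^sup>2 \<le> (r \<alpha>)\<^sup>2 * (S \<alpha>)\<^sup>2" using that by (intro mult_left_mono power_mono) auto
    then show ?thesis using rw[of \<alpha>] by simp
  qed
  have uR: "u \<in> RL2_space r (L2V_space iV T) (L2V_norm iV T)" if "0 < T" for T
    unfolding RL2_space_def using uL[OF that] rN[OF that] by simp
  have usR: "ustar \<in> RL2_space r UNIV norm"
    unfolding RL2_space_def
    using summable_on_comparison_test[OF ws, of "\<lambda>\<alpha>. (r \<alpha>)\<^sup>2 * (norm (ustar \<alpha>))\<^sup>2"] rw' B(1) by (simp add: S_def)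
  have dom: "0 \<le> (r \<alpha>)\<^sup>2 * (norm (u \<alpha> t - iV (ustar \<alpha>)))\<^sup>2 \<and> (r \<alpha>)\<^sup>2 * (norm (u \<alpha> t - iV (ustar \<alpha>)))\<^sup>2 \<le> w \<alpha>"
    if "0 \<le> t" for t \<alpha>
    using rw'[OF norm_ge_zero, of "u \<alpha> t - iV (ustar \<alpha>)" \<alpha>] B(2)[OF that, of \<alpha>] by (simp add: S_def add_increasing2)
  have T: "RL2_tendsto_at_top r u (\<lambda>\<alpha>. iV (ustar \<alpha>))"
    unfolding RL2_tendsto_at_top_def
  proof
    show "\<forall>\<^sub>F t in at_top. (\<lambda>\<alpha>. u \<alpha> t - iV (ustar \<alpha>)) \<in> RL2_space r UNIV norm"
      using eventually_ge_at_top[of 0]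
    proof eventually_elim
      case (elim t)
      have "(\<lambda>\<alpha>. (r \<alpha>)\<^sup>2 * (norm (u \<alpha> t - iV (ustar \<alpha>)))\<^sup>2) summable_on UNIV"
        by (rule summable_on_comparison_test[OF ws]) (use dom[OF elim] in auto)
      then show ?case unfolding RL2_space_def by simp
    qed
    have "((\<lambda>t. \<Sum>\<^sub>\<infinity>\<alpha>. (r \<alpha>)\<^sup>2 * (norm (u \<alpha> t - iV (ustar \<alpha>)))\<^sup>2) \<longlongrightarrow> 0) at_top"
    proof (rule infsum_tendsto_0_dominated[OF ws])
      show "\<forall>\<^sub>F t in at_top. \<forall>\<alpha>. 0 \<le> (r \<alpha>)\<^sup>2 * (norm (u \<alpha> t - iV (ustar \<alpha>)))\<^sup>2 \<and>
          (r \<alpha>)\<^sup>2 * (norm (u \<alpha> t - iV (ustar \<alpha>)))\<^sup>2 \<le> w \<alpha>"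
        using eventually_ge_at_top[of 0] by eventually_elim (use dom in blast)
      have "((\<lambda>t. (r \<alpha>)\<^sup>2 * (norm (u \<alpha> t - iV (ustar \<alpha>)))\<^sup>2) \<longlongrightarrow> (r \<alpha>)\<^sup>2 * (norm (iV (ustar \<alpha>) - iV (ustar \<alpha>)))\<^sup>2) at_top" for \<alpha>
        by (intro tendsto_intros ul)
      then show "((\<lambda>t. (r \<alpha>)\<^sup>2 * (norm (u \<alpha> t - iV (ustar \<alpha>)))\<^sup>2) \<longlongrightarrow> 0) at_top" for \<alpha> by simp
    qed
    then show "((\<lambda>t. RL2_norm r norm (\<lambda>\<alpha>. u \<alpha> t - iV (ustar \<alpha>))) \<longlongrightarrow> 0) at_top"
      unfolding RL2_norm_def using tendsto_real_sqrt by fastforce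
  qed
  \<comment> \<open>Whatever the weights, membership makes every coefficient square integrable in V,
    and uniqueness is coefficientwise.\<close>
  have uniq: "\<forall>\<alpha>. \<forall>t\<ge>0. w \<alpha> t = u \<alpha> t"
    if "evolution_solution iV iH A M f u0 w" "\<forall>T>0. w \<in> RL2_space r (L2V_space iV T) (L2V_norm iV T)" for w
    using evolution_solution_unique[OF u uL that(1)] that(2) unfolding RL2_space_def by blast
  show ?thesis
    by (rule exI[of _ r], intro conjI r exI[of _ u] exI[of _ ustar])
      (use u uR uniq us usR T stationary_solution_unique[OF us] in blast)+
qed

end
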